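(* Let $[a,b]\subset[0,\infty)$ be a finite closed interval and let $\varphi=(\varphi_1,\varphi_2)$ be a pair of real-valued functions in $C^1[a,b]$ such that $\varphi_1,\varphi_2$ are increasing, $\varphi_1+\varphi_2$ is strictly increasing, and $\varphi_1'(x)+\varphi_2'(x)>0$ for all $x\in[a,b]\setminus\{0\}$. Let $\psi_i(x)=\varphi_i(\sqrt{x})$ for $x\in[a^2,b^2]$, $i=1,2$, and assume further that $\psi_i\in C^{n-1}[a^2,b^2]$ for $i=1,2$ (this is equivalent to $\varphi_i\in C^{n-1}[a,b]$ if $a>0$). Then for any $T\in\mathbb{M}_n[a,b]$ the flow $\{F^\varphi_t(T)\}_{t\ge0}$ converges to a normal matrix as $t\to\infty$.
   Context: $\mathbb{M}_n$ is the algebra of $n\times n$ complex matrices, $|X|=(X^*X)^{1/2}$, $\sigma(\cdot)$ is the spectrum, $[A,B]=AB-BA$. $\mathbb{M}_n[a,b]=\{X\in\mathbb{M}_n: \sigma(|X|)\subset[a,b]\}$. For $X\in\mathbb{M}_n[a,b]$, $\varphi(X):=\varphi_1(|X|)-\varphi_2(|X^*|)$. "Increasing" means non-decreasing. $F^\varphi_t(T):=X(t)$, where $X:[0,\infty)\to\mathbb{M}_n[a,b]$ is the unique global solution of $\frac{dX(t)}{dt}=[\varphi(X(t)),X(t)]$, $X(0)=T$ (it exists and is unique whenever $\varphi_1,\varphi_2$ are increasing Lipschitz functions with $\varphi_1+\varphi_2$ strictly increasing). *)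

theory Defs
  imports "HOL-Analysis.Analysis"
begin

definition adj :: "complex ^ 'n ^ 'm \<Rightarrow> complex ^ 'm ^ 'n" where
  "adj A = (\<chi> i j. cnj (A $ j $ i))"

definition unitary_mat :: "complex ^ 'n ^ 'n \<Rightarrow> bool" where
  "unitary_mat U \<longleftrightarrow> adj U ** U = mat 1 \<and> U ** adj U = mat 1"

definition normal_mat :: "complex ^ 'n ^ 'n \<Rightarrow> bool" where
  "normal_mat A \<longleftrightarrow> adj A ** A = A ** adj A"

definition real_diag :: "('n \<Rightarrow> real) \<Rightarrow> complex ^ 'n ^ 'n" where
  "real_diag d = (\<chi> i j. if i = j then complex_of_real (d i) else 0)"

definition spectrum :: "complex ^ 'n ^ 'n \<Rightarrow> complex set" where
  "spectrum A = {z. \<not> invertible (A - mat z)}"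

definition comm_mat :: "complex ^ 'n ^ 'n \<Rightarrow> complex ^ 'n ^ 'n \<Rightarrow> complex ^ 'n ^ 'n" where
  "comm_mat A B = A ** B - B ** A"

text \<open>
  Functional calculus \<open>f(A)\<close> of a Hermitian matrix \<open>A\<close>, by unitary diagonalisation; \<open>f(A)\<close> does
  not depend on the diagonalisation chosen, and depends only on the restriction of \<open>f\<close> to the
  spectrum of \<open>A\<close>. The value is meaningful for Hermitian \<open>A\<close> only.
\<close>

definition herm_fun :: "(real \<Rightarrow> real) \<Rightarrow> complex ^ 'n ^ 'n \<Rightarrow> complex ^ 'n ^ 'n" where
  "herm_fun f A = (THE B. \<exists>U d. unitary_mat U \<and> A = U ** real_diag d ** adj U
                               \<and> B = U ** real_diag (\<lambda>i. f (d i)) ** adj U)"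

definition mat_abs :: "complex ^ 'n ^ 'n \<Rightarrow> complex ^ 'n ^ 'n" where
  "mat_abs X = herm_fun sqrt (adj X ** X)"

definition mats_between :: "real \<Rightarrow> real \<Rightarrow> (complex ^ 'n ^ 'n) set" where
  "mats_between a b = {X. spectrum (mat_abs X) \<subseteq> complex_of_real ` {a..b}}"

definition phi_mat ::
  "(real \<Rightarrow> real) \<Rightarrow> (real \<Rightarrow> real) \<Rightarrow> complex ^ 'n ^ 'n \<Rightarrow> complex ^ 'n ^ 'n" where
  "phi_mat \<phi>1 \<phi>2 X = herm_fun \<phi>1 (mat_abs X) - herm_fun \<phi>2 (mat_abs (adj X))"

text \<open>
  Only the values on \<open>[0,\<infinity>)\<close> of a solution \<open>X\<close> matter; the derivative at \<open>0\<close> is one-sided.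
\<close>

definition flow_solution ::
  "real \<Rightarrow> real \<Rightarrow> (real \<Rightarrow> real) \<Rightarrow> (real \<Rightarrow> real) \<Rightarrow> complex ^ 'n ^ 'n
    \<Rightarrow> (real \<Rightarrow> complex ^ 'n ^ 'n) \<Rightarrow> bool" where
  "flow_solution a b \<phi>1 \<phi>2 T X \<longleftrightarrow>
     X 0 = T \<and>
     (\<forall>t\<ge>0. X t \<in> mats_between a b \<and>
        (X has_vector_derivative comm_mat (phi_mat \<phi>1 \<phi>2 (X t)) (X t)) (at t within {0..}))"

text \<open>
  The description operator ranges over the value at time \<open>t\<close> because a solution is unique only on
  \<open>[0,\<infinity>)\<close>, not as a function on all of \<open>\<real>\<close>.
\<close>

definition flow ::
  "real \<Rightarrow> real \<Rightarrow> (real \<Rightarrow> real) \<Rightarrow> (real \<Rightarrow> real) \<Rightarrow> real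
    \<Rightarrow> complex ^ 'n ^ 'n \<Rightarrow> complex ^ 'n ^ 'n" where
  "flow a b \<phi>1 \<phi>2 t T = (THE Y. \<exists>X. flow_solution a b \<phi>1 \<phi>2 T X \<and> X t = Y)"

text \<open>
  \<open>Ck_on k f S\<close>: \<open>f\<close> is \<open>k\<close> times continuously differentiable on \<open>S\<close>, derivatives being taken
  within \<open>S\<close> (one-sided at the endpoints of a closed interval).
\<close>

primrec Ck_on :: "nat \<Rightarrow> (real \<Rightarrow> real) \<Rightarrow> real set \<Rightarrow> bool" where
  "Ck_on 0 f S \<longleftrightarrow> continuous_on S f"
| "Ck_on (Suc k) f S \<longleftrightarrow>
     (\<exists>f'. (\<forall>x\<in>S. (f has_real_derivative f' x) (at x within S)) \<and> Ck_on k f' S)"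

end

theory Submission
  imports Defs "HOL-Computational_Algebra.Fundamental_Theorem_Algebra"
begin

text \<open>
  Write \<open>H = X\<^sup>* X\<close>, \<open>K = X X\<^sup>*\<close> and \<open>\<psi>\<^sub>i(x) = \<phi>\<^sub>i(sqrt x)\<close>, so that the equation reads
  \<open>X' = [\<Phi>, X]\<close> with the Hermitian matrix \<open>\<Phi> = \<psi>\<^sub>1(H) - \<psi>\<^sub>2(K)\<close>. The norm of matrices is the
  Frobenius norm. In that norm a Lipschitz function of one variable gives a Lipschitz function of
  Hermitian matrices, so the flow comes from Picard iteration; the spectra of \<open>H\<close> and \<open>K\<close> stay in
  \<open>[a\<^sup>2, b\<^sup>2]\<close> because the trace of a suitable function of \<open>H\<close> cannot grow.

  \<^bold>\<open>Limit points are normal.\<close> The derivative of \<open>\<parallel>X\<parallel>\<^sup>2\<close> is \<open>2 Re tr \<Phi> (K - H)\<close>. Since \<open>H\<close> and \<open>K\<close>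
  have the same eigenvalues, it is a negative multiple of a weighted sum, over pairs of eigenvectors,
  of Bregman divergences of the convex antiderivatives of \<open>\<psi>\<^sub>1\<close> and \<open>\<psi>\<^sub>2\<close>. It is therefore nonpositive, and as
  \<open>\<psi>\<^sub>1 + \<psi>\<^sub>2\<close> is strictly increasing it vanishes only if \<open>H = K\<close>. LaSalle's principle does the rest
  (\<open>limit_normal\<close>).

  \<^bold>\<open>The limit point is unique.\<close> If \<open>T\<close> is not diagonalisable, \<open>X\<close> itself does not
  approach the normal matrices exponentially fast: the nilpotent part of a Jordan block decays only
  polynomially. What does converge exponentially fast are the Riesz projections. Each of them is a
  polynomial \<open>R = p(X)\<close> with \<open>p\<close> independent of time, because polynomial identities satisfied by \<open>T\<close> persist along the
  flow, and it satisfies \<open>R' = [\<Phi>, R]\<close>. Let \<open>D = R - R\<^sup>*\<close> be its defect from being orthogonal. Then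
  \<open>R' = O(\<parallel>D\<parallel>)\<close>, and the derivative of \<open>\<parallel>D\<parallel>\<^sup>2\<close> is exactly a quadratic form in \<open>D\<close>: the commutators
  \<open>[\<psi>\<^sub>1(H), R]\<close> and \<open>[\<psi>\<^sub>2(K), R]\<close> are Schur multipliers, by divided differences, of
  \<open>[H, R] = [X\<^sup>*, D] X\<close> and \<open>[K, R] = X [X\<^sup>*, D]\<close>. As \<open>X\<close> tends to a normal \<open>N\<close>, and the normalised
  defect to a limit again called \<open>D\<close>, the normalised form tends to
  \<open>-2 \<Sum> (\<psi>\<^sub>1 + \<psi>\<^sub>2)\<^sup>[\<^sup>1\<^sup>](h\<^sub>i, h\<^sub>j) \<bar>c\<^sub>i\<^sub>j\<bar>\<^sup>2\<close>, where \<open>C = [N, D]\<close> is written in an eigenbasis of \<open>N\<^sup>* N\<close>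
  with eigenvalues \<open>h\<^sub>i\<close> and the weights are divided differences. These are positive except
  possibly at \<open>h\<^sub>i = h\<^sub>j = 0\<close>, where \<open>c\<^sub>i\<^sub>j = 0\<close>; and \<open>C \<noteq> 0\<close>, since \<open>D\<close> is off-diagonal for the orthogonal projection \<open>p(N)\<close>.
  So the defect decays exponentially (\<open>defect_exponential_rate\<close>) and \<open>R\<close> converges (\<open>proj_convergent\<close>).
  Finally a normal limit point has no nilpotent part, so it is the sum of the eigenvalues times the
  limits of the Riesz projections (\<open>converges_to_normal\<close>).
\<close>

section \<open>Matrix algebra and the Frobenius norm\<close>

lemma mm_entry: "(A ** B) $ i $ j = (\<Sum>k\<in>UNIV. A $ i $ k * B $ k $ j)"
  by (simp add: matrix_matrix_mult_def)

lemma adj_entry [simp]: "adj A $ i $ j = cnj (A $ j $ i)"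
  by (simp add: adj_def)

lemma adj_adj [simp]: "adj (adj A) = A"
  by (simp add: vec_eq_iff)

lemma adj_mult: "adj (A ** B) = adj B ** adj A"
  by (simp add: vec_eq_iff mm_entry mult.commute)

lemma adj_add: "adj (A + B) = adj A + adj B" and adj_diff: "adj (A - B) = adj A - adj B"
  and adj_zero [simp]: "adj 0 = 0"
  and adj_scaleR: "adj (r *\<^sub>R A) = r *\<^sub>R adj A"
  by (simp_all add: vec_eq_iff)

lemma adj_mat1 [simp]: "adj (mat 1) = mat 1"
  by (simp add: vec_eq_iff mat_def)

lemma mm_diff_left: "(A - B) ** C = A ** C - B ** (C :: complex^'n^'n)"
  and mm_diff_right: "C ** (A - B) = C ** A - C ** (B :: complex^'n^'n)"
  and mm_add_left: "(A + B) ** C = A ** C + B ** (C :: complex^'n^'n)"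
  and mm_minus_left: "(- A) ** C = - (A ** (C :: complex^'n^'n))"
  and mm_minus_right: "A ** (- C) = - (A ** (C :: complex^'n^'n))"
  and mm_scaleR_left: "(r *\<^sub>R A) ** C = r *\<^sub>R (A ** (C :: complex^'n^'n))"
  and mm_scaleR_right: "A ** (r *\<^sub>R C) = r *\<^sub>R (A ** (C :: complex^'n^'n))"
  and mm_zero_left [simp]: "0 ** (C :: complex^'n^'n) = 0"
  and mm_zero_right [simp]: "(C :: complex^'n^'n) ** 0 = 0"
  by (simp_all add: vec_eq_iff mm_entry algebra_simps sum.distrib sum_subtractf sum_negf scaleR_sum_right)

text \<open>
  Square matrices are not an instance of a ring class for \<open>**\<close>; these equations
  replace the ring simplification rules, with products bracketed to the left.
\<close>
lemmas mm_ring = matrix_mul_assoc matrix_add_ldistrib mm_add_left mm_diff_left mm_diff_right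
  mm_minus_left mm_minus_right mm_scaleR_left mm_scaleR_right

lemma mm_real_diag: "(A ** real_diag d) $ i $ j = A $ i $ j * of_real (d j)"
  and real_diag_mm: "(real_diag d ** A) $ i $ j = of_real (d i) * A $ i $ j"
  by (simp_all add: mm_entry real_diag_def if_distrib[of "\<lambda>x. x * z" for z]
      if_distrib[of "\<lambda>x. z * x" for z] cong: if_cong)

lemma trace_adj: "trace (adj A) = cnj (trace A)"
  by (simp add: trace_def)

lemma trace_uminus: "trace (- (A :: complex^'n^'n)) = - trace A"
  and trace_scaleR: "trace (r *\<^sub>R (A :: complex^'n^'n)) = of_real r * trace A"
  by (simp_all add: trace_def sum_negf scaleR_conv_of_real[where 'a=complex] sum_distrib_left)

text \<open>
  The coordinatewise inner product of matrices is the real part of the trace pairing, so the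
  norm is the Frobenius norm; this is what makes the trace computations below norm computations.
\<close>
lemma inner_mat: "inner A B = Re (trace (adj A ** (B :: complex^'n^'n)))"
proof -
  have "inner A B = (\<Sum>i\<in>UNIV. \<Sum>j\<in>UNIV. Re (cnj (A$i$j) * B$i$j))"
    by (simp add: inner_vec_def inner_complex_def)
  also have "\<dots> = (\<Sum>j\<in>UNIV. \<Sum>i\<in>UNIV. Re (cnj (A$i$j) * B$i$j))"
    by (rule sum.swap)
  finally show ?thesis by (simp add: trace_def mm_entry)
qed

lemma norm_mat_sq: "(norm (A :: complex^'n^'n))\<^sup>2 = (\<Sum>i\<in>UNIV. \<Sum>j\<in>UNIV. (cmod (A$i$j))\<^sup>2)"
  by (simp add: norm_vec_def L2_set_def sum_nonneg)

lemma norm_sq_trace: "(norm (A :: complex^'n^'n))\<^sup>2 = Re (trace (adj A ** A))"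
  by (simp add: power2_norm_eq_inner inner_mat)

lemma norm_adj [simp]: "norm (adj (A :: complex^'n^'n)) = norm A"
proof -
  have "(norm (adj A))\<^sup>2 = (norm A)\<^sup>2"
    unfolding norm_sq_trace by (simp add: trace_mul_sym[of A])
  thus ?thesis by simp
qed

text \<open>Cauchy-Schwarz in each entry of the product.\<close>
lemma norm_mm_le: "norm (A ** B) \<le> norm (A :: complex^'n^'n) * norm (B :: complex^'n^'n)"
proof -
  have "(norm (A ** B))\<^sup>2 \<le> (\<Sum>i\<in>UNIV. \<Sum>j\<in>UNIV. (\<Sum>k\<in>UNIV. (cmod (A$i$k))\<^sup>2) * (\<Sum>k\<in>UNIV. (cmod (B$k$j))\<^sup>2))"
    unfolding norm_mat_sq mm_entry
  proof (intro sum_mono)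
    fix i j
    have "cmod (\<Sum>k\<in>UNIV. A$i$k * B$k$j) \<le> (\<Sum>k\<in>UNIV. cmod (A$i$k) * cmod (B$k$j))"
      by (rule order_trans[OF norm_sum]) (simp add: norm_mult)
    hence "(cmod (\<Sum>k\<in>UNIV. A$i$k * B$k$j))\<^sup>2 \<le> (\<Sum>k\<in>UNIV. cmod (A$i$k) * cmod (B$k$j))\<^sup>2"
      by (intro power_mono) auto
    also have "\<dots> \<le> (\<Sum>k\<in>UNIV. (cmod (A$i$k))\<^sup>2) * (\<Sum>k\<in>UNIV. (cmod (B$k$j))\<^sup>2)"
      by (rule Cauchy_Schwarz_ineq_sum)
    finally show "(cmod (\<Sum>k\<in>UNIV. A$i$k * B$k$j))\<^sup>2 \<le> (\<Sum>k\<in>UNIV. (cmod (A$i$k))\<^sup>2) * (\<Sum>k\<in>UNIV. (cmod (B$k$j))\<^sup>2)" .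
  qed
  also have "\<dots> = (norm A * norm B)\<^sup>2"
    unfolding power_mult_distrib norm_mat_sq sum_product[symmetric]
    by (rule arg_cong[where f = "(*) _"], rule sum.swap)
  finally show ?thesis by (rule power2_le_imp_le) simp
qed

lemma norm_comm_mat: "norm (comm_mat A B) \<le> 2 * norm A * norm (B :: complex^'n^'n)"
  unfolding comm_mat_def
  by (rule order_trans[OF norm_triangle_ineq4]) (use norm_mm_le[of A B] norm_mm_le[of B A] in \<open>simp add: mult_ac\<close>)

lemma bounded_bilinear_mm: "bounded_bilinear ((**) :: complex^'n^'n \<Rightarrow> complex^'n^'n \<Rightarrow> complex^'n^'n)"
  by (rule bounded_bilinear.intro)
     (auto simp: mm_ring intro!: exI[of _ 1] norm_mm_le)

lemma bounded_linear_adj: "bounded_linear (adj :: complex^'n^'n \<Rightarrow> _)"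
  by (rule bounded_linear_intro[of _ 1]) (auto simp: adj_add adj_scaleR)

lemma bounded_linear_trace: "bounded_linear (trace :: complex^'n^'n \<Rightarrow> _)"
  unfolding linear_conv_bounded_linear[symmetric]
  by (rule linearI) (rule trace_add, rule trans[OF trace_scaleR scaleR_conv_of_real[symmetric]])

lemmas tendsto_mm = bounded_bilinear.tendsto[OF bounded_bilinear_mm]
lemmas tendsto_adj = bounded_linear.tendsto[OF bounded_linear_adj]
lemmas tendsto_trace = bounded_linear.tendsto[OF bounded_linear_trace]

section \<open>The spectral theorem for Hermitian matrices\<close>

text \<open>
  The Rayleigh quotient is maximal on the unit sphere of the invariant subspace \<open>S\<close>
  at an eigenvector. Working inside a subspace is what allows eigenvectors to be collected one
  after the other.
\<close>
lemma self_adjoint_eigenvector: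
  fixes f :: "'a::euclidean_space \<Rightarrow> 'a"
  assumes lin: "linear f" and sym: "\<And>x y. inner (f x) y = inner x (f y)"
    and S: "subspace S" and inv: "\<And>x. x \<in> S \<Longrightarrow> f x \<in> S" and ne: "z \<in> S" "z \<noteq> 0"
  shows "\<exists>x\<in>S. \<exists>\<mu>. norm x = 1 \<and> f x = \<mu> *\<^sub>R x"
proof -
  let ?K = "sphere 0 1 \<inter> S"
  have "compact ?K" by (intro compact_Int_closed compact_sphere closed_subspace S)
  moreover have "z /\<^sub>R norm z \<in> ?K" using ne S by (auto simp: subspace_scale)
  hence "?K \<noteq> {}" by blast
  moreover have "continuous_on ?K (\<lambda>x. inner x (f x))"
    using lin by (intro continuous_on_inner continuous_on_id linear_continuous_on)
      (simp add: linear_conv_bounded_linear)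
  ultimately obtain x where x: "x \<in> ?K" and mx: "\<And>y. y \<in> ?K \<Longrightarrow> inner y (f y) \<le> inner x (f x)"
    using continuous_attains_sup[of ?K "\<lambda>x. inner x (f x)"] by blast
  define \<mu> where "\<mu> = inner x (f x)"
  \<comment> \<open>the residual: testing maximality in the direction \<open>r\<close> shows that it
    vanishes\<close>
  define r where "r = f x - \<mu> *\<^sub>R x"
  have q: "inner y (f y) \<le> \<mu> * (norm y)\<^sup>2" if "y \<in> S" for y
  proof (cases "y = 0")
    case False
    have "inner (y /\<^sub>R norm y) (f (y /\<^sub>R norm y)) \<le> \<mu>"
      unfolding \<mu>_def using that False S by (intro mx) (auto simp: subspace_scale)
    moreover have "inner (y /\<^sub>R norm y) (f (y /\<^sub>R norm y)) = inner y (f y) / (norm y)\<^sup>2"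
      unfolding linear_scale[OF lin] by (simp add: power2_eq_square divide_inverse)
    ultimately have "inner y (f y) / (norm y)\<^sup>2 \<le> \<mu>" by (simp only:)
    thus ?thesis using False by (simp add: divide_le_eq)
  qed (simp add: linear_0[OF lin])
  have nx: "inner x x = 1" using x by (simp add: dot_square_norm)
  have rS: "r \<in> S" unfolding r_def using x S inv by (auto intro: subspace_diff subspace_scale)
  have xr: "inner x r = 0" by (simp add: r_def inner_diff_right nx \<mu>_def)
  have rf: "inner r (f x) = inner r r"
    using xr by (simp add: r_def inner_diff_right inner_commute)
  have *: "2 * inner r r \<le> s * (\<mu> * inner r r - inner r (f r))" if "s > 0" for s
  proof -
    have "inner (x + s *\<^sub>R r) (f (x + s *\<^sub>R r)) \<le> \<mu> * (norm (x + s *\<^sub>R r))\<^sup>2"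
      by (rule q) (use x rS S in \<open>auto intro: subspace_add subspace_scale\<close>)
    also have "inner (x + s *\<^sub>R r) (f (x + s *\<^sub>R r)) = \<mu> + 2 * s * inner r r + s * s * inner r (f r)"
      using rf sym[of x r]
      by (simp add: linear_add[OF lin] linear_scale[OF lin] inner_add_left inner_add_right \<mu>_def algebra_simps inner_commute)
    also have "(norm (x + s *\<^sub>R r))\<^sup>2 = 1 + s * s * inner r r"
      using xr nx unfolding power2_norm_eq_inner by (simp add: inner_add_left inner_add_right inner_commute)
    finally have "s * (2 * inner r r) \<le> s * (s * (\<mu> * inner r r - inner r (f r)))"
      by (simp add: algebra_simps)
    thus ?thesis using that by (simp add: mult_le_cancel_left)
  qed
  have "r = 0"
  proof (rule ccontr)
    assume "r \<noteq> 0"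
    hence p: "inner r r > 0" by simp
    define c where "c = \<mu> * inner r r - inner r (f r)"
    \<comment> \<open>a step so small that the quadratic term cannot compensate the linear one\<close>
    have "2 * inner r r \<le> (inner r r / (1 + \<bar>c\<bar>)) * c"
      unfolding c_def by (rule *) (use p in \<open>simp add: divide_pos_pos add_pos_nonneg\<close>)
    also have "\<dots> \<le> inner r r * 1"
      using p mult_left_mono[of "c / (1 + \<bar>c\<bar>)" 1 "inner r r"] by (simp add: divide_le_eq)
    finally show False using p by simp
  qed
  thus ?thesis using x by (auto simp: r_def)
qed

text \<open>The Hermitian inner product, conjugate linear in its first argument.\<close>
definition cinner :: "complex^'n \<Rightarrow> complex^'n \<Rightarrow> complex" where
  "cinner x y = (\<Sum>i\<in>UNIV. cnj (x $ i) * y $ i)"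

lemma inner_cinner: "inner x y = Re (cinner x y)"
  by (simp add: inner_vec_def cinner_def inner_complex_def)

lemma cinner_adj: "cinner (adj A *v x) y = cinner x (A *v y)"
  unfolding cinner_def matrix_vector_mult_def
  by (simp add: sum_distrib_left sum_distrib_right mult_ac) (subst sum.swap, simp add: mult_ac)

lemma cinner_scale: "cinner (c *s x) y = cnj c * cinner x y" "cinner x (c *s y) = c * cinner x y"
   "cinner (r *\<^sub>R x) y = of_real r * cinner x y" "cinner x (r *\<^sub>R y) = of_real r * cinner x y"
  by (simp_all add: cinner_def sum_distrib_left mult_ac scaleR_conv_of_real[where 'a=complex])

lemma cinner_add: "cinner x (y + z) = cinner x y + cinner x z"
  by (simp add: cinner_def algebra_simps sum.distrib)

lemma cinner_commute: "cinner x y = cnj (cinner y x)"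
  by (simp add: cinner_def mult.commute)

lemma cinner_self: "cinner x x = of_real ((norm x)\<^sup>2)"
proof -
  have "cnj z * z = of_real ((cmod z)\<^sup>2)" for z
    by (metis complex_norm_square mult.commute)
  thus ?thesis by (simp add: cinner_def norm_vec_def L2_set_def sum_nonneg)
qed

text \<open>
  The eigenvectors found so far are indexed by the subset \<open>J\<close> of the coordinate
  type, which makes the induction possible although the dimension is a type. Their orthogonal
  complement is invariant, and nonzero for reasons of real dimension, as \<open>u\<close> and
  \<open>\<i> u\<close> together span less than everything.
\<close>
lemma hermitian_eigenbasis_partial:
  fixes A :: "complex^'n^'n" and J :: "'n set"
  assumes A: "adj A = A" and "finite J"
  shows "\<exists>u d. (\<forall>i\<in>J. \<forall>j\<in>J. cinner (u i) (u j) = (if i = j then 1 else 0)) \<and>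
           (\<forall>i\<in>J. A *v u i = (d i :: real) *\<^sub>R u i)"
  using \<open>finite J\<close>
proof (induction J rule: finite_induct)
  case (insert k J)
  then obtain u :: "'n \<Rightarrow> complex^'n" and d where u: "\<And>i j. i \<in> J \<Longrightarrow> j \<in> J \<Longrightarrow> cinner (u i) (u j) = (if i = j then 1 else 0)"
    and d: "\<And>i. i \<in> J \<Longrightarrow> A *v u i = d i *\<^sub>R u i" by blast
  define S where "S = {x. \<forall>i\<in>J. cinner (u i) x = 0}"
  have S: "subspace S"
    unfolding S_def subspace_def by (auto simp: cinner_add cinner_scale) (simp add: cinner_def)
  have inv: "A *v x \<in> S" if "x \<in> S" for x
  proof -
    have "cinner (u i) (A *v x) = of_real (d i) * cinner (u i) x" if "i \<in> J" for i
      using cinner_adj[of A "u i" x] d[OF that] by (simp add: A cinner_scale)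
    thus ?thesis using that by (simp add: S_def)
  qed
  let ?B = "u ` J \<union> (\<lambda>i. \<i> *s u i) ` J"
  have "card ?B \<le> card J + card J"
    by (rule order_trans[OF card_Un_le]) (intro add_mono card_image_le insert.hyps(1))
  moreover have "card J < CARD('n)"
    using insert.hyps by (intro psubset_card_mono) auto
  ultimately have "dim ?B < DIM(complex^'n)"
    using dim_le_card[OF span_superset, of ?B] insert.hyps(1) by simp
  then obtain z where z: "z \<noteq> 0" "\<And>y. y \<in> span ?B \<Longrightarrow> orthogonal z y"
    using orthogonal_to_subspace_exists by blast
  have "z \<in> S" unfolding S_def
  proof (intro CollectI ballI)
    fix i assume i: "i \<in> J"
    have "inner z (u i) = 0" "inner z (\<i> *s u i) = 0"
      using z(2) i by (auto simp: orthogonal_def span_base)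
    thus "cinner (u i) z = 0"
      unfolding inner_cinner cinner_scale cinner_commute[of "u i"] by (simp add: complex_eq_iff)
  qed
  moreover have "inner (A *v x) y = inner x (A *v y)" for x y
    using cinner_adj[of A x y] by (simp add: A inner_cinner)
  ultimately obtain x \<mu> where x: "x \<in> S" "norm x = 1" "A *v x = \<mu> *\<^sub>R x"
    using self_adjoint_eigenvector[of "(*v) A" S z] S inv z(1) by auto
  let ?u = "u(k := x)" and ?d = "d(k := \<mu>)"
  have xu: "cinner (u i) x = 0" "cinner x (u i) = 0" if "i \<in> J" for i
    using x(1) that cinner_commute[of x "u i"] by (auto simp: S_def)
  have "\<forall>i\<in>insert k J. \<forall>j\<in>insert k J. cinner (?u i) (?u j) = (if i = j then 1 else 0)"
    using u xu x(2) insert.hyps(2) cinner_self[of x] by auto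
  moreover have "\<forall>i\<in>insert k J. A *v ?u i = ?d i *\<^sub>R ?u i"
    using d x(3) insert.hyps(2) by auto
  ultimately show ?case by blast
qed auto

lemma unitary_matI: "adj U ** U = mat 1 \<Longrightarrow> unitary_mat U"
  using matrix_left_right_inverse[of "adj U" U] by (simp add: unitary_mat_def)

lemma hermitian_diagonalisable:
  fixes A :: "complex^'n^'n"
  assumes A: "adj A = A"
  obtains U d where "unitary_mat U" "A = U ** real_diag d ** adj U"
proof -
  obtain u :: "'n \<Rightarrow> complex^'n" and d where u: "\<And>i j. cinner (u i) (u j) = (if i = j then 1 else 0)"
    and d: "\<And>i. A *v u i = d i *\<^sub>R u i"
    using hermitian_eigenbasis_partial[OF A, of UNIV] by auto
  define U :: "complex^'n^'n" where "U = (\<chi> i j. u j $ i)"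
  have "adj U ** U = mat 1"
    using u by (simp add: vec_eq_iff mm_entry U_def mat_def cinner_def)
  hence U: "unitary_mat U" by (rule unitary_matI)
  have "A ** U = U ** real_diag d"
  proof -
    have "(A ** U) $ i $ j = of_real (d j) * u j $ i" for i j
      using arg_cong[OF d[of j], of "\<lambda>v. v $ i"]
      by (simp add: U_def mm_entry matrix_vector_mult_def scaleR_conv_of_real[where 'a=complex])
    thus ?thesis by (simp add: vec_eq_iff mm_real_diag U_def mult.commute)
  qed
  hence "A = U ** real_diag d ** adj U"
    using U by (metis unitary_mat_def matrix_mul_assoc matrix_mul_rid)
  thus ?thesis using U that by blast
qed

section \<open>Polynomials in a matrix\<close>

text \<open>Horner evaluation of a polynomial at a matrix.\<close>
definition pmat :: "complex poly \<Rightarrow> complex^'n^'n \<Rightarrow> complex^'n^'n" where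
  "pmat p A = fold_coeffs (\<lambda>a B. mat a + A ** B) p 0"

lemma mat_0 [simp]: "mat 0 = (0 :: complex^'n^'n)"
  by (simp add: vec_eq_iff mat_def)

lemma mat_mm_entry: "(mat c ** A) $ i $ j = c * A $ i $ j"
  and mm_mat_entry: "(A ** mat c) $ i $ j = A $ i $ j * (c::complex)"
  by (simp_all add: mm_entry mat_def if_distrib[of "\<lambda>x. x * z" for z]
      if_distrib[of "\<lambda>x. z * x" for z] cong: if_cong)

lemma mat_mm_commute: "mat c ** A = A ** mat (c::complex)"
  by (simp add: vec_eq_iff mat_mm_entry mm_mat_entry mult.commute)

lemma mat_add: "mat (a + b) = mat a + (mat b :: complex^'n^'n)"
  and mat_mult: "mat (a * b) = mat a ** (mat b :: complex^'n^'n)"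
  by (simp_all add: vec_eq_iff mat_mm_entry) (simp_all add: mat_def)

lemma pmat_0 [simp]: "pmat 0 A = 0"
  by (simp add: pmat_def)

lemma pmat_pCons [simp]: "pmat (pCons a p) A = mat a + A ** pmat p A"
  by (cases "p = 0 \<and> a = 0") (auto simp: pmat_def)

lemma pmat_1 [simp]: "pmat 1 A = mat 1"
  by (simp add: one_pCons)

lemma pmat_add: "pmat (p + q) A = pmat p A + pmat q A"
  by (induction p q rule: poly_induct2) (simp_all add: mat_add matrix_add_ldistrib)

lemma pmat_smult: "pmat (smult c p) A = mat c ** pmat p A"
  by (induction p) (simp_all add: mat_mult matrix_add_ldistrib matrix_mul_assoc mat_mm_commute[of c A])

lemma pmat_mult: "pmat (p * q) A = pmat p A ** pmat q A"
  by (induction p) (simp_all add: pmat_add pmat_smult mm_add_left matrix_mul_assoc)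

lemma pmat_uminus: "pmat (- p) A = - pmat p A"
  using pmat_add[of "- p" p A] by (simp add: eq_neg_iff_add_eq_0)

lemma pmat_diff: "pmat (p - q) A = pmat p A - pmat q A"
  using pmat_add[of p "- q" A] by (simp add: pmat_uminus)

lemma pmat_sum: "pmat (\<Sum>i\<in>I. p i) A = (\<Sum>i\<in>I. pmat (p i) A)"
  by (induction I rule: infinite_finite_induct) (simp_all add: pmat_add)

text \<open>
  Used with \<open>A = X\<^sup>* X\<close> and \<open>B = X X\<^sup>*\<close>, with
  unitary \<open>X\<close>, and with \<open>A = B\<close>, where it says that whatever
  commutes with \<open>A\<close> commutes with each polynomial in \<open>A\<close>.
\<close>
lemma pmat_intertwine:
  assumes "X ** A = B ** (X :: complex^'n^'n)"
  shows "X ** pmat p A = pmat p B ** X"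
proof (induction p)
  case (pCons a p)
  have "X ** (A ** pmat p A) = B ** (X ** pmat p A)"
    by (simp add: matrix_mul_assoc assms)
  thus ?case by (simp add: pCons matrix_add_ldistrib mm_add_left mat_mm_commute[of a X] matrix_mul_assoc)
qed simp

lemma pmat_similar:
  assumes "unitary_mat U"
  shows "pmat p (U ** A ** adj U) = U ** pmat p A ** adj U"
proof -
  have "U ** A = (U ** A ** adj U) ** U"
    using assms by (metis unitary_mat_def matrix_mul_assoc matrix_mul_rid)
  from pmat_intertwine[OF this] show ?thesis
    using assms by (metis unitary_mat_def matrix_mul_assoc matrix_mul_rid)
qed

lemma pmat_real_diag:
  assumes "\<And>i. poly p (of_real (d i)) = of_real (f (d i))"
  shows "pmat p (real_diag d) = real_diag (\<lambda>i. f (d i))"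
proof -
  have "pmat p (real_diag d) $ i $ j = (if i = j then poly p (of_real (d i)) else 0)" for i j
    by (induction p) (auto simp: mat_def real_diag_mm)
  thus ?thesis by (simp add: vec_eq_iff assms real_diag_def)
qed

lemma tendsto_pmat: "(f \<longlongrightarrow> A) F \<Longrightarrow> ((\<lambda>x. pmat p (f x)) \<longlongrightarrow> pmat p A) F"
  by (induction p) (auto intro: tendsto_add tendsto_mm)

lemma polynomial_interpolation:
  fixes f :: "real \<Rightarrow> real"
  assumes "finite S"
  obtains p :: "complex poly" where "\<And>x. x \<in> S \<Longrightarrow> poly p (of_real x) = of_real (f x)"
proof -
  have "\<exists>p :: complex poly. \<forall>x\<in>S. poly p (of_real x) = of_real (f x)"
    using assms
  proof (induction S rule: finite_induct)
    case (insert y S)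
    then obtain p :: "complex poly" where p: "\<forall>x\<in>S. poly p (of_real x) = of_real (f x)" by blast
    define q :: "complex poly" where "q = (\<Prod>s\<in>S. [:- of_real s, 1:])"
    have q: "poly q (of_real x) = (\<Prod>s\<in>S. of_real x - of_real s)" for x :: real
      by (simp add: q_def poly_prod)
    have "poly q (of_real y) \<noteq> 0"
      using insert.hyps by (auto simp: q)
    moreover have "poly q (of_real x) = 0" if "x \<in> S" for x
      using insert.hyps that by (auto simp: q)
    ultimately have "\<forall>x\<in>insert y S. poly (p + smult ((of_real (f y) - poly p (of_real y)) / poly q (of_real y)) q) (of_real x) = of_real (f x)"
      using p by auto
    thus ?case by blast
  qed simp
  thus ?thesis using that by blast
qed

section \<open>Functional calculus by interpolation\<close>

definition eigdecomp :: "complex^'n^'n \<Rightarrow> ('n \<Rightarrow> real) \<Rightarrow> complex^'n^'n \<Rightarrow> bool" where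
  "eigdecomp U d A \<longleftrightarrow> unitary_mat U \<and> A = U ** real_diag d ** adj U"

lemma adj_real_diag [simp]: "adj (real_diag d) = real_diag d"
  by (simp add: vec_eq_iff real_diag_def)

lemma eigdecomp_hermitian: "eigdecomp U d A \<Longrightarrow> adj A = A"
  by (auto simp: eigdecomp_def adj_mult matrix_mul_assoc)

lemma hermitian_eigdecomp:
  assumes "adj A = A" obtains U d where "eigdecomp U d A"
  using hermitian_diagonalisable[OF assms] unfolding eigdecomp_def by metis

lemma unitary_cancel:
  assumes "unitary_mat U"
  shows "adj U ** U = mat 1" "U ** adj U = mat 1" "Y ** adj U ** U = Y" "Y ** U ** adj U = Y"
  using assms by (simp_all add: unitary_mat_def) (simp_all add: unitary_mat_def matrix_mul_assoc[symmetric])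

lemma eigdecomp_pmat:
  assumes "eigdecomp U d A" "\<And>i. poly p (of_real (d i)) = of_real (f (d i))"
  shows "pmat p A = U ** real_diag (\<lambda>i. f (d i)) ** adj U"
  using assms pmat_similar[of U p "real_diag d"] pmat_real_diag[of p d f] by (simp add: eigdecomp_def)

text \<open>
  Two diagonalisations of the same matrix give the same value because a polynomial that
  interpolates the function at both lists of eigenvalues computes both candidates.
\<close>
lemma herm_fun_eigdecomp:
  assumes "eigdecomp U d A"
  shows "herm_fun f A = U ** real_diag (\<lambda>i. f (d i)) ** adj U"
  unfolding herm_fun_def
proof (rule the_equality)
  show "\<exists>V e. unitary_mat V \<and> A = V ** real_diag e ** adj V \<and>
      U ** real_diag (\<lambda>i. f (d i)) ** adj U = V ** real_diag (\<lambda>i. f (e i)) ** adj V"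
    using assms by (auto simp: eigdecomp_def)
next
  fix B assume "\<exists>V e. unitary_mat V \<and> A = V ** real_diag e ** adj V \<and> B = V ** real_diag (\<lambda>i. f (e i)) ** adj V"
  then obtain V e where V: "eigdecomp V e A" "B = V ** real_diag (\<lambda>i. f (e i)) ** adj V"
    by (auto simp: eigdecomp_def)
  obtain p :: "complex poly" where p: "\<And>x. x \<in> range d \<union> range e \<Longrightarrow> poly p (of_real x) = of_real (f x)"
    using polynomial_interpolation[of "range d \<union> range e" f] by auto
  have "pmat p A = B" unfolding V(2) by (rule eigdecomp_pmat[OF V(1)]) (use p in auto)
  moreover have "pmat p A = U ** real_diag (\<lambda>i. f (d i)) ** adj U"
    by (rule eigdecomp_pmat[OF assms]) (use p in auto)
  ultimately show "B = U ** real_diag (\<lambda>i. f (d i)) ** adj U" by simp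
qed

lemma eigdecomp_herm_fun: "eigdecomp U d A \<Longrightarrow> eigdecomp U (\<lambda>i. f (d i)) (herm_fun f A)"
  using herm_fun_eigdecomp[of U d A f] by (auto simp: eigdecomp_def)

lemma herm_fun_pmat:
  assumes "eigdecomp U d A" "\<And>i. poly p (of_real (d i)) = of_real (f (d i))"
  shows "herm_fun f A = pmat p A"
  by (simp add: herm_fun_eigdecomp[OF assms(1)] eigdecomp_pmat[OF assms])

lemma herm_fun_cong:
  assumes "eigdecomp U d A" "\<And>i. f (d i) = g (d i)"
  shows "herm_fun f A = herm_fun g A"
  using assms(2) by (simp add: herm_fun_eigdecomp[OF assms(1)])

lemma herm_fun_compose:
  assumes "adj A = A" shows "herm_fun f (herm_fun g A) = herm_fun (\<lambda>x. f (g x)) A"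
proof -
  obtain U d where "eigdecomp U d A" using hermitian_eigdecomp[OF assms] .
  thus ?thesis using eigdecomp_herm_fun[of U d A g] by (simp add: herm_fun_eigdecomp)
qed

lemma herm_fun_id: "adj A = A \<Longrightarrow> herm_fun (\<lambda>x. x) A = A"
  by (erule hermitian_eigdecomp) (simp add: herm_fun_eigdecomp, simp add: eigdecomp_def)

lemma adj_herm_fun: "adj A = A \<Longrightarrow> adj (herm_fun f A) = herm_fun f A"
  by (erule hermitian_eigdecomp) (rule eigdecomp_hermitian[OF eigdecomp_herm_fun])

lemma real_diag_mult: "real_diag d ** real_diag e = real_diag (\<lambda>i. d i * e i)"
  by (simp add: vec_eq_iff real_diag_mm) (simp add: real_diag_def)

lemma herm_fun_mult:
  assumes "adj A = A" shows "herm_fun f A ** herm_fun g A = herm_fun (\<lambda>x. f x * g x) A"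
proof -
  obtain U d where U: "eigdecomp U d A" using hermitian_eigdecomp[OF assms] .
  hence "unitary_mat U" by (simp add: eigdecomp_def)
  thus ?thesis
    by (simp add: herm_fun_eigdecomp[OF U] matrix_mul_assoc unitary_cancel)
      (simp add: matrix_mul_assoc[symmetric] real_diag_mult)
qed

lemma herm_gram [simp]: "adj (adj X ** X) = adj X ** X" "adj (X ** adj X) = X ** adj X"
  by (simp_all add: adj_mult)

text \<open>
  One polynomial serves both Gram matrices; this transfers
  \<open>X p(X\<^sup>* X) = p(X X\<^sup>*) X\<close> and the equality of the traces to
  arbitrary functions.
\<close>
lemma gram_common_polynomial:
  fixes X :: "complex^'n^'n"
  obtains p where "herm_fun f (adj X ** X) = pmat p (adj X ** X)" "herm_fun f (X ** adj X) = pmat p (X ** adj X)"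
proof -
  obtain U d where U: "eigdecomp U d (adj X ** X)" using hermitian_eigdecomp[of "adj X ** X"] by auto
  obtain V e where V: "eigdecomp V e (X ** adj X)" using hermitian_eigdecomp[of "X ** adj X"] by auto
  obtain p :: "complex poly" where p: "\<And>x. x \<in> range d \<union> range e \<Longrightarrow> poly p (of_real x) = of_real (f x)"
    using polynomial_interpolation[of "range d \<union> range e" f] by auto
  show ?thesis
    by (rule that[of p]; rule herm_fun_pmat[OF U] herm_fun_pmat[OF V]) (use p in auto)
qed

lemma herm_fun_gram_intertwine: "X ** herm_fun f (adj X ** X) = herm_fun f (X ** adj X) ** (X :: complex^'n^'n)"
  using gram_common_polynomial[of f X] pmat_intertwine[of X "adj X ** X" "X ** adj X"]
  by (metis matrix_mul_assoc)

text \<open>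
  Equality of the traces for all functions says that \<open>X\<^sup>* X\<close> and
  \<open>X X\<^sup>*\<close> have the same eigenvalues with the same multiplicities.
\<close>
lemma trace_herm_fun_gram: "trace (herm_fun f (adj X ** X)) = trace (herm_fun f (X ** adj (X :: complex^'n^'n)))"
proof -
  have *: "trace (pmat p (adj X ** X)) = trace (pmat p (X ** adj X))" for p
  proof (cases p)
    case (pCons a q)
    have "trace (adj X ** X ** pmat q (adj X ** X)) = trace (adj X ** (pmat q (X ** adj X) ** X))"
      using pmat_intertwine[of X "adj X ** X" "X ** adj X" q] by (simp add: matrix_mul_assoc[symmetric])
    also have "\<dots> = trace (pmat q (X ** adj X) ** (X ** adj X))"
      by (subst trace_mul_sym) (simp add: matrix_mul_assoc)
    also have "\<dots> = trace (X ** adj X ** pmat q (X ** adj X))"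
      by (rule trace_mul_sym)
    finally show ?thesis by (simp add: pCons trace_add)
  qed
  obtain p where "herm_fun f (adj X ** X) = pmat p (adj X ** X)" "herm_fun f (X ** adj X) = pmat p (X ** adj X)"
    by (rule gram_common_polynomial)
  thus ?thesis using * by simp
qed

section \<open>Traces in two eigenbases\<close>

text \<open>
  The squared modulus of the inner product of the \<open>i\<close>-th column of \<open>U\<close>
  and the \<open>j\<close>-th column of \<open>W\<close>: a doubly stochastic matrix through
  which every trace of functions of two Hermitian matrices becomes a double sum of scalars.
\<close>
definition overlap :: "complex^'n^'n \<Rightarrow> complex^'n^'n \<Rightarrow> 'n \<Rightarrow> 'n \<Rightarrow> real" where
  "overlap U W i j = (cmod ((adj U ** W) $ i $ j))\<^sup>2"

lemma overlap_nonneg [simp]: "overlap U W i j \<ge> 0"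
  by (simp add: overlap_def)

lemma trace_two_bases:
  fixes A :: "complex^'n^'n"
  assumes "eigdecomp U h A" "eigdecomp W k B"
  shows "Re (trace (herm_fun f A ** herm_fun g B)) = (\<Sum>i\<in>UNIV. \<Sum>j\<in>UNIV. overlap U W i j * (f (h i) * g (k j)))"
proof -
  define F where "F = real_diag (\<lambda>i. f (h i))"
  define G where "G = real_diag (\<lambda>i. g (k i))"
  define M where "M = adj U ** W"
  have "trace (herm_fun f A ** herm_fun g B) = trace (U ** (F ** adj U ** W ** G ** adj W))"
    unfolding herm_fun_eigdecomp[OF assms(1)] herm_fun_eigdecomp[OF assms(2)] F_def G_def by (simp add: matrix_mul_assoc)
  also have "\<dots> = trace (F ** adj U ** W ** G ** adj W ** U)"
    by (rule trace_mul_sym)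
  also have "F ** adj U ** W ** G ** adj W ** U = F ** (M ** G) ** adj M"
    by (simp add: M_def adj_mult matrix_mul_assoc)
  finally have 1: "trace (herm_fun f A ** herm_fun g B) = trace (F ** (M ** G) ** adj M)" .
  have 2: "(F ** (M ** G)) $ i $ j = of_real (f (h i)) * (M $ i $ j * of_real (g (k j)))" for i j
    unfolding F_def G_def by (simp only: real_diag_mm mm_real_diag)
  have 3: "Re (a * (z * b) * cnj z) = (cmod z)\<^sup>2 * (x * y)" if "a = of_real x" "b = of_real y" for a b z x y
  proof -
    have "a * (z * b) * cnj z = (a * b) * (z * cnj z)" by (simp add: mult_ac)
    also have "\<dots> = of_real ((cmod z)\<^sup>2 * (x * y))"
      unfolding that complex_norm_square[symmetric] by simp
    finally show ?thesis by simp
  qed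
  show ?thesis unfolding 1 unfolding trace_def
    by (simp only: mm_entry[of _ "adj M"] 2 adj_entry Re_sum overlap_def M_def[symmetric] 3[OF refl refl])
qed

lemma herm_fun_one:
  fixes A :: "complex^'n^'n"
  assumes "adj A = A"
  shows "herm_fun (\<lambda>x. 1) A = mat 1"
proof -
  from assms
  obtain U d where U: "eigdecomp U d A" using hermitian_eigdecomp by blast
  have "real_diag (\<lambda>i::'n. 1) = mat 1" by (simp add: vec_eq_iff real_diag_def mat_def)
  with herm_fun_eigdecomp[OF U] U show ?thesis by (simp add: eigdecomp_def unitary_mat_def)
qed

lemma trace_left_two_bases:
  fixes A :: "complex^'n^'n"
  assumes "eigdecomp U h A" "eigdecomp W k B"
  shows "Re (trace (herm_fun f A)) = (\<Sum>i\<in>UNIV. \<Sum>j\<in>UNIV. overlap U W i j * f (h i))"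
    and "Re (trace (herm_fun f B)) = (\<Sum>i\<in>UNIV. \<Sum>j\<in>UNIV. overlap U W i j * f (k j))"
  using trace_two_bases[OF assms, of f "\<lambda>x. 1"] trace_two_bases[OF assms, of "\<lambda>x. 1" f]
    eigdecomp_hermitian[OF assms(1)] eigdecomp_hermitian[OF assms(2)]
  by (simp_all add: herm_fun_one)

lemma trace_herm_fun: "eigdecomp U h A \<Longrightarrow> trace (herm_fun f A) = (\<Sum>i\<in>UNIV. of_real (f (h i)))"
proof -
  assume U: "eigdecomp U h A"
  have "trace (herm_fun f A) = trace (adj U ** (U ** real_diag (\<lambda>i. f (h i))))"
    unfolding herm_fun_eigdecomp[OF U] by (rule trace_mul_sym)
  also have "\<dots> = trace (real_diag (\<lambda>i. f (h i)))"
    using U by (simp add: matrix_mul_assoc unitary_cancel eigdecomp_def)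
  finally show ?thesis by (simp add: trace_def real_diag_def)
qed

text \<open>
  Scalar inequalities between the eigenvalues of \<open>A\<close> and \<open>B\<close> turn into
  Frobenius norm inequalities term by term.
\<close>
lemma norm_diff_herm_fun:
  fixes A :: "complex^'n^'n"
  assumes U: "eigdecomp U h A" and W: "eigdecomp W k B"
  shows "(norm (herm_fun f A - herm_fun g B))\<^sup>2 = (\<Sum>i\<in>UNIV. \<Sum>j\<in>UNIV. overlap U W i j * (f (h i) - g (k j))\<^sup>2)"
proof -
  have hA: "adj A = A" and hB: "adj B = B" using U W eigdecomp_hermitian by auto
  have "(norm (herm_fun f A - herm_fun g B))\<^sup>2
     = Re (trace (herm_fun f A ** herm_fun f A)) - Re (trace (herm_fun f A ** herm_fun g B))
       - Re (trace (herm_fun g B ** herm_fun f A)) + Re (trace (herm_fun g B ** herm_fun g B))"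
    unfolding norm_sq_trace by (simp add: adj_diff adj_herm_fun hA hB mm_ring trace_sub)
  also have "trace (herm_fun g B ** herm_fun f A) = trace (herm_fun f A ** herm_fun g B)"
    by (rule trace_mul_sym)
  moreover have "m * (x - y)\<^sup>2 = m * (x * x) - m * (x * y) - m * (x * y) + m * (y * y)" for m x y :: real
    by (simp add: power2_eq_square algebra_simps)
  ultimately show ?thesis
    by (simp only: herm_fun_mult[OF hA] herm_fun_mult[OF hB] trace_two_bases[OF U W]
        trace_left_two_bases[OF U W] sum.distrib sum_subtractf)
qed

lemma herm_fun_lipschitz:
  fixes A :: "complex^'n^'n"
  assumes A: "adj A = A" and B: "adj B = B" and L: "\<And>x y. \<bar>f x - f y\<bar> \<le> L * \<bar>x - y\<bar>" "L \<ge> 0"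
  shows "norm (herm_fun f A - herm_fun f B) \<le> L * norm (A - B)"
proof -
  obtain U h where U: "eigdecomp U h A" using hermitian_eigdecomp[OF A] .
  obtain W k where W: "eigdecomp W k B" using hermitian_eigdecomp[OF B] .
  have "(norm (herm_fun f A - herm_fun f B))\<^sup>2 \<le> (\<Sum>i\<in>UNIV. \<Sum>j\<in>UNIV. overlap U W i j * (L\<^sup>2 * (h i - k j)\<^sup>2))"
    unfolding norm_diff_herm_fun[OF U W]
    using L(1)[THEN power_mono, of _ _ 2] by (intro sum_mono mult_left_mono) (auto simp: power_mult_distrib)
  also have "\<dots> = L\<^sup>2 * (norm (herm_fun (\<lambda>x. x) A - herm_fun (\<lambda>x. x) B))\<^sup>2"
    unfolding norm_diff_herm_fun[OF U W] by (simp add: sum_distrib_left mult_ac)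
  also have "\<dots> = (L * norm (A - B))\<^sup>2"
    by (simp add: herm_fun_id A B power_mult_distrib)
  finally show ?thesis by (rule power2_le_imp_le) (use L(2) in auto)
qed

lemma norm_herm_fun_le:
  fixes A :: "complex^'n^'n"
  assumes A: "adj A = A" and L: "\<And>x. \<bar>f x\<bar> \<le> L"
  shows "norm (herm_fun f A) \<le> sqrt (CARD('n)) * L"
proof -
  obtain U h where U: "eigdecomp U h A" using hermitian_eigdecomp[OF A] .
  have L0: "L \<ge> 0" using L[of 0] by linarith
  have "(norm (herm_fun f A))\<^sup>2 = Re (trace (herm_fun (\<lambda>x. f x * f x) A))"
    by (simp add: norm_sq_trace adj_herm_fun herm_fun_mult A)
  also have "\<dots> = (\<Sum>i\<in>UNIV. (f (h i))\<^sup>2)"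
    by (simp add: trace_herm_fun[OF U] power2_eq_square)
  also have "\<dots> \<le> (\<Sum>i\<in>(UNIV::'n set). L\<^sup>2)"
    using L[THEN power_mono, of _ 2] by (intro sum_mono) auto
  also have "\<dots> = (sqrt (CARD('n)) * L)\<^sup>2" by (simp add: power_mult_distrib)
  finally show ?thesis by (rule power2_le_imp_le) (use L0 in auto)
qed

text \<open>
  The source both of Klein's inequality (for convex \<open>g\<close> with derivative
  \<open>f\<close> and \<open>l = id\<close> each summand is nonnegative) and of the
  differentiation of trace functions (each summand is quadratically small).
\<close>
lemma trace_taylor_two_bases:
  fixes A :: "complex^'n^'n"
  assumes U: "eigdecomp U h A" and W: "eigdecomp W k B"
  shows "Re (trace (herm_fun g B)) - Re (trace (herm_fun g A)) - Re (trace (herm_fun f A ** (herm_fun l B - herm_fun l A)))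
     = (\<Sum>i\<in>UNIV. \<Sum>j\<in>UNIV. overlap U W i j * (g (k j) - g (h i) - f (h i) * (l (k j) - l (h i))))"
proof -
  have "m * (x - y - a * (b - c)) = m * x - m * y - (m * (a * b) - m * (a * c))" for m x y a b c :: real
    by (simp add: algebra_simps)
  thus ?thesis
    by (simp only: mm_diff_right trace_sub minus_complex.sel herm_fun_mult[OF eigdecomp_hermitian[OF U]]
        trace_two_bases[OF U W] trace_left_two_bases[OF U W] sum_subtractf)
qed

section \<open>Schur multipliers and commutators\<close>

text \<open>
  Rows and columns carry separate lists of eigenvalues, so that changes of eigenbasis are
  covered by the same rules as multiplication by commuting matrices.
\<close>
definition hadamard :: "(real \<Rightarrow> real \<Rightarrow> real) \<Rightarrow> ('n \<Rightarrow> real) \<Rightarrow> ('n \<Rightarrow> real) \<Rightarrow> complex^'n^'n \<Rightarrow> complex^'n^'n" where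
  "hadamard \<kappa> h k Z = (\<chi> i j. of_real (\<kappa> (h i) (k j)) * Z $ i $ j)"

text \<open>
  The double operator integral with symbol \<open>\<kappa>\<close>: entrywise multiplication by
  \<open>\<kappa>(h\<^sub>i, h\<^sub>j)\<close> in the eigenbasis \<open>U\<close>.
\<close>
definition schur_mult :: "(real \<Rightarrow> real \<Rightarrow> real) \<Rightarrow> complex^'n^'n \<Rightarrow> ('n \<Rightarrow> real) \<Rightarrow> complex^'n^'n \<Rightarrow> complex^'n^'n" where
  "schur_mult \<kappa> U h Z = U ** hadamard \<kappa> h h (adj U ** Z ** U) ** adj U"

lemma hadamard_entry: "hadamard \<kappa> h k Z $ i $ j = of_real (\<kappa> (h i) (k j)) * Z $ i $ j"
  by (simp add: hadamard_def)

text \<open>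
  The nonzero entries of \<open>A\<close> join only equal eigenvalues, so the multiplier may be
  read off on either side of \<open>A\<close>.
\<close>
lemma hadamard_mm_left:
  assumes "\<And>i j. A $ i $ j = 0 \<or> h i = k j"
  shows "hadamard \<kappa> h l (A ** Z) = A ** hadamard \<kappa> k l Z"
proof -
  have "of_real (\<kappa> (h i) (l j)) * (A $ i $ m * Z $ m $ j) = A $ i $ m * (of_real (\<kappa> (k m) (l j)) * Z $ m $ j)" for i j m
    using assms[of i m] by auto
  thus ?thesis unfolding vec_eq_iff by (simp only: hadamard_entry mm_entry sum_distrib_left simp_thms)
qed

lemma hadamard_mm_right:
  assumes "\<And>i j. A $ i $ j = 0 \<or> k i = h j"
  shows "hadamard \<kappa> l h (Z ** A) = hadamard \<kappa> l k Z ** A"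
proof -
  have "of_real (\<kappa> (l i) (h j)) * (Z $ i $ m * A $ m $ j) = of_real (\<kappa> (l i) (k m)) * Z $ i $ m * A $ m $ j" for i j m
    using assms[of m j] by auto
  thus ?thesis unfolding vec_eq_iff by (simp only: hadamard_entry mm_entry sum_distrib_left simp_thms)
qed

text \<open>
  With \<open>N = 1\<close> this compares two eigenbases of the same matrix; with
  \<open>U = W\<close> it says that a commuting matrix preserves the eigenspaces.
\<close>
lemma commuting_entry_zero:
  fixes A :: "complex^'n^'n"
  assumes U: "eigdecomp U h A" and W: "eigdecomp W k A" and N: "N ** A = A ** N"
  shows "(adj U ** N ** W) $ i $ j = 0 \<or> h i = k j"
proof -
  have uU: "unitary_mat U" "A = U ** real_diag h ** adj U" and uW: "unitary_mat W" "A = W ** real_diag k ** adj W"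
    using U W by (auto simp: eigdecomp_def)
  have AW: "A ** W = W ** real_diag k" and UA: "adj U ** A = real_diag h ** adj U"
    by (subst uW(2), simp add: unitary_cancel[OF uW(1)])
       (subst uU(2), simp add: matrix_mul_assoc unitary_cancel[OF uU(1)])
  have "adj U ** N ** W ** real_diag k = adj U ** (N ** A) ** W"
    by (simp add: matrix_mul_assoc[symmetric] AW)
  also have "\<dots> = real_diag h ** (adj U ** N ** W)"
    unfolding N by (simp add: matrix_mul_assoc UA)
  finally have "(adj U ** N ** W ** real_diag k) $ i $ j = (real_diag h ** (adj U ** N ** W)) $ i $ j" by simp
  thus ?thesis unfolding mm_real_diag real_diag_mm by auto
qed

lemma schur_mult_left:
  assumes U: "eigdecomp U h A" and N: "N ** A = A ** N"
  shows "schur_mult \<kappa> U h (N ** Z) = N ** schur_mult \<kappa> U h Z"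
proof -
  have u: "unitary_mat U" using U by (simp add: eigdecomp_def)
  have "adj U ** (N ** Z) ** U = (adj U ** N ** U) ** (adj U ** Z ** U)"
    by (simp add: matrix_mul_assoc unitary_cancel[OF u])
  thus ?thesis unfolding schur_mult_def
    by (simp add: hadamard_mm_left[OF commuting_entry_zero[OF U U N]])
       (simp add: matrix_mul_assoc unitary_cancel[OF u])
qed

lemma schur_mult_right:
  assumes U: "eigdecomp U h A" and N: "N ** A = A ** N"
  shows "schur_mult \<kappa> U h (Z ** N) = schur_mult \<kappa> U h Z ** N"
proof -
  have u: "unitary_mat U" using U by (simp add: eigdecomp_def)
  have "adj U ** (Z ** N) ** U = (adj U ** Z ** U) ** (adj U ** N ** U)"
    by (simp add: matrix_mul_assoc unitary_cancel[OF u])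
  thus ?thesis unfolding schur_mult_def
    by (simp add: hadamard_mm_right[OF commuting_entry_zero[OF U U N]])
       (simp add: matrix_mul_assoc unitary_cancel[OF u])
qed

text \<open>
  The multiplier depends on the spectral projections only; at a normal limit it allows the
  eigenbases coming from \<open>X\<^sup>* X\<close> and from \<open>X X\<^sup>*\<close> to be
  exchanged.
\<close>
lemma schur_mult_basis_independent:
  assumes U: "eigdecomp U h A" and W: "eigdecomp W k A"
  shows "schur_mult \<kappa> W k Z = schur_mult \<kappa> U h Z"
proof -
  have u: "unitary_mat U" and w: "unitary_mat W" using U W by (auto simp: eigdecomp_def)
  define a where "a = adj U ** W"
  have a: "a $ i $ j = 0 \<or> h i = k j" for i j
    using commuting_entry_zero[OF U W, of "mat 1"] by (simp add: a_def)
  have a': "adj a $ i $ j = 0 \<or> k i = h j" for i j using a[of j i] by auto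
  have "adj W ** Z ** W = adj a ** (adj U ** Z ** U ** a)"
    by (simp add: a_def adj_mult matrix_mul_assoc unitary_cancel[OF u])
  hence "schur_mult \<kappa> W k Z = W ** (adj a ** (hadamard \<kappa> h h (adj U ** Z ** U) ** a)) ** adj W"
    unfolding schur_mult_def by (simp only: hadamard_mm_left[OF a'] hadamard_mm_right[OF a])
  also have "\<dots> = schur_mult \<kappa> U h Z"
    by (simp add: a_def adj_mult matrix_mul_assoc unitary_cancel[OF u] unitary_cancel[OF w] schur_mult_def)
  finally show ?thesis .
qed

lemma hadamard_diff: "hadamard \<kappa> h k (Y - Z) = hadamard \<kappa> h k Y - hadamard \<kappa> h k Z"
  by (simp add: vec_eq_iff hadamard_entry algebra_simps)

lemma schur_mult_diff: "schur_mult \<kappa> U h (Y - Z) = schur_mult \<kappa> U h Y - schur_mult \<kappa> U h Z"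
  by (simp add: schur_mult_def hadamard_diff mm_ring)

lemma schur_mult_scaleR: "schur_mult \<kappa> U h (r *\<^sub>R Z) = r *\<^sub>R schur_mult \<kappa> U h Z"
proof -
  have "hadamard \<kappa> h h (r *\<^sub>R Y) = r *\<^sub>R hadamard \<kappa> h h Y" for Y
    by (simp add: vec_eq_iff hadamard_entry)
  thus ?thesis by (simp add: schur_mult_def mm_scaleR_left mm_scaleR_right)
qed

lemma schur_mult_adj:
  assumes "\<And>x y. \<kappa> x y = \<kappa> y x"
  shows "adj (schur_mult \<kappa> U h Z) = schur_mult \<kappa> U h (adj Z)"
proof -
  have "adj (hadamard \<kappa> h h Y) = hadamard \<kappa> h h (adj Y)" for Y
    by (simp add: vec_eq_iff hadamard_entry assms[of "h _" "h _"])
  thus ?thesis by (simp add: schur_mult_def adj_mult matrix_mul_assoc)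
qed

lemma trace_schur_mult:
  assumes "unitary_mat U"
  shows "trace (schur_mult \<kappa> U h Z ** S) =
    (\<Sum>i\<in>UNIV. \<Sum>j\<in>UNIV. of_real (\<kappa> (h i) (h j)) * (adj U ** Z ** U) $ i $ j * (adj U ** S ** U) $ j $ i)"
proof -
  have "trace (schur_mult \<kappa> U h Z ** S) = trace (U ** (hadamard \<kappa> h h (adj U ** Z ** U) ** adj U ** S))"
    by (simp add: schur_mult_def matrix_mul_assoc)
  also have "\<dots> = trace (hadamard \<kappa> h h (adj U ** Z ** U) ** (adj U ** S ** U))"
    by (subst trace_mul_sym) (simp add: matrix_mul_assoc)
  finally show ?thesis by (simp add: trace_def mm_entry[of "hadamard \<kappa> h h _"] hadamard_entry)
qed

lemma trace_schur_mult_sym: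
  assumes "unitary_mat U" "\<And>x y. \<kappa> x y = \<kappa> y x"
  shows "trace (schur_mult \<kappa> U h Z ** S) = trace (Z ** schur_mult \<kappa> U h S)"
proof -
  have "trace (schur_mult \<kappa> U h Z ** S) = trace (schur_mult \<kappa> U h S ** Z)"
    unfolding trace_schur_mult[OF assms(1)]
    by (subst sum.swap) (simp add: assms(2)[of "h _" "h _"] mult_ac)
  thus ?thesis by (simp add: trace_mul_sym[of Z])
qed

lemma trace_schur_mult_adj:
  assumes "unitary_mat U"
  shows "trace (schur_mult \<kappa> U h Z ** adj Z) =
    of_real (\<Sum>i\<in>UNIV. \<Sum>j\<in>UNIV. \<kappa> (h i) (h j) * (cmod ((adj U ** Z ** U) $ i $ j))\<^sup>2)"
proof -
  have "(adj U ** adj Z ** U) $ j $ i = cnj ((adj U ** Z ** U) $ i $ j)" for i j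
    unfolding adj_entry[symmetric] by (simp add: adj_mult matrix_mul_assoc)
  thus ?thesis unfolding trace_schur_mult[OF assms] of_real_sum of_real_mult complex_norm_square
    by (simp add: mult.assoc)
qed

lemma norm_unitary_conj:
  assumes "unitary_mat (U :: complex^'n^'n)"
  shows "norm (U ** Y ** adj U) = norm Y" "norm (adj U ** Y ** U) = norm Y"
proof -
  have *: "norm (V ** Z) = norm Z" if "adj V ** V = mat 1" for V Z :: "complex^'n^'n"
  proof -
    have "adj Z ** adj V ** V ** Z = adj Z ** Z"
      using that by (metis matrix_mul_assoc matrix_mul_rid)
    hence "(norm (V ** Z))\<^sup>2 = (norm Z)\<^sup>2" by (simp add: norm_sq_trace adj_mult matrix_mul_assoc)
    thus ?thesis by simp
  qed
  have **: "norm (Z ** V) = norm Z" if "V ** adj V = mat 1" for V Z :: "complex^'n^'n"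
    using *[of "adj V" "adj Z"] that norm_adj[of "Z ** V"] by (simp add: adj_mult)
  show "norm (U ** Y ** adj U) = norm Y" "norm (adj U ** Y ** U) = norm Y"
    using assms by (simp_all add: * ** unitary_mat_def)
qed

lemma norm_schur_mult_le:
  fixes Z :: "complex^'n^'n"
  assumes "unitary_mat U" and L: "\<And>i j. \<bar>\<kappa> (h i) (h j)\<bar> \<le> L"
  shows "norm (schur_mult \<kappa> U h Z) \<le> L * norm Z"
proof -
  have L0: "L \<ge> 0" using L[of undefined undefined] by linarith
  define z where "z = adj U ** Z ** U"
  have "(norm (hadamard \<kappa> h h z))\<^sup>2 = (\<Sum>i\<in>UNIV. \<Sum>j\<in>UNIV. \<bar>\<kappa> (h i) (h j)\<bar>\<^sup>2 * (cmod (z $ i $ j))\<^sup>2)"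
    unfolding norm_mat_sq hadamard_entry norm_mult power_mult_distrib norm_of_real ..
  also have "\<dots> \<le> (\<Sum>i\<in>UNIV. \<Sum>j\<in>UNIV. L\<^sup>2 * (cmod (z $ i $ j))\<^sup>2)"
    by (intro sum_mono mult_right_mono power_mono L) auto
  also have "\<dots> = (L * norm z)\<^sup>2"
    unfolding power_mult_distrib norm_mat_sq by (simp only: sum_distrib_left)
  finally have "norm (hadamard \<kappa> h h z) \<le> L * norm z"
    by (rule power2_le_imp_le) (use L0 in auto)
  thus ?thesis by (simp add: schur_mult_def norm_unitary_conj[OF assms(1)] z_def)
qed

lemma tendsto_schur_mult:
  fixes Z :: "nat \<Rightarrow> complex^'n^'n"
  assumes \<kappa>: "\<And>i j. (\<lambda>m. \<kappa> (h m i) (h m j)) \<longlonglongrightarrow> \<kappa> (e i) (e j)"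
    and U: "U \<longlonglongrightarrow> V" and Z: "Z \<longlonglongrightarrow> Y"
  shows "(\<lambda>m. schur_mult \<kappa> (U m) (h m) (Z m)) \<longlonglongrightarrow> schur_mult \<kappa> V e Y"
proof -
  have "(\<lambda>m. hadamard \<kappa> (h m) (h m) (adj (U m) ** Z m ** U m)) \<longlonglongrightarrow> hadamard \<kappa> e e (adj V ** Y ** V)"
  proof (intro vec_tendstoI)
    fix i j
    show "(\<lambda>m. hadamard \<kappa> (h m) (h m) (adj (U m) ** Z m ** U m) $ i $ j) \<longlonglongrightarrow> hadamard \<kappa> e e (adj V ** Y ** V) $ i $ j"
      unfolding hadamard_entry by (intro tendsto_mult tendsto_of_real \<kappa> tendsto_vec_nth tendsto_mm tendsto_adj U Z)
  qed
  thus ?thesis unfolding schur_mult_def by (intro tendsto_mm tendsto_adj U)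
qed

text \<open>
  In an eigenbasis the \<open>(i, j)\<close> entry of \<open>[f(A), R]\<close> is
  \<open>(f(h\<^sub>i) - f(h\<^sub>j)) r\<^sub>i\<^sub>j\<close>, and that of
  \<open>[A, R]\<close> is \<open>(h\<^sub>i - h\<^sub>j) r\<^sub>i\<^sub>j\<close>.
\<close>
lemma herm_fun_commutator:
  assumes U: "eigdecomp U h A" and \<kappa>: "\<And>i j. \<kappa> (h i) (h j) * (h i - h j) = f (h i) - f (h j)"
  shows "herm_fun f A ** R - R ** herm_fun f A = schur_mult \<kappa> U h (A ** R - R ** A)"
proof -
  have u: "unitary_mat U" "A = U ** real_diag h ** adj U" using U by (auto simp: eigdecomp_def)
  define r where "r = adj U ** R ** U"
  define F where "F = real_diag (\<lambda>i. f (h i))"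
  have "F ** r - r ** F = hadamard \<kappa> h h (real_diag h ** r - r ** real_diag h)"
  proof -
    have "of_real (f (h i)) * z - z * of_real (f (h j)) = of_real (\<kappa> (h i) (h j)) * (of_real (h i) * z - z * of_real (h j))"
      for i j and z :: complex
    proof -
      have "of_real (f (h i)) * z - z * of_real (f (h j)) = of_real (f (h i) - f (h j)) * z"
        by (simp add: algebra_simps)
      thus ?thesis unfolding \<kappa>[symmetric] by (simp add: algebra_simps)
    qed
    thus ?thesis by (simp add: vec_eq_iff hadamard_entry real_diag_mm mm_real_diag F_def)
  qed
  also have "real_diag h ** r - r ** real_diag h = adj U ** (A ** R - R ** A) ** U"
    unfolding u(2) r_def by (simp add: mm_ring unitary_cancel[OF u(1)])
  finally have *: "F ** r - r ** F = hadamard \<kappa> h h (adj U ** (A ** R - R ** A) ** U)" .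
  have "herm_fun f A ** R - R ** herm_fun f A = U ** (F ** r - r ** F) ** adj U"
    unfolding herm_fun_eigdecomp[OF U] F_def[symmetric] r_def by (simp add: mm_ring unitary_cancel[OF u(1)])
  thus ?thesis unfolding * schur_mult_def .
qed

text \<open>
  Because \<open>N\<close> is normal, it and its adjoint commute with
  \<open>N\<^sup>* N\<close> and pass through the multiplier \<open>M\<close>. The difference
  of the two traces is the form of \<open>C\<close>, by cyclicity and
  \<open>E = C\<^sup>*\<close>; the second is minus the conjugate of the first, by skewness of
  \<open>D\<close> and symmetry of \<open>M\<close>. So each of them carries half of the form.
\<close>
lemma skew_commutator_form:
  fixes N D :: "complex^'n^'n"
  assumes N: "adj N ** N = N ** adj N" and U: "eigdecomp U h (adj N ** N)" and D: "adj D = - D"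
    and \<kappa>: "\<And>x y. \<kappa> x y = \<kappa> y x"
  defines "C \<equiv> N ** D - D ** N" and "E \<equiv> adj N ** D - D ** adj N" and "M \<equiv> schur_mult \<kappa> U h"
  shows "2 * Re (trace (M (E ** N) ** D)) = Re (trace (M C ** adj C))"
    and "2 * Re (trace (M (N ** E) ** D)) = - Re (trace (M C ** adj C))"
proof -
  have u: "unitary_mat U" using U by (simp add: eigdecomp_def)
  have cN: "N ** (adj N ** N) = adj N ** N ** N" "adj N ** (adj N ** N) = adj N ** N ** adj N"
    using N by (simp_all add: matrix_mul_assoc) (simp_all add: matrix_mul_assoc[symmetric])
  have l: "M (N ** Z) = N ** M Z" "M (adj N ** Z) = adj N ** M Z"
     and r: "M (Z ** N) = M Z ** N" "M (Z ** adj N) = M Z ** adj N" for Z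
    unfolding M_def using schur_mult_left[OF U] schur_mult_right[OF U] cN by auto
  have ts: "trace (M Z ** S) = trace (Z ** M S)" for Z S
    unfolding M_def by (rule trace_schur_mult_sym[OF u \<kappa>])
  have ma: "adj (M Z) = M (adj Z)" for Z
    unfolding M_def by (rule schur_mult_adj[OF \<kappa>])
  have md: "M (Y - Z) = M Y - M Z" for Y Z by (simp add: M_def schur_mult_diff)
  have EC: "E = adj C" by (simp add: E_def C_def adj_diff adj_mult D mm_ring)
  have 1: "trace (M (E ** N) ** D) - trace (M (N ** E) ** D) = trace (M C ** adj C)"
  proof -
    have "trace (M (N ** E) ** D) = trace (N ** (M E ** D))" by (simp add: l matrix_mul_assoc)
    also have "\<dots> = trace (M E ** D ** N)" by (rule trace_mul_sym)
    finally have "trace (M (E ** N) ** D) - trace (M (N ** E) ** D) = trace (M E ** C)"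
      by (simp add: r C_def mm_ring trace_sub)
    also have "\<dots> = trace (E ** M C)" by (rule ts)
    also have "\<dots> = trace (M C ** adj C)" unfolding EC by (rule trace_mul_sym)
    finally show ?thesis .
  qed
  have 2: "trace (M (N ** E) ** D) = - cnj (trace (M (E ** N) ** D))"
  proof -
    have "- cnj (trace (M (E ** N) ** D)) = trace (D ** adj N ** M C)"
      unfolding trace_adj[symmetric] by (simp add: adj_mult ma D EC r l mm_ring trace_uminus)
    also have "\<dots> = trace (D ** adj N ** N ** M D) - trace (D ** adj N ** M D ** N)"
      by (simp add: C_def md l r mm_ring trace_sub)
    also have "trace (D ** adj N ** N ** M D) = trace (N ** adj N ** M D ** D)"
    proof -
      have "trace (D ** (adj N ** N ** M D)) = trace (adj N ** N ** M D ** D)" by (rule trace_mul_sym)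
      also have "\<dots> = trace (N ** adj N ** M D ** D)" by (simp only: N)
      finally show ?thesis by (simp add: matrix_mul_assoc)
    qed
    also have "trace (D ** adj N ** M D ** N) = trace (N ** M D ** adj N ** D)"
    proof -
      have "trace (N ** (M D ** adj N ** D)) = trace (M D ** (adj N ** D ** N))"
        by (subst trace_mul_sym) (simp add: matrix_mul_assoc)
      also have "\<dots> = trace (D ** M (adj N ** D ** N))" by (rule ts)
      finally show ?thesis by (simp add: l r matrix_mul_assoc)
    qed
    also have "trace (N ** adj N ** M D ** D) - trace (N ** M D ** adj N ** D) = trace (M (N ** E) ** D)"
      unfolding l(1)[of E] by (simp add: l r md E_def mm_ring trace_sub)
    finally show ?thesis by simp
  qed
  show "2 * Re (trace (M (E ** N) ** D)) = Re (trace (M C ** adj C))"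
    "2 * Re (trace (M (N ** E) ** D)) = - Re (trace (M C ** adj C))"
    using arg_cong[OF 1, of Re] arg_cong[OF 2, of Re] by simp_all
qed

section \<open>Differential inequalities\<close>

lemma nonincreasing_if_deriv_nonpos:
  fixes f :: "real \<Rightarrow> real"
  assumes st: "0 \<le> s" "s \<le> t"
    and d: "\<And>x. s \<le> x \<Longrightarrow> x \<le> t \<Longrightarrow> (f has_real_derivative f' x) (at x within {0..})"
    and n: "\<And>x. s \<le> x \<Longrightarrow> x \<le> t \<Longrightarrow> f' x \<le> 0"
  shows "f t \<le> f s"
proof -
  have "\<exists>x\<in>{s..t}. f t - f s = (*) (f' x) (t - s)"
  proof (rule mvt_very_simple[OF st(2)])
    fix x assume x: "s \<le> x" "x \<le> t"
    show "(f has_derivative (*) (f' x)) (at x within {s..t})"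
      using has_field_derivative_subset[OF d[OF x], of "{s..t}"] st by (auto simp: has_field_derivative_def)
  qed
  then obtain x where "x \<in> {s..t}" "f t - f s = f' x * (t - s)" by blast
  with n[of x] st show ?thesis by (smt (verit) atLeastAtMost_iff mult_nonpos_nonneg)
qed

lemma vector_derivative_inner:
  assumes "(f has_vector_derivative f') (at x within S)" "(g has_vector_derivative g') (at x within S)"
  shows "((\<lambda>x. inner (f x) (g x)) has_real_derivative (inner (f x) g' + inner f' (g x))) (at x within S)"
  using has_derivative_inner[OF assms[unfolded has_vector_derivative_def]]
  unfolding has_field_derivative_def by (rule has_derivative_eq_rhs) (auto simp: algebra_simps)

text \<open>
  Applied to the difference of two solutions, and to polynomials in \<open>X\<close> that vanish
  at the start.
\<close>
lemma gronwall_zero: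
  fixes z :: "real \<Rightarrow> 'a::real_inner"
  assumes d: "\<And>t. t \<ge> 0 \<Longrightarrow> (z has_vector_derivative z' t) (at t within {0..})"
    and b: "\<And>t. 0 \<le> t \<Longrightarrow> norm (z' t) \<le> M * norm (z t)"
    and z0: "z 0 = 0" and t: "t \<ge> 0"
  shows "z t = 0"
proof -
  define f where "f t = inner (z t) (z t) * exp (- 2 * M * t)" for t
  define f' where "f' t = (2 * inner (z t) (z' t) - 2 * M * inner (z t) (z t)) * exp (- 2 * M * t)" for t
  have "f t \<le> f 0"
  proof (rule nonincreasing_if_deriv_nonpos[OF order_refl t])
    fix x :: real assume x: "0 \<le> x"
    show "(f has_real_derivative f' x) (at x within {0..})"
      unfolding f_def f'_def
      by (rule DERIV_cong, (rule derivative_intros vector_derivative_inner d x refl)+)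
         (simp add: inner_commute algebra_simps)
    have "inner (z x) (z' x) \<le> norm (z x) * (M * norm (z x))"
      using norm_cauchy_schwarz[of "z x" "z' x"] mult_left_mono[OF b[OF x], of "norm (z x)"] by simp
    also have "\<dots> = M * inner (z x) (z x)" by (simp add: dot_square_norm power2_eq_square)
    finally show "f' x \<le> 0" by (simp add: f'_def mult_nonpos_nonneg)
  qed
  hence "inner (z t) (z t) * exp (- 2 * M * t) \<le> 0" by (simp add: f_def z0)
  hence "inner (z t) (z t) \<le> 0" by (simp add: mult_le_0_iff)
  thus ?thesis by (metis inner_gt_zero_iff not_less)
qed

lemma exponential_decay:
  fixes y :: "real \<Rightarrow> real"
  assumes d: "\<And>t. t \<ge> s \<Longrightarrow> (y has_real_derivative y' t) (at t within {0..})"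
    and b: "\<And>t. t \<ge> s \<Longrightarrow> y' t \<le> - c * y t" and st: "0 \<le> s" "s \<le> t"
  shows "y t \<le> y s * exp (- c * (t - s))"
proof -
  have "y t * exp (c * t) \<le> y s * exp (c * s)"
  proof (rule nonincreasing_if_deriv_nonpos[OF st])
    fix x assume x: "s \<le> x"
    show "((\<lambda>t. y t * exp (c * t)) has_real_derivative (y' x + c * y x) * exp (c * x)) (at x within {0..})"
      by (rule DERIV_cong, (rule derivative_intros d x refl)+) (simp add: algebra_simps)
    show "(y' x + c * y x) * exp (c * x) \<le> 0" using b[OF x] by (simp add: mult_nonpos_nonneg)
  qed
  hence "y t * exp (c * t) * exp (- (c * t)) \<le> y s * exp (c * s) * exp (- (c * t))"
    by (rule mult_right_mono) simp
  thus ?thesis by (simp add: mult.assoc exp_add[symmetric] algebra_simps)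
qed

text \<open>
  The mean value inequality with a one-sided derivative at \<open>0\<close>, obtained by testing
  with the vector \<open>z(t) - z(s)\<close>.
\<close>
lemma norm_diff_le_if_derivative_bounded:
  fixes z :: "real \<Rightarrow> 'a::real_inner"
  assumes d: "\<And>t. t \<ge> 0 \<Longrightarrow> (z has_vector_derivative z' t) (at t within {0..})"
    and b: "\<And>t. t \<ge> 0 \<Longrightarrow> norm (z' t) \<le> M" and st: "0 \<le> s" "s \<le> t"
  shows "norm (z t - z s) \<le> M * (t - s)"
proof -
  define v where "v = z t - z s"
  define f where "f x = inner v (z x) - norm v * M * x" for x
  have "f t \<le> f s"
  proof (rule nonincreasing_if_deriv_nonpos[OF st])
    fix x assume "s \<le> x"
    hence x: "0 \<le> x" using st by simp
    show "(f has_real_derivative (inner v (z' x) - norm v * M)) (at x within {0..})"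
      unfolding f_def
      by (rule DERIV_cong, (rule derivative_intros vector_derivative_inner d x refl)+) simp
    have "inner v (z' x) \<le> norm v * M"
      using norm_cauchy_schwarz[of v "z' x"] mult_left_mono[OF b[OF x], of "norm v"] by simp
    thus "inner v (z' x) - norm v * M \<le> 0" by simp
  qed
  moreover have "inner v (z t) - inner v (z s) = norm v * norm v"
    by (simp add: v_def inner_diff_right[symmetric] dot_square_norm power2_eq_square)
  ultimately have "norm v * norm v \<le> norm v * (M * (t - s))" by (simp add: f_def algebra_simps)
  moreover have "M \<ge> 0" using b[of 0] norm_ge_zero order_trans by blast
  ultimately show ?thesis using st
    by (cases "v = 0") (auto simp: v_def)
qed

text \<open>
  The increments after time \<open>r\<close> are bounded by the tail
  \<open>(C / c) e\<^bsup>-cr\<^esup>\<close> of the integral of the speed.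
\<close>
lemma convergent_if_derivative_decays:
  fixes z :: "real \<Rightarrow> 'a::euclidean_space"
  assumes d: "\<And>t. t \<ge> s \<Longrightarrow> (z has_vector_derivative z' t) (at t within {0..})"
    and b: "\<And>t. t \<ge> s \<Longrightarrow> norm (z' t) \<le> C * exp (- c * t)" and s: "0 \<le> s" and c: "c > 0" "C \<ge> 0"
  obtains L where "(z \<longlongrightarrow> L) at_top"
proof -
  have key: "norm (z t - z r) \<le> C / c * exp (- c * r)" if r: "s \<le> r" "r \<le> t" for r t
  proof -
    define v where "v = z t - z r"
    define f where "f x = inner v (z x) + norm v * (C / c * exp (- c * x))" for x
    have "f t \<le> f r"
    proof (rule nonincreasing_if_deriv_nonpos[OF _ r(2)])
      show "0 \<le> r" using r s by simp
    next
      fix x assume "r \<le> x"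
      hence x: "s \<le> x" using r by simp
      show "(f has_real_derivative (inner v (z' x) - norm v * (C * exp (- c * x)))) (at x within {0..})"
        unfolding f_def using c(1)
        by - (rule DERIV_cong, (rule derivative_intros vector_derivative_inner d x refl)+,
           simp add: field_simps)
      have "inner v (z' x) \<le> norm v * (C * exp (- c * x))"
        using norm_cauchy_schwarz[of v "z' x"] mult_left_mono[OF b[OF x], of "norm v"] by simp
      thus "inner v (z' x) - norm v * (C * exp (- c * x)) \<le> 0" by simp
    qed
    moreover have "inner v (z t) - inner v (z r) = norm v * norm v"
      by (simp add: v_def inner_diff_right[symmetric] dot_square_norm power2_eq_square)
    moreover have "norm v * (C / c * exp (- c * t)) \<ge> 0" using c by simp
    ultimately have "norm v * norm v \<le> norm v * (C / c * exp (- c * r))" by (simp add: f_def)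
    hence "norm v \<le> C / c * exp (- c * r)" if "v \<noteq> 0"
      using that mult_le_cancel_left_pos[of "norm v"] by fastforce
    thus ?thesis using c by (cases "v = 0") (auto simp: v_def)
  qed
  \<comment> \<open>Cauchy along \<open>s + n\<close>; the estimate \<open>key\<close> then
    extends the limit to all times\<close>
  have lim0: "((\<lambda>r. C / c * exp (- c * r)) \<longlongrightarrow> 0) at_top"
  proof -
    have "filterlim (\<lambda>r. c * r) at_top at_top"
      by (rule filterlim_tendsto_pos_mult_at_top[OF tendsto_const c(1) filterlim_ident])
    hence "((\<lambda>r. exp (- (c * r))) \<longlongrightarrow> 0) at_top"
      by (intro filterlim_compose[OF exp_at_bot] filterlim_compose[OF filterlim_uminus_at_bot_at_top])
    from tendsto_mult_right_zero[OF this, of "C / c"] show ?thesis by simp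
  qed
  have "Cauchy (\<lambda>n. z (s + real n))"
  proof (rule metric_CauchyI)
    fix e :: real assume "e > 0"
    with order_tendstoD(2)[OF lim0, of e] obtain R where R: "\<And>r. r \<ge> R \<Longrightarrow> C / c * exp (- c * r) < e"
      by (auto simp: eventually_at_top_linorder)
    obtain N :: nat where N: "real N \<ge> R - s" using real_arch_simple by blast
    have "norm (z (s + real m) - z (s + real n)) < e" if "n \<ge> N" "m \<ge> n" for m n
      using key[of "s + real n" "s + real m"] R[of "s + real n"] that N by (smt (verit) of_nat_mono of_nat_0_le_iff)
    thus "\<exists>M. \<forall>m\<ge>M. \<forall>n\<ge>M. dist (z (s + real m)) (z (s + real n)) < e"
      by (intro exI[of _ N]) (metis dist_norm dist_commute linear)
  qed
  then obtain L where L: "(\<lambda>n. z (s + real n)) \<longlonglongrightarrow> L"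
    using Cauchy_convergent convergent_def by blast
  have "norm (L - z r) \<le> C / c * exp (- c * r)" if "r \<ge> s" for r
  proof -
    obtain N :: nat where N: "real N \<ge> r" using real_arch_simple by blast
    show ?thesis
  proof (rule Lim_bounded)
    show "(\<lambda>n. norm (z (s + real n) - z r)) \<longlonglongrightarrow> norm (L - z r)"
      by (intro tendsto_intros L)
    show "\<forall>n\<ge>N. norm (z (s + real n) - z r) \<le> C / c * exp (- c * r)"
      using key[OF that] s N by (smt (verit) of_nat_mono)
  qed
  qed
  hence "eventually (\<lambda>r. norm (z r - L) \<le> C / c * exp (- c * r)) at_top"
    by (auto simp: eventually_at_top_linorder norm_minus_commute)
  hence "((\<lambda>r. z r - L) \<longlongrightarrow> 0) at_top"
    using lim0 by (rule Lim_null_comparison)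
  thus ?thesis using that LIM_zero_iff by blast
qed

text \<open>
  If \<open>G(N) < 0\<close>, then near each of the times \<open>s\<^sub>m\<close> the
  trajectory stays close to \<open>N\<close> for a fixed length of time, as its speed is
  bounded, and \<open>E\<close> drops by a fixed amount; but \<open>E\<close> is bounded below
  and can only do so finitely often.
\<close>
lemma lasalle_zero_dissipation:
  fixes X :: "real \<Rightarrow> 'a::real_normed_vector" and E :: "real \<Rightarrow> real"
  assumes d: "\<And>t. t \<ge> 0 \<Longrightarrow> (E has_real_derivative G (X t)) (at t within {0..})"
    and G: "\<And>t. t \<ge> 0 \<Longrightarrow> G (X t) \<le> 0" and E: "\<And>t. t \<ge> 0 \<Longrightarrow> E t \<ge> 0"
    and lip: "\<And>s t. 0 \<le> s \<Longrightarrow> s \<le> t \<Longrightarrow> norm (X t - X s) \<le> M * (t - s)" and M: "M > 0"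
    and cont: "isCont G N" and s: "filterlim s at_top sequentially" and N: "(\<lambda>m. X (s m)) \<longlonglongrightarrow> N"
  shows "G N = 0"
proof (rule ccontr)
  assume ne: "G N \<noteq> 0"
  have spos: "eventually (\<lambda>m. s m \<ge> 0) sequentially" using s by (simp add: filterlim_at_top)
  have "(\<lambda>m. G (X (s m))) \<longlonglongrightarrow> G N" using cont N by (rule isCont_tendsto_compose)
  moreover have "eventually (\<lambda>m. G (X (s m)) \<le> 0) sequentially"
    using spos by eventually_elim (rule G)
  ultimately have "G N \<le> 0" by (intro tendsto_upperbound) auto
  with ne have neg: "G N < 0" by simp
  define \<eta> where "\<eta> = - G N / 2"
  have \<eta>: "\<eta> > 0" using neg by (simp add: \<eta>_def)
  have "eventually (\<lambda>x. G x < - \<eta>) (nhds N)"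
    using order_tendstoD(2)[OF cont[unfolded isCont_def tendsto_at_iff_tendsto_nhds], of "- \<eta>"] neg
    by (simp add: \<eta>_def)
  then obtain \<delta> where \<delta>: "\<delta> > 0" "\<And>x. dist x N < \<delta> \<Longrightarrow> G x < - \<eta>"
    unfolding eventually_nhds_metric by blast
  \<comment> \<open>the time needed to travel \<open>\<delta>/2\<close> at the greatest speed\<close>
  define \<tau> where "\<tau> = \<delta> / (2 * M)"
  have \<tau>: "\<tau> > 0" using \<delta> M by (simp add: \<tau>_def)
  define l where "l = Inf (E ` {0..})"
  have bdd: "bdd_below (E ` {0..})" using E by (intro bdd_belowI[of _ 0]) auto
  have "Inf (E ` {0..}) < l + \<eta> * \<tau>" using \<eta> \<tau> by (simp add: l_def)
  then obtain t0 where t0: "t0 \<ge> 0" "E t0 < l + \<eta> * \<tau>"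
    using cInf_less_iff[OF _ bdd, of "l + \<eta> * \<tau>"] by auto
  have mono: "E t \<le> E r" if "0 \<le> r" "r \<le> t" for r t
    by (rule nonincreasing_if_deriv_nonpos[OF that, of E "\<lambda>t. G (X t)"]) (use d G that in auto)
  have "eventually (\<lambda>m. s m \<ge> t0 \<and> dist (X (s m)) N < \<delta> / 2) sequentially"
    using s tendstoD[OF N, of "\<delta> / 2"] \<delta> by (auto simp: filterlim_at_top intro: eventually_conj)
  then obtain m where m: "s m \<ge> t0" "dist (X (s m)) N < \<delta> / 2"
    by (auto simp: eventually_sequentially)
  have "E (s m + \<tau>) + \<eta> * (s m + \<tau>) \<le> E (s m) + \<eta> * s m"
  proof (rule nonincreasing_if_deriv_nonpos[of _ _ "\<lambda>t. E t + \<eta> * t" "\<lambda>t. G (X t) + \<eta>"])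
    fix x assume x: "s m \<le> x" "x \<le> s m + \<tau>"
    show "((\<lambda>t. E t + \<eta> * t) has_real_derivative G (X x) + \<eta>) (at x within {0..})"
      using d[of x] x m t0 by (auto intro!: derivative_eq_intros)
    have "dist (X x) (X (s m)) \<le> M * (x - s m)" unfolding dist_norm using lip x m t0 by auto
    also have "\<dots> \<le> M * \<tau>" using x M by simp
    also have "\<dots> = \<delta> / 2" using M by (simp add: \<tau>_def)
    finally have "dist (X x) N < \<delta>" using m dist_triangle[of "X x" N "X (s m)"] by simp
    thus "G (X x) + \<eta> \<le> 0" using \<delta>(2)[of "X x"] by simp
  qed (use m t0 \<tau> in auto)
  moreover have "E (s m) \<le> E t0" using mono t0 m by auto
  moreover have "l \<le> E (s m + \<tau>)" unfolding l_def using m t0 \<tau> by (intro cInf_lower bdd) auto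
  ultimately show False using t0 by (simp add: algebra_simps)
qed

section \<open>Divided differences\<close>

text \<open>On the diagonal the value is \<open>f'\<close>, the continuous extension.\<close>
definition divdiff :: "(real \<Rightarrow> real) \<Rightarrow> (real \<Rightarrow> real) \<Rightarrow> real \<Rightarrow> real \<Rightarrow> real" where
  "divdiff f f' x y = (if x = y then f' x else (f x - f y) / (x - y))"

lemma divdiff_commute: "divdiff f f' x y = divdiff f f' y x"
  by (auto simp: divdiff_def) (metis minus_diff_eq minus_divide_divide)

lemma divdiff_mult: "divdiff f f' x y * (x - y) = f x - f y"
  by (simp add: divdiff_def)

lemma divdiff_mean_value:
  assumes d: "\<And>x. x \<in> {\<alpha>..\<beta>} \<Longrightarrow> (f has_real_derivative f' x) (at x within {\<alpha>..\<beta>})"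
    and xy: "x \<in> {\<alpha>..\<beta>}" "y \<in> {\<alpha>..\<beta>}"
  obtains c where "min x y \<le> c" "c \<le> max x y" "divdiff f f' x y = f' c"
proof -
  have *: thesis if xy: "x < y" "x \<in> {\<alpha>..\<beta>}" "y \<in> {\<alpha>..\<beta>}"
    and th: "\<And>c. x \<le> c \<Longrightarrow> c \<le> y \<Longrightarrow> divdiff f f' x y = f' c \<Longrightarrow> thesis" for x y thesis
  proof -
    have "\<exists>c\<in>{x..y}. f y - f x = (*) (f' c) (y - x)"
      by (rule mvt_very_simple) (use xy d has_field_derivative_subset[of f _ _ "{\<alpha>..\<beta>}" "{x..y}"]
          in \<open>force simp: has_field_derivative_def[symmetric]\<close>)+
    then obtain c where c: "x \<le> c" "c \<le> y" "f y - f x = f' c * (y - x)" by auto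
    hence "divdiff f f' x y = f' c" using xy(1) by (simp add: divdiff_def field_simps)
    thus thesis using th c by blast
  qed
  consider "x < y" | "y < x" | "x = y" by linarith
  thus thesis
  proof cases
    case 1 show thesis by (rule *[OF 1 xy]) (rule that, use 1 in auto)
  next
    case 2 show thesis by (rule *[OF 2 xy(2,1)]) (rule that, use 2 divdiff_commute in auto)
  next
    case 3 thus thesis using that[of x] by (simp add: divdiff_def)
  qed
qed

text \<open>
  Joint continuity on the square. At the diagonal the mean value theorem replaces each divided
  difference by a value of the continuous function \<open>f'\<close>.
\<close>
lemma tendsto_divdiff:
  assumes d: "\<And>x. x \<in> {\<alpha>..\<beta>} \<Longrightarrow> (f has_real_derivative f' x) (at x within {\<alpha>..\<beta>})"
    and c: "continuous_on {\<alpha>..\<beta>} f'"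
    and xn: "\<And>n. x n \<in> {\<alpha>..\<beta>}" "\<And>n. y n \<in> {\<alpha>..\<beta>}"
    and lim: "x \<longlonglongrightarrow> X" "y \<longlonglongrightarrow> Y"
  shows "(\<lambda>n. divdiff f f' (x n) (y n)) \<longlonglongrightarrow> divdiff f f' X Y"
proof -
  have XY: "X \<in> {\<alpha>..\<beta>}" "Y \<in> {\<alpha>..\<beta>}"
    using closed_sequentially[OF closed_atLeastAtMost _ lim(1)] closed_sequentially[OF closed_atLeastAtMost _ lim(2)] xn
    by blast+
  show ?thesis
  proof (cases "X = Y")
    case True
    have "\<forall>n. \<exists>c. min (x n) (y n) \<le> c \<and> c \<le> max (x n) (y n) \<and> divdiff f f' (x n) (y n) = f' c"
      using divdiff_mean_value[OF d xn(1) xn(2)] by metis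
    then obtain \<xi> where \<xi>: "\<And>n. min (x n) (y n) \<le> \<xi> n" "\<And>n. \<xi> n \<le> max (x n) (y n)"
        "\<And>n. divdiff f f' (x n) (y n) = f' (\<xi> n)" by metis
    have "\<xi> \<longlonglongrightarrow> X"
    proof (rule tendsto_sandwich)
      show "(\<lambda>n. min (x n) (y n)) \<longlonglongrightarrow> X" "(\<lambda>n. max (x n) (y n)) \<longlonglongrightarrow> X"
        using tendsto_min[OF lim] tendsto_max[OF lim] True by auto
    qed (use \<xi> in auto)
    moreover have "\<xi> n \<in> {\<alpha>..\<beta>}" for n using \<xi>(1,2)[of n] xn[of n] by (auto simp: min_def max_def split: if_splits)
    ultimately have "(\<lambda>n. f' (\<xi> n)) \<longlonglongrightarrow> f' X"
      using XY by (intro continuous_on_tendsto_compose[OF c]) auto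
    moreover have "divdiff f f' X Y = f' X" using True by (simp add: divdiff_def)
    ultimately show ?thesis by (simp only: \<xi>(3))
  next
    case False
    have fc: "continuous_on {\<alpha>..\<beta>} f"
      using d by (meson DERIV_continuous continuous_on_eq_continuous_within)
    have "(\<lambda>n. f (x n)) \<longlonglongrightarrow> f X" "(\<lambda>n. f (y n)) \<longlonglongrightarrow> f Y"
      using XY xn lim by (auto intro!: continuous_on_tendsto_compose[OF fc])
    hence "(\<lambda>n. (f (x n) - f (y n)) / (x n - y n)) \<longlonglongrightarrow> (f X - f Y) / (X - Y)"
      using False lim by (intro tendsto_intros) auto
    moreover have "eventually (\<lambda>n. x n \<noteq> y n) sequentially"
    proof -
      have "(\<lambda>n. x n - y n) \<longlonglongrightarrow> X - Y" by (intro tendsto_intros lim)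
      hence "eventually (\<lambda>n. x n - y n \<noteq> 0) sequentially" using False by (intro tendsto_imp_eventually_ne) auto
      thus ?thesis by simp
    qed
    hence "eventually (\<lambda>n. (f (x n) - f (y n)) / (x n - y n) = divdiff f f' (x n) (y n)) sequentially"
      by eventually_elim (simp add: divdiff_def)
    ultimately have "(\<lambda>n. divdiff f f' (x n) (y n)) \<longlonglongrightarrow> (f X - f Y) / (X - Y)"
      by (rule Lim_transform_eventually)
    thus ?thesis using False by (simp add: divdiff_def)
  qed
qed

section \<open>Global solutions of Lipschitz equations\<close>

text \<open>
  Picard iteration for \<open>z(t) = e\<^bsup>-\<mu>t\<^esup> X(t)\<close> in the space of
  bounded continuous functions. The exponential weight makes the iteration a contraction on the
  whole half-line at once, so that no local solutions have to be glued. Negative times are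
  collapsed to \<open>0\<close>, since the function space lives on all of
  \<open>\<real>\<close>.
\<close>
lemma global_ode_solution:
  fixes F :: "'a::euclidean_space \<Rightarrow> 'a"
  assumes lip: "\<And>x y. norm (F x - F y) \<le> L * norm (x - y)" and bd: "\<And>x. norm (F x) \<le> B"
  obtains X where "X 0 = T" "\<And>t. t \<ge> 0 \<Longrightarrow> (X has_vector_derivative F (X t)) (at t within {0..})"
proof -
  define K where "K = \<bar>L\<bar> + 1"
  have K: "K > 0" by (simp add: K_def)
  have lipK: "norm (F x - F y) \<le> K * norm (x - y)" for x y
    by (rule order_trans[OF lip]) (intro mult_right_mono, auto simp: K_def)
  have contF: "continuous_on UNIV F"
    using lipK K by (intro lipschitz_on_continuous_on lipschitz_onI) (auto simp: dist_norm)
  have B: "B \<ge> 0" using bd[of 0] norm_ge_zero order_trans by blast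
  \<comment> \<open>twice the Lipschitz constant gives the contraction factor \<open>1/2\<close>\<close>
  define \<mu> where "\<mu> = 2 * K"
  have \<mu>: "\<mu> > 0" using K by (simp add: \<mu>_def)
  define g where "g z s = F (exp (\<mu> * s) *\<^sub>R apply_bcontfun z s)" for z :: "real \<Rightarrow>\<^sub>C 'a" and s
  define I where "I z t = integral {0..t} (g z)" for z t
  define h where "h z t = exp (- \<mu> * max 0 t) *\<^sub>R (T + I z (max 0 t))" for z t
  have cg: "continuous_on S (g z)" for S z
    unfolding g_def
    by (rule continuous_on_compose2[OF contF]) (auto intro!: continuous_intros)
  have dI: "(I z has_vector_derivative g z t) (at t within {0..})" if "t \<ge> 0" for z t
  proof -
    have "(I z has_vector_derivative g z t) (at t within {0..t+1})"
      unfolding I_def using that by (intro integral_has_vector_derivative cg) auto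
    moreover have "at t within {0..t+1} = at t within {0..}"
      by (rule at_within_nhd[of t "{..<t+1}"]) (use that in auto)
    ultimately show ?thesis by simp
  qed
  have cI: "continuous_on {0..} (I z)" for z
    using dI by (meson atLeast_iff continuous_on_eq_continuous_within has_vector_derivative_continuous)
  have bI: "norm (I z t) \<le> B * t" if "t \<ge> 0" for z t
    unfolding I_def using integral_bound[OF that cg, of z B] bd by (simp add: g_def)
  have hb: "h z \<in> bcontfun" for z
  proof (rule bcontfun_normI)
    show "continuous_on UNIV (h z)"
      unfolding h_def by (intro continuous_intros continuous_on_compose2[OF cI]) auto
    fix t :: real
    define \<tau> where "\<tau> = max 0 t"
    have \<tau>: "\<tau> \<ge> 0" by (simp add: \<tau>_def)
    have "\<mu> * \<tau> * exp (- \<mu> * \<tau>) \<le> 1"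
      using order_trans[OF _ exp_ge_add_one_self, of "\<mu> * \<tau>" "\<mu> * \<tau>"] by (simp add: exp_minus field_simps)
    hence e: "\<tau> * exp (- \<mu> * \<tau>) \<le> 1 / \<mu>" using \<mu> by (simp add: field_simps)
    have "norm (h z t) \<le> exp (- \<mu> * \<tau>) * (norm T + B * \<tau>)"
      unfolding h_def \<tau>_def[symmetric] norm_scaleR
      using norm_triangle_ineq[of T "I z \<tau>"] bI[OF \<tau>, of z] by (auto intro!: mult_left_mono)
    also have "\<dots> = exp (- \<mu> * \<tau>) * norm T + B * (\<tau> * exp (- \<mu> * \<tau>))" by (simp add: algebra_simps)
    also have "\<dots> \<le> 1 * norm T + B * (1 / \<mu>)"
      using e B \<tau> \<mu> by (intro add_mono mult_right_mono mult_left_mono) auto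
    finally show "norm (h z t) \<le> 1 * norm T + B * (1 / \<mu>)" .
  qed
  define \<Phi> where "\<Phi> z = Bcontfun (h z)" for z
  have \<Phi>: "apply_bcontfun (\<Phi> z) = h z" for z
    unfolding \<Phi>_def by (rule Bcontfun_inverse[OF hb])
  have "dist (\<Phi> z) (\<Phi> w) \<le> 1/2 * dist z w" for z w
  proof (rule dist_bound)
    fix t :: real
    define \<tau> where "\<tau> = max 0 t"
    have \<tau>: "\<tau> \<ge> 0" by (simp add: \<tau>_def)
    define D where "D = dist z w"
    have ftc: "((\<lambda>s. K * exp (\<mu> * s) * D) has_integral (exp (\<mu> * \<tau>) * D / 2 - exp (\<mu> * 0) * D / 2)) {0..\<tau>}"
      by (rule fundamental_theorem_of_calculus[OF \<tau>])
         (auto intro!: derivative_eq_intros simp: has_real_derivative_iff_has_vector_derivative[symmetric] \<mu>_def)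
    have "I z \<tau> - I w \<tau> = integral {0..\<tau>} (\<lambda>s. g z s - g w s)"
      unfolding I_def by (intro integral_diff[symmetric] integrable_continuous_real cg)
    also have "norm \<dots> \<le> integral {0..\<tau>} (\<lambda>s. K * exp (\<mu> * s) * D)"
    proof (rule Henstock_Kurzweil_Integration.integral_norm_bound_integral)
      show "(\<lambda>s. g z s - g w s) integrable_on {0..\<tau>}"
        by (intro integrable_continuous_real continuous_intros cg)
      show "(\<lambda>s. K * exp (\<mu> * s) * D) integrable_on {0..\<tau>}" using ftc by blast
      fix s
      have "norm (g z s - g w s) \<le> K * norm (exp (\<mu> * s) *\<^sub>R (apply_bcontfun z s - apply_bcontfun w s))"
        unfolding g_def scaleR_diff_right by (rule lipK)
      also have "\<dots> \<le> K * (exp (\<mu> * s) * D)"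
        using K dist_bounded[of z s w] by (simp add: D_def dist_norm)
      finally show "norm (g z s - g w s) \<le> K * exp (\<mu> * s) * D" by (simp add: mult.assoc)
    qed
    also have "\<dots> \<le> exp (\<mu> * \<tau>) * D / 2" using integral_unique[OF ftc] by (simp add: D_def)
    finally have *: "norm (I z \<tau> - I w \<tau>) \<le> exp (\<mu> * \<tau>) * D / 2" .
    have "dist (h z t) (h w t) = exp (- \<mu> * \<tau>) * norm (I z \<tau> - I w \<tau>)"
      unfolding h_def \<tau>_def[symmetric] dist_norm by (simp add: scaleR_diff_right[symmetric])
    also have "\<dots> \<le> exp (- \<mu> * \<tau>) * (exp (\<mu> * \<tau>) * D / 2)"
      using * by (intro mult_left_mono) auto
    also have "\<dots> = 1/2 * D" by (simp add: exp_minus)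
    finally show "dist (apply_bcontfun (\<Phi> z) t) (apply_bcontfun (\<Phi> w) t) \<le> 1/2 * dist z w"
      unfolding \<Phi> D_def .
  qed
  hence "\<exists>!z. \<Phi> z = z" by (intro banach_fix_type[of "1/2"]) auto
  then obtain z where z: "\<Phi> z = z" by blast
  have zt: "apply_bcontfun z t = h z t" for t using \<Phi>[of z] z by simp
  define X where "X t = T + I z t" for t
  have Xg: "g z t = F (X t)" if "t \<ge> 0" for t
    unfolding g_def zt X_def h_def using that by (simp add: exp_minus)
  show thesis
  proof (rule that[of X])
    show "X 0 = T" by (simp add: X_def I_def)
    show "(X has_vector_derivative F (X t)) (at t within {0..})" if "t \<ge> 0" for t
      using has_vector_derivative_add[OF has_vector_derivative_const[of T] dI[OF that, of z]] Xg[OF that]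
      by (simp add: X_def[abs_def])
  qed
qed

section \<open>Singular values\<close>

lemma sum_eigenvalues_gram:
  fixes X :: "complex^'n^'n" and g :: "real \<Rightarrow> real"
  assumes "eigdecomp U h (adj X ** X)" "eigdecomp W k (X ** adj X)"
  shows "(\<Sum>i\<in>UNIV. g (h i)) = (\<Sum>i\<in>UNIV. g (k i))"
  using trace_herm_fun_gram[of g X] unfolding trace_herm_fun[OF assms(1)] trace_herm_fun[OF assms(2)]
  by (metis of_real_eq_iff of_real_sum)

lemma gram_eigenvalue:
  assumes "eigdecomp U h (adj X ** X)"
  shows "h j = (\<Sum>k\<in>UNIV. (cmod ((X ** U) $ k $ j))\<^sup>2)"
proof -
  have U: "unitary_mat U" "adj X ** X = U ** real_diag h ** adj U" using assms by (auto simp: eigdecomp_def)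
  have "real_diag h = adj U ** (U ** real_diag h ** adj U) ** U"
    by (simp add: matrix_mul_assoc unitary_cancel[OF U(1)])
  also have "\<dots> = adj (X ** U) ** (X ** U)"
    unfolding U(2)[symmetric] by (simp add: adj_mult matrix_mul_assoc)
  finally have "real_diag h $ j $ j = (adj (X ** U) ** (X ** U)) $ j $ j" by simp
  hence "of_real (h j) = (\<Sum>k\<in>UNIV. cnj ((X ** U) $ k $ j) * (X ** U) $ k $ j)"
    by (simp add: mm_entry[of "adj (X ** U)"] real_diag_def)
  also have "\<dots> = of_real (\<Sum>k\<in>UNIV. (cmod ((X ** U) $ k $ j))\<^sup>2)"
    by (simp only: of_real_sum complex_norm_square mult.commute)
  finally show ?thesis unfolding of_real_eq_iff .
qed

lemma gram_eigenvalue_nonneg: "eigdecomp U h (adj X ** X) \<Longrightarrow> h j \<ge> 0"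
  unfolding gram_eigenvalue by (simp add: sum_nonneg)

text \<open>
  The eigenvectors of \<open>X\<^sup>* X\<close> with eigenvalue \<open>0\<close> span the
  kernel of \<open>X\<close>.
\<close>
lemma gram_kernel:
  assumes "eigdecomp U h (adj X ** X)" "h j = 0"
  shows "(X ** U) $ k $ j = 0"
proof -
  have "(\<Sum>k\<in>UNIV. (cmod ((X ** U) $ k $ j))\<^sup>2) = 0"
    using gram_eigenvalue[OF assms(1), of j] assms(2) by simp
  thus ?thesis by (subst (asm) sum_nonneg_eq_0_iff) auto
qed

definition spec_in :: "real \<Rightarrow> real \<Rightarrow> complex^'n^'n \<Rightarrow> bool" where
  "spec_in \<alpha> \<beta> A \<longleftrightarrow> (\<exists>U d. eigdecomp U d A \<and> (\<forall>i. d i \<in> {\<alpha>..\<beta>}))"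

text \<open>
  Test the equality of the eigenvalue sums with the indicator function of the complement of the
  interval.
\<close>
lemma spec_in_gram_eigenvalues:
  fixes X :: "complex^'n^'n"
  assumes "spec_in \<alpha> \<beta> (adj X ** X)"
  shows "eigdecomp U h (adj X ** X) \<Longrightarrow> h i \<in> {\<alpha>..\<beta>}"
    and "eigdecomp W k (X ** adj X) \<Longrightarrow> k i \<in> {\<alpha>..\<beta>}"
proof -
  \<comment> \<open>counts the eigenvalues outside the interval\<close>
  define g where "g x = (if x \<in> {\<alpha>..\<beta>} then 0 else 1 :: real)" for x
  obtain V d where V: "eigdecomp V d (adj X ** X)" "\<forall>i. d i \<in> {\<alpha>..\<beta>}"
    using assms by (auto simp: spec_in_def)
  have 0: "(\<Sum>i\<in>UNIV. g (d i)) = 0" using V(2) by (simp add: g_def image_subset_iff)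
  obtain W' k' where W': "eigdecomp W' k' (X ** adj X)" using hermitian_eigdecomp[of "X ** adj X"] by auto
  have 1: "e i \<in> {\<alpha>..\<beta>}" if "(\<Sum>i\<in>UNIV. g (e i)) = 0" for e :: "'n \<Rightarrow> real" and i
  proof -
    have "g (e i) = 0" using that by (subst (asm) sum_nonneg_eq_0_iff) (auto simp: g_def)
    thus ?thesis by (auto simp: g_def split: if_splits)
  qed
  show "h i \<in> {\<alpha>..\<beta>}" if "eigdecomp U h (adj X ** X)"
    using sum_eigenvalues_gram[OF that W', of g] sum_eigenvalues_gram[OF V(1) W', of g] 0 1[of h] by simp
  show "k i \<in> {\<alpha>..\<beta>}" if "eigdecomp W k (X ** adj X)"
    using sum_eigenvalues_gram[OF V(1) that, of g] 0 1[of k] by simp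
qed

lemma norm_le_if_spec_in:
  fixes X :: "complex^'n^'n" and \<alpha> \<beta> :: real
  assumes "spec_in \<alpha> \<beta> (adj X ** X)"
  shows "norm X \<le> sqrt (real CARD('n) * \<beta>)"
proof -
  obtain V d where V: "eigdecomp V d (adj X ** X)" "\<forall>i. d i \<in> {\<alpha>..\<beta>}"
    using assms by (auto simp: spec_in_def)
  have "(norm X)\<^sup>2 = (\<Sum>i\<in>UNIV. d i)"
    using trace_herm_fun[OF V(1), of "\<lambda>x. x"] by (simp add: norm_sq_trace herm_fun_id)
  also have "\<dots> \<le> (\<Sum>i\<in>(UNIV::'n set). \<beta>)" using V(2) by (intro sum_mono) (auto simp: image_subset_iff)
  finally have "(norm X)\<^sup>2 \<le> real CARD('n) * \<beta>" by simp
  thus ?thesis by (rule real_le_rsqrt)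
qed

lemma spectrum_eigdecomp:
  assumes "eigdecomp U e (A :: complex^'n^'n)"
  shows "spectrum A = complex_of_real ` range e"
proof -
  have U: "unitary_mat U" "A = U ** real_diag e ** adj U" using assms by (auto simp: eigdecomp_def)
  have dU: "det U * det (adj U) = 1"
    using U(1) by (metis det_I det_mul unitary_mat_def)
  have "invertible (A - mat z) \<longleftrightarrow> (\<forall>i. of_real (e i) \<noteq> z)" for z
  proof -
    have "U ** mat z ** adj U = mat z"
      unfolding mat_mm_commute[where A = U, symmetric] using unitary_cancel(2)[OF U(1)]
      by (simp add: matrix_mul_assoc[symmetric])
    hence "A - mat z = U ** (real_diag e - mat z) ** adj U"
      by (simp add: U(2) mm_ring)
    hence "det (A - mat z) = det (real_diag e - mat z) * (det U * det (adj U))" by (simp add: det_mul)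
    also have "\<dots> = (\<Prod>i\<in>UNIV. of_real (e i) - z)"
      unfolding dU by (subst det_diagonal) (auto simp: real_diag_def mat_def)
    finally show ?thesis by (simp add: invertible_det_nz)
  qed
  thus ?thesis by (auto simp: spectrum_def image_iff)
qed

lemma mats_between_iff_spec_in:
  fixes X :: "complex^'n^'n"
  assumes "0 \<le> a" "a \<le> b"
  shows "X \<in> mats_between a b \<longleftrightarrow> spec_in (a\<^sup>2) (b\<^sup>2) (adj X ** X)"
proof -
  obtain U d where U: "eigdecomp U d (adj X ** X)" using hermitian_eigdecomp[of "adj X ** X"] by auto
  have d: "d i \<ge> 0" for i using gram_eigenvalue_nonneg[OF U] .
  have "sqrt (d i) \<in> {a..b} \<longleftrightarrow> d i \<in> {a\<^sup>2..b\<^sup>2}" for i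
    using real_sqrt_le_iff[of "a\<^sup>2" "d i"] real_sqrt_le_iff[of "d i" "b\<^sup>2"] assms by simp
  moreover have "X \<in> mats_between a b \<longleftrightarrow> (\<forall>i. sqrt (d i) \<in> {a..b})"
    unfolding mats_between_def mat_abs_def using spectrum_eigdecomp[OF eigdecomp_herm_fun[OF U, of sqrt]] by (auto simp: image_subset_iff image_iff)
  moreover have "spec_in (a\<^sup>2) (b\<^sup>2) (adj X ** X) \<longleftrightarrow> (\<forall>i. d i \<in> {a\<^sup>2..b\<^sup>2})"
  proof
    assume "spec_in (a\<^sup>2) (b\<^sup>2) (adj X ** X)"
    thus "\<forall>i. d i \<in> {a\<^sup>2..b\<^sup>2}" using spec_in_gram_eigenvalues(1)[OF _ U] by blast
  qed (use U in \<open>auto simp: spec_in_def image_subset_iff\<close>)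
  ultimately show ?thesis by simp
qed

lemma phi_mat_eq:
  "phi_mat \<phi>1 \<phi>2 X = herm_fun (\<lambda>x. \<phi>1 (sqrt x)) (adj X ** X) - herm_fun (\<lambda>x. \<phi>2 (sqrt x)) (X ** adj X)"
  by (simp add: phi_mat_def mat_abs_def herm_fun_compose)

section \<open>Derivatives of trace functions\<close>

text \<open>
  By the two-basis formula the remainder of the first order expansion at \<open>H(t)\<close> is
  bounded by \<open>C \<parallel>H(s) - H(t)\<parallel>\<^sup>2\<close>, which has derivative
  \<open>0\<close> at \<open>t\<close>.
\<close>
lemma trace_herm_fun_has_derivative:
  fixes H :: "real \<Rightarrow> complex^'n^'n"
  assumes rem: "\<And>x y. \<bar>h y - h x - h' x * (y - x)\<bar> \<le> C * (y - x)\<^sup>2"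
    and herm: "\<And>s. adj (H s) = H s"
    and d: "(H has_vector_derivative H') (at t within S)"
  shows "((\<lambda>s. Re (trace (herm_fun h (H s)))) has_real_derivative Re (trace (herm_fun h' (H t) ** H'))) (at t within S)"
proof -
  define g where "g s = Re (trace (herm_fun h (H s)))" for s
  define l where "l Y = Re (trace (herm_fun h' (H t) ** Y))" for Y
  have l: "bounded_linear l"
    unfolding l_def by (intro bounded_linear_compose[OF bounded_linear_Re] bounded_linear_compose[OF bounded_linear_trace]
        bounded_bilinear.bounded_linear_right[OF bounded_bilinear_mm])
  define R where "R s = g s - l (H s)" for s
  define q where "q s = inner (H s - H t) (H s - H t)" for s
  have R: "\<bar>R s - R t\<bar> \<le> C * q s" for s
  proof -
    obtain U a where U: "eigdecomp U a (H t)" using hermitian_eigdecomp[OF herm] .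
    obtain W b where W: "eigdecomp W b (H s)" using hermitian_eigdecomp[OF herm] .
    have "R s - R t = g s - g t - Re (trace (herm_fun h' (H t) ** (herm_fun (\<lambda>x. x) (H s) - herm_fun (\<lambda>x. x) (H t))))"
      by (simp add: R_def l_def herm_fun_id herm mm_ring trace_sub)
    also have "\<dots> = (\<Sum>i\<in>UNIV. \<Sum>j\<in>UNIV. overlap U W i j * (h (b j) - h (a i) - h' (a i) * (b j - a i)))"
      unfolding g_def by (rule trace_taylor_two_bases[OF U W])
    also have "\<bar>\<dots>\<bar> \<le> (\<Sum>i\<in>UNIV. \<Sum>j\<in>UNIV. \<bar>overlap U W i j * (h (b j) - h (a i) - h' (a i) * (b j - a i))\<bar>)"
      by (rule order_trans[OF sum_abs]) (intro sum_mono sum_abs)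
    also have "\<dots> \<le> (\<Sum>i\<in>UNIV. \<Sum>j\<in>UNIV. overlap U W i j * (C * (a i - b j)\<^sup>2))"
      unfolding abs_mult using rem[of "b _" "a _"]
      by (intro sum_mono mult_mono) (auto simp: power2_commute)
    also have "\<dots> = C * (norm (H t - H s))\<^sup>2"
      using norm_diff_herm_fun[OF U W, of "\<lambda>x. x" "\<lambda>x. x"]
      by (simp add: herm_fun_id herm sum_distrib_left mult_ac)
    finally show ?thesis by (simp add: q_def dot_square_norm norm_minus_commute)
  qed
  have "((\<lambda>s. H s - H t) has_vector_derivative H') (at t within S)"
    using has_vector_derivative_diff[OF d has_vector_derivative_const[of "H t"]] by simp
  from vector_derivative_inner[OF this this] have "(q has_real_derivative 0) (at t within S)"
    by (simp add: q_def[abs_def])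
  hence q0: "((\<lambda>s. C * (q s / (s - t))) \<longlongrightarrow> 0) (at t within S)"
    unfolding has_field_derivative_iff
    by (intro tendsto_mult_right_zero) (simp add: q_def)
  have "((\<lambda>s. (R s - R t) / (s - t)) \<longlongrightarrow> 0) (at t within S)"
  proof (rule Lim_null_comparison[OF _ tendsto_rabs_zero[OF q0]], rule always_eventually, rule allI)
    fix s
    have "\<bar>R s - R t\<bar> \<le> \<bar>C * q s\<bar>" using R[of s] by linarith
    thus "norm ((R s - R t) / (s - t)) \<le> \<bar>C * (q s / (s - t))\<bar>"
      by (simp add: abs_mult divide_right_mono)
  qed
  hence "(R has_real_derivative 0) (at t within S)" by (simp add: has_field_derivative_iff)
  moreover have "((\<lambda>s. l (H s)) has_real_derivative l H') (at t within S)"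
    using bounded_linear.has_vector_derivative[OF l d] by (simp add: has_real_derivative_iff_has_vector_derivative)
  ultimately have "((\<lambda>s. R s + l (H s)) has_real_derivative 0 + l H') (at t within S)" by (rule DERIV_add)
  thus ?thesis by (simp add: R_def l_def g_def)
qed

section \<open>The vector field\<close>

text \<open>
  Composition with this truncation extends continuous functions from
  \<open>[\<alpha>, \<beta>]\<close> to the real line, keeps monotonicity and Lipschitz
  constants, and makes them bounded.
\<close>
definition cut :: "real \<Rightarrow> real \<Rightarrow> real \<Rightarrow> real" where
  "cut \<alpha> \<beta> x = max \<alpha> (min \<beta> x)"

lemma cut_in: "\<alpha> \<le> \<beta> \<Longrightarrow> cut \<alpha> \<beta> x \<in> {\<alpha>..\<beta>}"
  and cut_id: "x \<in> {\<alpha>..\<beta>} \<Longrightarrow> cut \<alpha> \<beta> x = x"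
  and cut_lipschitz: "\<bar>cut \<alpha> \<beta> x - cut \<alpha> \<beta> y\<bar> \<le> \<bar>x - y\<bar>"
  and cut_mono: "x \<le> y \<Longrightarrow> cut \<alpha> \<beta> x \<le> cut \<alpha> \<beta> y"
  by (auto simp: cut_def)

text \<open>
  Globally defined extensions \<open>f\<^sub>i\<close> of \<open>\<psi>\<^sub>i\<close>,
  constant outside \<open>[\<alpha>, \<beta>] = [a\<^sup>2, b\<^sup>2]\<close>: the equation
  can be solved before it is known that the singular values stay in \<open>[a, b]\<close>.
\<close>
locale clamped_pair =
  fixes \<alpha> \<beta> L B :: real and f1 f2 :: "real \<Rightarrow> real"
  assumes \<alpha>: "0 \<le> \<alpha>" and \<alpha>\<beta>: "\<alpha> \<le> \<beta>"
    and mono: "mono f1" "mono f2"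
    and lip: "\<And>x y. \<bar>f1 x - f1 y\<bar> \<le> L * \<bar>x - y\<bar>" "\<And>x y. \<bar>f2 x - f2 y\<bar> \<le> L * \<bar>x - y\<bar>" and L: "L \<ge> 0"
    and bd: "\<And>x. \<bar>f1 x\<bar> \<le> B" "\<And>x. \<bar>f2 x\<bar> \<le> B"
    and cutoff: "\<And>x. f1 (cut \<alpha> \<beta> x) = f1 x" "\<And>x. f2 (cut \<alpha> \<beta> x) = f2 x"
begin

definition Phi :: "complex^'n^'n \<Rightarrow> complex^'n^'n" where
  "Phi X = herm_fun f1 (adj X ** X) - herm_fun f2 (X ** adj X)"

definition vfield :: "complex^'n^'n \<Rightarrow> complex^'n^'n" where
  "vfield X = comm_mat (Phi X) X"

lemma B_nonneg: "B \<ge> 0" using bd(1)[of 0] by linarith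

lemma norm_Phi: "norm (Phi X) \<le> 2 * sqrt (CARD('n)) * B" for X :: "complex^'n^'n"
  unfolding Phi_def
  by (rule order_trans[OF norm_triangle_ineq4])
     (use norm_herm_fun_le[of "adj X ** X" f1 B] norm_herm_fun_le[of "X ** adj X" f2 B] bd in auto)

lemma norm_gram_diff:
  fixes X :: "complex^'n^'n"
  assumes "norm X \<le> r" "norm Y \<le> r"
  shows "norm (adj X ** X - adj Y ** Y) \<le> 2 * r * norm (X - Y)"
    and "norm (X ** adj X - Y ** adj Y) \<le> 2 * r * norm (X - Y)"
proof -
  have *: "norm (A ** C - A' ** C') \<le> 2 * r * e"
    if "norm A \<le> r" "norm C' \<le> r" "norm (A - A') \<le> e" "norm (C - C') \<le> e" for A A' C C' :: "complex^'n^'n" and e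
  proof -
    have "A ** C - A' ** C' = A ** (C - C') + (A - A') ** C'" by (simp add: mm_ring)
    also have "norm \<dots> \<le> norm A * norm (C - C') + norm (A - A') * norm C'"
      by (rule order_trans[OF norm_triangle_ineq]) (intro add_mono norm_mm_le)
    also have "\<dots> \<le> r * e + e * r"
      using that by (intro add_mono mult_mono) (auto intro: order_trans[OF norm_ge_zero])
    finally show ?thesis by (simp add: algebra_simps)
  qed
  show "norm (adj X ** X - adj Y ** Y) \<le> 2 * r * norm (X - Y)"
    "norm (X ** adj X - Y ** adj Y) \<le> 2 * r * norm (X - Y)"
    by (rule *; use assms in \<open>simp add: adj_diff[symmetric]\<close>)+
qed

lemma Phi_lipschitz:
  fixes X :: "complex^'n^'n"
  assumes "norm X \<le> r" "norm Y \<le> r"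
  shows "norm (Phi X - Phi Y) \<le> 4 * r * L * norm (X - Y)"
proof -
  have "Phi X - Phi Y = (herm_fun f1 (adj X ** X) - herm_fun f1 (adj Y ** Y)) - (herm_fun f2 (X ** adj X) - herm_fun f2 (Y ** adj Y))"
    by (simp add: Phi_def)
  also have "norm \<dots> \<le> L * norm (adj X ** X - adj Y ** Y) + L * norm (X ** adj X - Y ** adj Y)"
    by (rule order_trans[OF norm_triangle_ineq4])
       (intro add_mono herm_fun_lipschitz lip L herm_gram)
  also have "\<dots> \<le> L * (2 * r * norm (X - Y)) + L * (2 * r * norm (X - Y))"
    by (intro add_mono mult_left_mono norm_gram_diff assms L)
  finally show ?thesis by (simp add: algebra_simps)
qed

lemma continuous_Phi: "isCont (Phi :: complex^'n^'n \<Rightarrow> _) X"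
proof -
  define r where "r = norm X + 1"
  have "L * 4 * r \<ge> 0" using L by (simp add: r_def)
  hence "continuous_on (ball 0 r) (Phi :: complex^'n^'n \<Rightarrow> _)"
    by (intro lipschitz_on_continuous_on[of "L * 4 * r"] lipschitz_onI)
      (simp add: dist_norm, rule order_trans[OF Phi_lipschitz[of _ r]], simp_all)
  thus ?thesis by (rule continuous_on_interior) (simp add: r_def)
qed

lemma vfield_bound: "norm (vfield X) \<le> 4 * sqrt (CARD('n)) * B * norm X" for X :: "complex^'n^'n"
  unfolding vfield_def using norm_comm_mat[of "Phi X" X] mult_right_mono[OF norm_Phi[of X], of "2 * norm X"] by (simp add: mult_ac)

lemma vfield_lipschitz:
  fixes X :: "complex^'n^'n"
  assumes "norm X \<le> r" "norm Y \<le> r"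
  shows "norm (vfield X - vfield Y) \<le> (8 * r * r * L + 4 * sqrt (CARD('n)) * B) * norm (X - Y)"
proof -
  have r: "r \<ge> 0" using assms(1) norm_ge_zero order_trans by blast
  have "vfield X - vfield Y = comm_mat (Phi X - Phi Y) X + comm_mat (Phi Y) (X - Y)"
    by (simp add: vfield_def comm_mat_def mm_ring)
  also have "norm \<dots> \<le> 2 * norm (Phi X - Phi Y) * norm X + 2 * norm (Phi Y) * norm (X - Y)"
    by (rule order_trans[OF norm_triangle_ineq]) (intro add_mono norm_comm_mat)
  also have "\<dots> \<le> 2 * (4 * r * L * norm (X - Y)) * r + 2 * (2 * sqrt (CARD('n)) * B) * norm (X - Y)"
    using assms r L B_nonneg by (intro add_mono mult_mono Phi_lipschitz norm_Phi) auto
  finally show ?thesis by (simp add: algebra_simps)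
qed

text \<open>
  The functions \<open>g1\<close> and \<open>g2\<close> are free: their traces at
  \<open>X\<^sup>* X\<close> and \<open>X X\<^sup>*\<close> agree and cancel. They are chosen
  so that every summand has a sign, which is how the rearrangement inequality for isospectral
  matrices enters.
\<close>
lemma trace_Phi_difference:
  fixes X :: "complex^'n^'n"
  assumes U: "eigdecomp U h (adj X ** X)" and W: "eigdecomp W k (X ** adj X)"
  shows "Re (trace (Phi X ** (herm_fun l (X ** adj X) - herm_fun l (adj X ** X)))) =
    - (\<Sum>i\<in>UNIV. \<Sum>j\<in>UNIV. overlap U W i j * (g1 (k j) - g1 (h i) - f1 (h i) * (l (k j) - l (h i))))
    - (\<Sum>i\<in>UNIV. \<Sum>j\<in>UNIV. overlap W U i j * (g2 (h j) - g2 (k i) - f2 (k i) * (l (h j) - l (k i))))"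
  unfolding trace_taylor_two_bases[OF U W, symmetric] trace_taylor_two_bases[OF W U, symmetric]
  by (simp add: trace_herm_fun_gram Phi_def mm_ring trace_sub)

text \<open>
  Cyclicity of the trace and
  \<open>X h'(X\<^sup>* X) X\<^sup>* = (h' \<cdot> id)(X X\<^sup>*)\<close> turn the
  derivative into a pairing of \<open>\<Phi>\<close> with a difference of functions of the two
  Gram matrices. The scalar \<open>c\<close> leaves room for a cut-off of the vector field.
\<close>
lemma derivative_trace_gram:
  fixes X :: "real \<Rightarrow> complex^'n^'n"
  assumes rem: "\<And>x y. \<bar>h y - h x - h' x * (y - x)\<bar> \<le> C * (y - x)\<^sup>2"
    and d: "(X has_vector_derivative c *\<^sub>R vfield (X t)) (at t within S)"
  shows "((\<lambda>s. Re (trace (herm_fun h (adj (X s) ** X s)))) has_real_derivative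
     2 * c * Re (trace (Phi (X t) ** (herm_fun (\<lambda>x. h' x * x) (X t ** adj (X t)) - herm_fun (\<lambda>x. h' x * x) (adj (X t) ** X t)))))
     (at t within S)"
proof -
  define Y where "Y = X t"
  define Z where "Z = c *\<^sub>R vfield Y"
  define A where "A = herm_fun h' (adj Y ** Y)"
  have hA: "adj A = A" by (simp add: A_def adj_herm_fun)
  have dH: "((\<lambda>s. adj (X s) ** X s) has_vector_derivative (adj Y ** Z + adj Z ** Y)) (at t within S)"
    using bounded_bilinear.has_vector_derivative[OF bounded_bilinear_mm
        bounded_linear.has_vector_derivative[OF bounded_linear_adj d] d] by (simp add: Y_def Z_def)
  have "Re (trace (A ** (adj Y ** Z + adj Z ** Y))) = 2 * Re (trace (A ** adj Y ** Z))"
  proof -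
    have "trace (A ** adj Z ** Y) = cnj (trace (adj Y ** Z ** A))"
      unfolding trace_adj[symmetric] by (simp add: adj_mult hA matrix_mul_assoc)
    also have "trace (adj Y ** Z ** A) = trace (A ** (adj Y ** Z))" by (rule trace_mul_sym)
    finally show ?thesis by (simp add: mm_ring trace_add)
  qed
  also have "trace (A ** adj Y ** Z) = of_real c * (trace (A ** adj Y ** Phi Y ** Y) - trace (A ** adj Y ** Y ** Phi Y))"
    by (simp add: Z_def vfield_def comm_mat_def mm_ring trace_scaleR trace_sub algebra_simps)
  also have "trace (A ** adj Y ** Phi Y ** Y) = trace (Phi Y ** herm_fun (\<lambda>x. h' x * x) (Y ** adj Y))"
  proof -
    have "trace (A ** adj Y ** Phi Y ** Y) = trace (Phi Y ** (Y ** A ** adj Y))"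
    proof -
      have "trace ((A ** adj Y) ** (Phi Y ** Y)) = trace (Phi Y ** Y ** (A ** adj Y))" by (rule trace_mul_sym)
      thus ?thesis by (simp add: matrix_mul_assoc)
    qed
    also have "Y ** A ** adj Y = herm_fun h' (Y ** adj Y) ** herm_fun (\<lambda>x. x) (Y ** adj Y)"
      by (simp add: A_def herm_fun_gram_intertwine herm_fun_id matrix_mul_assoc)
    also have "\<dots> = herm_fun (\<lambda>x. h' x * x) (Y ** adj Y)" by (rule herm_fun_mult) simp
    finally show ?thesis .
  qed
  also have "trace (A ** adj Y ** Y ** Phi Y) = trace (Phi Y ** herm_fun (\<lambda>x. h' x * x) (adj Y ** Y))"
  proof -
    have "A ** adj Y ** Y = herm_fun h' (adj Y ** Y) ** herm_fun (\<lambda>x. x) (adj Y ** Y)"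
      by (simp add: A_def herm_fun_id matrix_mul_assoc)
    also have "\<dots> = herm_fun (\<lambda>x. h' x * x) (adj Y ** Y)" by (rule herm_fun_mult) simp
    finally show ?thesis using trace_mul_sym by metis
  qed
  finally have "Re (trace (A ** (adj Y ** Z + adj Z ** Y))) =
      2 * c * Re (trace (Phi Y ** (herm_fun (\<lambda>x. h' x * x) (Y ** adj Y) - herm_fun (\<lambda>x. h' x * x) (adj Y ** Y))))"
    by (simp add: mm_ring trace_sub)
  thus ?thesis
    using trace_herm_fun_has_derivative[OF rem _ dH] by (simp add: A_def Y_def)
qed

end

section \<open>Compactness of eigenbases\<close>

lemma norm_unitary: "unitary_mat U \<Longrightarrow> norm (U :: complex^'n^'n) = sqrt (CARD('n))"
  using norm_sq_trace[of U] by (simp add: unitary_mat_def trace_I real_sqrt_unique[symmetric])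

text \<open>
  The unitary group is compact, and the eigenvalues are recovered continuously from
  \<open>U\<^sup>* A U\<close>.
\<close>
lemma eigdecomp_convergent_subsequence:
  fixes A :: "nat \<Rightarrow> complex^'n^'n"
  assumes U: "\<And>m. eigdecomp (U m) (d m) (A m)" and lim: "A \<longlonglongrightarrow> H"
  obtains r V e where "strict_mono (r :: nat \<Rightarrow> nat)" "(\<lambda>m. U (r m)) \<longlonglongrightarrow> V"
    "\<And>i. (\<lambda>m. d (r m) i) \<longlonglongrightarrow> e i" "eigdecomp V e H"
proof -
  have uU: "unitary_mat (U m)" "A m = U m ** real_diag (d m) ** adj (U m)" for m using U[of m] by (auto simp: eigdecomp_def)
  have "bounded (range U)"
    using norm_unitary[OF uU(1)] by (intro boundedI[of _ "sqrt (CARD('n))"]) auto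
  then obtain V r where r: "strict_mono (r :: nat \<Rightarrow> nat)" and V: "(\<lambda>m. U (r m)) \<longlonglongrightarrow> V"
    using bounded_imp_convergent_subsequence[of U] unfolding o_def by blast
  have A: "(\<lambda>m. A (r m)) \<longlonglongrightarrow> H" using LIMSEQ_subseq_LIMSEQ[OF lim r] by (simp add: o_def)
  have "(\<lambda>m. adj (U (r m)) ** U (r m)) \<longlonglongrightarrow> adj V ** V" by (intro tendsto_mm tendsto_adj V)
  hence "adj V ** V = mat 1" using uU(1) by (simp add: unitary_mat_def LIMSEQ_const_iff)
  hence uV: "unitary_mat V" by (rule unitary_matI)
  have "adj (U m) ** A m ** U m = real_diag (d m)" for m
    unfolding uU(2)[of m] by (simp add: matrix_mul_assoc unitary_cancel[OF uU(1)[of m]])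
  moreover have "(\<lambda>m. adj (U (r m)) ** A (r m) ** U (r m)) \<longlonglongrightarrow> adj V ** H ** V"
    by (intro tendsto_mm tendsto_adj V A)
  ultimately have D: "(\<lambda>m. real_diag (d (r m))) \<longlonglongrightarrow> adj V ** H ** V" by simp
  define e where "e i = Re ((adj V ** H ** V) $ i $ i)" for i
  have ent: "(\<lambda>m. real_diag (d (r m)) $ i $ j) \<longlonglongrightarrow> (adj V ** H ** V) $ i $ j" for i j
    by (intro tendsto_vec_nth D)
  have e: "(\<lambda>m. d (r m) i) \<longlonglongrightarrow> e i" for i
    using tendsto_Re[OF ent[of i i]] by (simp add: real_diag_def e_def)
  have "adj V ** H ** V = real_diag e"
  proof -
    have "(adj V ** H ** V) $ i $ j = real_diag e $ i $ j" for i j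
    proof (rule LIMSEQ_unique[OF ent])
      show "(\<lambda>m. real_diag (d (r m)) $ i $ j) \<longlonglongrightarrow> real_diag e $ i $ j"
        using tendsto_of_real[OF e[of j], where 'a=complex] by (auto simp: real_diag_def)
    qed
    thus ?thesis by (simp add: vec_eq_iff)
  qed
  hence "V ** (adj V ** H ** V) ** adj V = V ** real_diag e ** adj V" by simp
  hence "eigdecomp V e H"
    by (simp add: eigdecomp_def uV matrix_mul_assoc unitary_cancel[OF uV])
  with r V e show thesis using that by blast
qed

lemma spec_in_limit:
  fixes A :: "nat \<Rightarrow> complex^'n^'n"
  assumes "\<And>m. spec_in \<alpha> \<beta> (A m)" "A \<longlonglongrightarrow> H"
  shows "spec_in \<alpha> \<beta> H"
proof -
  obtain U d where Ud: "\<And>m. eigdecomp (U m) (d m) (A m)" "\<And>m i. d m i \<in> {\<alpha>..\<beta>}"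
    using assms(1) unfolding spec_in_def by metis
  obtain r V e where "strict_mono (r :: nat \<Rightarrow> nat)" and e: "\<And>i. (\<lambda>m. d (r m) i) \<longlonglongrightarrow> e i" "eigdecomp V e H"
    using eigdecomp_convergent_subsequence[OF Ud(1) assms(2)] by metis
  have "e i \<in> {\<alpha>..\<beta>}" for i
    by (rule closed_sequentially[OF closed_atLeastAtMost _ e(1)[of i]]) (use Ud(2) in auto)
  thus ?thesis using e(2) by (auto simp: spec_in_def)
qed

lemma overlap_commute: "overlap W U j i = overlap U W i j"
proof -
  have "(adj W ** U) $ j $ i = cnj ((adj U ** W) $ i $ j)"
    unfolding adj_entry[symmetric] by (simp add: adj_mult)
  thus ?thesis by (simp add: overlap_def)
qed

section \<open>Klein's inequality\<close>

text \<open>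
  A monotone \<open>f\<close> has a convex antiderivative \<open>g\<close>, which lies above its
  tangents.
\<close>
lemma klein_inequality:
  fixes f g :: "real \<Rightarrow> real"
  assumes f: "mono f" and d: "\<And>x. x \<in> {\<alpha>..\<beta>} \<Longrightarrow> (g has_real_derivative f x) (at x within {\<alpha>..\<beta>})"
    and xy: "x \<in> {\<alpha>..\<beta>}" "y \<in> {\<alpha>..\<beta>}"
  shows "g y - g x - f x * (y - x) \<ge> 0"
proof -
  obtain c where c: "min y x \<le> c" "c \<le> max y x" "divdiff g f y x = f c"
    using divdiff_mean_value[OF d xy(2,1)] by metis
  have "g y - g x = f c * (y - x)" using divdiff_mult[of g f y x] c(3) by simp
  hence "g y - g x - f x * (y - x) = (f c - f x) * (y - x)" by (simp add: algebra_simps)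
  moreover have "(f c - f x) * (y - x) \<ge> 0"
  proof (cases "x \<le> y")
    case True thus ?thesis using monoD[OF f, of x c] c by (simp add: min_def max_def split: if_splits)
  next
    case False thus ?thesis using monoD[OF f, of c x] c by (auto simp: min_def max_def intro: mult_nonpos_nonpos)
  qed
  ultimately show ?thesis by simp
qed

text \<open>
  A convex function that meets its tangent at \<open>x\<close> again at \<open>y\<close> is
  affine in between.
\<close>
lemma klein_equality:
  fixes f g :: "real \<Rightarrow> real"
  assumes f: "mono f" and d: "\<And>x. x \<in> {\<alpha>..\<beta>} \<Longrightarrow> (g has_real_derivative f x) (at x within {\<alpha>..\<beta>})"
    and xy: "x \<in> {\<alpha>..\<beta>}" "y \<in> {\<alpha>..\<beta>}" and eq: "g y - g x - f x * (y - x) = 0"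
    and z: "x < z \<and> z < y \<or> y < z \<and> z < x"
  shows "f z = f x"
proof -
  have zI: "z \<in> {\<alpha>..\<beta>}" using xy z by auto
  have "g y - g z - f z * (y - z) \<ge> 0" "g z - g x - f x * (z - x) \<ge> 0"
    using klein_inequality[OF f d] zI xy by auto
  hence le: "(f z - f x) * (y - z) \<le> 0" using eq by (simp add: algebra_simps)
  from z show ?thesis
  proof
    assume z: "x < z \<and> z < y"
    hence "f z - f x \<le> 0" using le by (simp add: mult_le_0_iff)
    thus ?thesis using monoD[OF f, of x z] z by simp
  next
    assume z: "y < z \<and> z < x"
    hence "f z - f x \<ge> 0" using le by (simp add: mult_le_0_iff)
    thus ?thesis using monoD[OF f, of z x] z by simp
  qed
qed

section \<open>Existence and uniqueness of the flow\<close>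

context clamped_pair
begin

text \<open>
  The factor \<open>(y - cut y) y\<close> vanishes on the interval, is positive to its
  right, where \<open>f\<close> has its greatest value, and nonpositive to its left, where
  \<open>f\<close> has its least value.
\<close>
lemma clamped_monotone_product:
  assumes f: "mono f" "\<And>x. f (cut \<alpha> \<beta> x) = f x" and y: "y \<ge> 0"
  shows "(f y - f x) * ((y - cut \<alpha> \<beta> y) * y) \<ge> 0"
proof -
  consider "y \<in> {\<alpha>..\<beta>}" | "y > \<beta>" | "y < \<alpha>" by fastforce
  thus ?thesis
  proof cases
    case 2
    have "f x \<le> f \<beta>" "f y = f \<beta>"
      using f(2)[of x] f(2)[of y] monoD[OF f(1), of "cut \<alpha> \<beta> x" \<beta>] 2 \<alpha>\<beta> by (auto simp: cut_def)
    thus ?thesis using 2 \<alpha>\<beta> y by (simp add: cut_def)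
  next
    case 3
    have "f \<alpha> \<le> f x" "f y = f \<alpha>"
      using f(2)[of x] f(2)[of y] monoD[OF f(1), of \<alpha> "cut \<alpha> \<beta> x"] 3 \<alpha>\<beta> by (auto simp: cut_def)
    moreover have "(y - cut \<alpha> \<beta> y) * y \<le> 0" using 3 \<alpha>\<beta> y by (simp add: cut_def mult_nonpos_nonneg)
    ultimately show ?thesis by (intro mult_nonpos_nonpos) auto
  qed (simp add: cut_id)
qed

text \<open>
  Half the squared distance to \<open>[\<alpha>, \<beta>]\<close>, summed over the eigenvalues
  of \<open>X\<^sup>* X\<close>, starts at \<open>0\<close> and cannot increase; so it stays
  \<open>0\<close>.
\<close>
lemma gram_spectrum_invariant:
  fixes X :: "real \<Rightarrow> complex^'n^'n"
  assumes d: "\<And>t. t \<ge> 0 \<Longrightarrow> (X has_vector_derivative c t *\<^sub>R vfield (X t)) (at t within {0..})"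
    and c: "\<And>t. t \<ge> 0 \<Longrightarrow> c t \<ge> 0"
    and T: "spec_in \<alpha> \<beta> (adj (X 0) ** X 0)" and t: "t \<ge> 0"
  shows "spec_in \<alpha> \<beta> (adj (X t) ** X t)"
proof -
  define h where "h x = (x - cut \<alpha> \<beta> x)\<^sup>2 / 2" for x
  define h' where "h' x = x - cut \<alpha> \<beta> x" for x
  have rem: "\<bar>h y - h x - h' x * (y - x)\<bar> \<le> 3/2 * (y - x)\<^sup>2" for x y
  proof -
    have "h y - h x - h' x * (y - x) = (h' y - h' x)\<^sup>2 / 2 - h' x * (cut \<alpha> \<beta> y - cut \<alpha> \<beta> x)"
      by (simp add: h_def h'_def power2_eq_square field_simps)
    moreover have "(h' y - h' x)\<^sup>2 \<le> (y - x)\<^sup>2"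
      unfolding abs_le_square_iff[symmetric] by (auto simp: h'_def cut_def \<alpha>\<beta>)
    moreover have "\<bar>h' x * (cut \<alpha> \<beta> y - cut \<alpha> \<beta> x)\<bar> \<le> (y - x)\<^sup>2"
    proof -
      have "h' x = 0 \<or> cut \<alpha> \<beta> y = cut \<alpha> \<beta> x \<or> \<bar>h' x\<bar> \<le> \<bar>y - x\<bar>"
        unfolding h'_def cut_def using \<alpha>\<beta> by (auto simp: min_def max_def)
      moreover have "\<bar>h' x\<bar> * \<bar>cut \<alpha> \<beta> y - cut \<alpha> \<beta> x\<bar> \<le> \<bar>y - x\<bar> * \<bar>y - x\<bar>" if "\<bar>h' x\<bar> \<le> \<bar>y - x\<bar>"
        using that cut_lipschitz[of \<alpha> \<beta> y x] by (intro mult_mono) auto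
      ultimately show ?thesis by (auto simp: abs_mult power2_eq_square)
    qed
    moreover have "(h' y - h' x)\<^sup>2 \<ge> 0" "(y - x)\<^sup>2 \<ge> 0" by auto
    ultimately show ?thesis by linarith
  qed
  define l where "l x = h' x * x" for x
  define g where "g s = Re (trace (herm_fun h (adj (X s) ** X s)))" for s
  have "g t \<le> g 0"
  proof (rule nonincreasing_if_deriv_nonpos[OF order_refl t])
    fix x :: real assume x: "0 \<le> x"
    let ?Y = "X x"
    show "(g has_real_derivative 2 * c x * Re (trace (Phi ?Y ** (herm_fun l (?Y ** adj ?Y) - herm_fun l (adj ?Y ** ?Y))))) (at x within {0..})"
      unfolding g_def[abs_def] l_def[abs_def] by (rule derivative_trace_gram[OF rem d[OF x]])
    obtain U a where U: "eigdecomp U a (adj ?Y ** ?Y)" using hermitian_eigdecomp[of "adj ?Y ** ?Y"] by auto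
    obtain W b where W: "eigdecomp W b (?Y ** adj ?Y)" using hermitian_eigdecomp[of "?Y ** adj ?Y"] by auto
    have a: "a i \<ge> 0" and b: "b i \<ge> 0" for i
      using gram_eigenvalue_nonneg[OF U] gram_eigenvalue_nonneg[of W b "adj ?Y"] W by auto
    have *: "f y * l y - f z * l z - f z * (l y - l z) \<ge> 0" if "mono f" "\<And>x. f (cut \<alpha> \<beta> x) = f x" "y \<ge> 0" for f y z
      using clamped_monotone_product[OF that, of z] by (simp add: l_def h'_def algebra_simps)
    have "Re (trace (Phi ?Y ** (herm_fun l (?Y ** adj ?Y) - herm_fun l (adj ?Y ** ?Y)))) \<le> 0"
    proof -
      have "(\<Sum>i\<in>UNIV. \<Sum>j\<in>UNIV. overlap U W i j * (f1 (b j) * l (b j) - f1 (a i) * l (a i) - f1 (a i) * (l (b j) - l (a i)))) \<ge> 0"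
           "(\<Sum>i\<in>UNIV. \<Sum>j\<in>UNIV. overlap W U i j * (f2 (a j) * l (a j) - f2 (b i) * l (b i) - f2 (b i) * (l (a j) - l (b i)))) \<ge> 0"
        by (intro sum_nonneg mult_nonneg_nonneg overlap_nonneg * mono cutoff a b)+
      thus ?thesis
        using trace_Phi_difference[OF U W, of l "\<lambda>x. f1 x * l x" "\<lambda>x. f2 x * l x"] by linarith
    qed
    thus "2 * c x * Re (trace (Phi ?Y ** (herm_fun l (?Y ** adj ?Y) - herm_fun l (adj ?Y ** ?Y)))) \<le> 0"
      using c[OF x] by (simp add: mult_nonneg_nonpos)
  qed
  obtain U a where U: "eigdecomp U a (adj (X 0) ** X 0)" using hermitian_eigdecomp[of "adj (X 0) ** X 0"] by auto
  obtain W b where W: "eigdecomp W b (adj (X t) ** X t)" using hermitian_eigdecomp[of "adj (X t) ** X t"] by auto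
  have "h (a i) = 0" for i using spec_in_gram_eigenvalues(1)[OF T U, of i] by (simp add: h_def cut_id)
  hence "g 0 = 0" by (simp add: g_def trace_herm_fun[OF U])
  with \<open>g t \<le> g 0\<close> have "(\<Sum>i\<in>UNIV. h (b i)) \<le> 0" by (simp add: g_def trace_herm_fun[OF W])
  moreover have "h x \<ge> 0" for x by (simp add: h_def)
  ultimately have "h (b i) = 0" for i
    using sum_nonneg_eq_0_iff[of UNIV "\<lambda>i. h (b i)"] by (simp add: sum_nonneg antisym)
  hence "b i = cut \<alpha> \<beta> (b i)" for i by (simp add: h_def)
  hence "b i \<in> {\<alpha>..\<beta>}" for i using cut_in[OF \<alpha>\<beta>, of "b i"] by metis
  thus ?thesis using W by (auto simp: spec_in_def)
qed

text \<open>
  The vector field is only locally Lipschitz. It is multiplied by a cut-off of the norm, which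
  has no effect on the solution since the spectral bound confines the trajectory to the region
  where the cut-off equals \<open>1\<close>.
\<close>
lemma solution_exists:
  fixes T :: "complex^'n^'n"
  assumes T: "spec_in \<alpha> \<beta> (adj T ** T)"
  obtains X where "X 0 = T" "\<And>t. t \<ge> 0 \<Longrightarrow> (X has_vector_derivative vfield (X t)) (at t within {0..})"
    "\<And>t. t \<ge> 0 \<Longrightarrow> spec_in \<alpha> \<beta> (adj (X t) ** X t)"
proof -
  define r where "r = sqrt (CARD('n) * \<beta>) + 1"
  have r: "r \<ge> 1" using \<alpha> \<alpha>\<beta> by (simp add: r_def)
  \<comment> \<open>\<open>1\<close> on the ball of radius \<open>r\<close>, \<open>0\<close>
    outside the ball of radius \<open>2 r\<close>\<close>
  define \<rho> where "\<rho> Y = min 1 (max 0 (2 - norm Y / r))" for Y :: "complex^'n^'n"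
  define F where "F Y = \<rho> Y *\<^sub>R vfield Y" for Y :: "complex^'n^'n"
  define P where "P = 4 * sqrt (CARD('n)) * B"
  define K where "K = 8 * (2 * r) * (2 * r) * L + P"
  have P: "P \<ge> 0" using B_nonneg by (simp add: P_def)
  have K: "K \<ge> 0" using P L r by (simp add: K_def)
  have \<rho>01: "0 \<le> \<rho> Y" "\<rho> Y \<le> 1" for Y by (auto simp: \<rho>_def)
  have \<rho>0: "\<rho> Y = 0" if "norm Y \<ge> 2 * r" for Y using that r by (simp add: \<rho>_def field_simps)
  have \<rho>1: "\<rho> Y = 1" if "norm Y \<le> r" for Y using that r by (simp add: \<rho>_def field_simps)
  have \<rho>L: "\<bar>\<rho> Y - \<rho> Z\<bar> \<le> norm (Y - Z)" for Y Z
  proof -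
    have "\<bar>\<rho> Y - \<rho> Z\<bar> \<le> \<bar>norm Y / r - norm Z / r\<bar>" by (auto simp: \<rho>_def)
    also have "\<dots> = \<bar>norm Y - norm Z\<bar> / r" using r by (simp add: diff_divide_distrib[symmetric])
    also have "\<dots> \<le> \<bar>norm Y - norm Z\<bar> / 1" using r by (intro divide_left_mono) auto
    also have "\<dots> \<le> norm (Y - Z)" using norm_triangle_ineq3[of Y Z] by simp
    finally show ?thesis .
  qed
  have VP: "norm (vfield Y) \<le> P * norm Y" for Y :: "complex^'n^'n"
    using vfield_bound[of Y] by (simp add: P_def)
  have VP2: "norm (vfield Y) \<le> P * (2 * r)" if "norm Y \<le> 2 * r" for Y :: "complex^'n^'n"
    using VP[of Y] mult_left_mono[OF that P] by linarith
  \<comment> \<open>outside the larger ball \<open>F\<close> is \<open>0\<close>, so it suffices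
    that one of the two points lies in it\<close>
  have F_le: "norm (F Y - F Z) \<le> (P * (2 * r) + K) * norm (Y - Z)" if Y: "norm Y \<le> 2 * r" for Y Z
  proof -
    have 1: "\<bar>\<rho> Y - \<rho> Z\<bar> * norm (vfield Y) \<le> norm (Y - Z) * (P * (2 * r))"
      using \<rho>L VP2[OF Y] by (intro mult_mono) auto
    have 2: "\<rho> Z * norm (vfield Y - vfield Z) \<le> K * norm (Y - Z)"
    proof (cases "norm Z \<le> 2 * r")
      case True
      have "norm (vfield Y - vfield Z) \<le> K * norm (Y - Z)"
        using vfield_lipschitz[OF Y True] by (simp add: K_def P_def)
      thus ?thesis using mult_mono[OF \<rho>01(2)[of Z], of "norm (vfield Y - vfield Z)" "K * norm (Y - Z)"] \<rho>01 K by simp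
    next
      case False thus ?thesis using \<rho>0[of Z] K by simp
    qed
    have "F Y - F Z = (\<rho> Y - \<rho> Z) *\<^sub>R vfield Y + \<rho> Z *\<^sub>R (vfield Y - vfield Z)"
      by (simp add: F_def algebra_simps)
    also have "norm \<dots> \<le> \<bar>\<rho> Y - \<rho> Z\<bar> * norm (vfield Y) + \<rho> Z * norm (vfield Y - vfield Z)"
      using norm_triangle_ineq[of "(\<rho> Y - \<rho> Z) *\<^sub>R vfield Y" "\<rho> Z *\<^sub>R (vfield Y - vfield Z)"] \<rho>01[of Z] by simp
    also have "\<dots> \<le> (P * (2 * r) + K) * norm (Y - Z)" using 1 2 by (simp add: algebra_simps)
    finally show ?thesis .
  qed
  have Flip: "norm (F Y - F Z) \<le> (P * (2 * r) + K) * norm (Y - Z)" for Y Z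
  proof -
    consider "norm Y \<le> 2 * r" | "norm Z \<le> 2 * r" | "norm Y \<ge> 2 * r" "norm Z \<ge> 2 * r" by linarith
    thus ?thesis
    proof cases
      case 1 thus ?thesis by (rule F_le)
    next
      case 2 thus ?thesis using F_le[of Z Y] by (simp add: norm_minus_commute)
    next
      case 3 thus ?thesis using P K r by (simp add: F_def \<rho>0)
    qed
  qed
  have Fbd: "norm (F Y) \<le> P * (2 * r)" for Y
  proof (cases "norm Y \<le> 2 * r")
    case True
    thus ?thesis using mult_mono[OF \<rho>01(2)[of Y] VP2[OF True]] \<rho>01 by (simp add: F_def)
  next
    case False thus ?thesis using P r by (simp add: F_def \<rho>0)
  qed
  obtain X where X: "X 0 = T" and dX: "\<And>t. t \<ge> 0 \<Longrightarrow> (X has_vector_derivative F (X t)) (at t within {0..})"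
    using global_ode_solution[OF Flip Fbd, of T] by metis
  have spec: "spec_in \<alpha> \<beta> (adj (X t) ** X t)" if "t \<ge> 0" for t
    by (rule gram_spectrum_invariant[where c = "\<lambda>t. \<rho> (X t)"]) (use dX T X \<rho>01 that in \<open>auto simp: F_def\<close>)
  have "F (X t) = vfield (X t)" if "t \<ge> 0" for t
    using norm_le_if_spec_in[OF spec[OF that]] by (simp add: F_def \<rho>1 r_def)
  thus thesis using that[of X] X dX spec by simp
qed

lemma solution_unique:
  fixes X Y :: "real \<Rightarrow> complex^'n^'n"
  assumes X: "\<And>t. t \<ge> 0 \<Longrightarrow> (X has_vector_derivative vfield (X t)) (at t within {0..})"
    "\<And>t. t \<ge> 0 \<Longrightarrow> spec_in \<alpha> \<beta> (adj (X t) ** X t)"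
    and Y: "\<And>t. t \<ge> 0 \<Longrightarrow> (Y has_vector_derivative vfield (Y t)) (at t within {0..})"
    "\<And>t. t \<ge> 0 \<Longrightarrow> spec_in \<alpha> \<beta> (adj (Y t) ** Y t)"
    and eq: "X 0 = Y 0" and t: "t \<ge> 0"
  shows "X t = Y t"
proof -
  have "X t - Y t = 0"
  proof (rule gronwall_zero[where z = "\<lambda>t. X t - Y t", OF _ _ _ t])
    fix s :: real assume s: "0 \<le> s"
    show "((\<lambda>t. X t - Y t) has_vector_derivative vfield (X s) - vfield (Y s)) (at s within {0..})"
      by (intro has_vector_derivative_diff X Y s)
    show "norm (vfield (X s) - vfield (Y s)) \<le> (8 * sqrt (CARD('n) * \<beta>) * sqrt (CARD('n) * \<beta>) * L + 4 * sqrt (CARD('n)) * B) * norm (X s - Y s)"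
      by (intro vfield_lipschitz norm_le_if_spec_in[OF X(2)[OF s]] norm_le_if_spec_in[OF Y(2)[OF s]])
  qed (use eq in simp)
  thus ?thesis by simp
qed

end

section \<open>Normal matrices and polynomials along the flow\<close>

text \<open>
  The commutator is a derivation, so the equation is inherited by every polynomial in
  \<open>X\<close>.
\<close>
lemma has_vector_derivative_pmat:
  assumes "(X has_vector_derivative comm_mat A (X t)) (at t within S)"
  shows "((\<lambda>s. pmat p (X s)) has_vector_derivative comm_mat A (pmat p (X t))) (at t within S)"
proof (induction p)
  case (pCons a p)
  have "X t ** comm_mat A (pmat p (X t)) + comm_mat A (X t) ** pmat p (X t) = comm_mat A (pmat (pCons a p) (X t))"
    by (simp add: comm_mat_def mm_ring mat_mm_commute[of a A])
  thus ?case
    using has_vector_derivative_add[OF has_vector_derivative_const[of "mat a"]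
        bounded_bilinear.has_vector_derivative[OF bounded_bilinear_mm assms pCons.IH]] by simp
qed (simp add: comm_mat_def)

lemma pmat_commute:
  assumes "B ** A = A ** (B :: complex^'n^'n)" shows "B ** pmat p A = pmat p A ** B"
  by (rule pmat_intertwine[OF assms])

lemma normal_pmat:
  assumes "adj N ** N = N ** adj (N :: complex^'n^'n)"
  shows "adj (pmat p N) ** pmat p N = pmat p N ** adj (pmat p N)"
proof -
  have "adj N ** pmat p N = pmat p N ** adj N" by (rule pmat_commute[OF assms])
  from arg_cong[OF this, of adj] have "adj (pmat p N) ** N = N ** adj (pmat p N)" by (simp add: adj_mult)
  thus ?thesis by (rule pmat_commute)
qed

text \<open>A normal matrix and its adjoint have the same norm on every vector.\<close>
lemma norm_normal_mm:
  assumes "adj A ** A = A ** adj (A :: complex^'n^'n)"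
  shows "norm (adj A ** B) = norm (A ** (B :: complex^'n^'n))"
proof -
  have "adj B ** A ** adj A ** B = adj B ** adj A ** A ** B"
    using assms by (metis matrix_mul_assoc)
  hence "Re (trace (adj (adj A ** B) ** (adj A ** B))) = Re (trace (adj (A ** B) ** (A ** B)))"
    by (simp only: adj_mult adj_adj matrix_mul_assoc)
  hence "(norm (adj A ** B))\<^sup>2 = (norm (A ** B))\<^sup>2" by (simp only: norm_sq_trace)
  thus ?thesis by simp
qed

lemma normal_idempotent_hermitian:
  assumes n: "adj A ** A = A ** adj (A :: complex^'n^'n)" and i: "A ** A = A"
  shows "adj A = A"
proof -
  have "A ** (mat 1 - A) = 0" by (simp add: mm_diff_right i)
  hence "adj A ** (mat 1 - A) = 0" using norm_normal_mm[OF n, of "mat 1 - A"] by simp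
  hence a: "adj A = adj A ** A" by (simp add: mm_diff_right)
  have "A = adj A ** A" using arg_cong[OF a, of adj] by (simp add: adj_mult)
  with a show ?thesis by (rule trans[OF _ sym])
qed

section \<open>Limit points are normal\<close>

text \<open>
  A solution with smooth data. Positivity of \<open>f1' + f2'\<close> is asked away from
  \<open>0\<close> only: it fails at \<open>0\<close> for \<open>a = 0\<close> and
  \<open>\<phi>\<^sub>i(x) = x\<^sup>4\<close>.
\<close>
locale smooth_flow = clamped_pair +
  fixes f1' f2' :: "real \<Rightarrow> real" and X :: "real \<Rightarrow> complex^'n^'n"
  assumes df1: "\<And>x. x \<in> {\<alpha>..\<beta>} \<Longrightarrow> (f1 has_real_derivative f1' x) (at x within {\<alpha>..\<beta>})"
    and df2: "\<And>x. x \<in> {\<alpha>..\<beta>} \<Longrightarrow> (f2 has_real_derivative f2' x) (at x within {\<alpha>..\<beta>})"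
    and cf1: "continuous_on {\<alpha>..\<beta>} f1'" and cf2: "continuous_on {\<alpha>..\<beta>} f2'"
    and strict: "strict_mono_on {\<alpha>..\<beta>} (\<lambda>x. f1 x + f2 x)"
    and pos: "\<And>x. x \<in> {\<alpha>..\<beta>} - {0} \<Longrightarrow> f1' x + f2' x > 0"
    and dX: "\<And>t. t \<ge> 0 \<Longrightarrow> (X has_vector_derivative vfield (X t)) (at t within {0..})"
    and specX: "\<And>t. t \<ge> 0 \<Longrightarrow> spec_in \<alpha> \<beta> (adj (X t) ** X t)"
begin

abbreviation "\<kappa>1 \<equiv> divdiff f1 f1'"
abbreviation "\<kappa>2 \<equiv> divdiff f2 f2'"

lemma norm_X: "t \<ge> 0 \<Longrightarrow> norm (X t) \<le> sqrt (real CARD('n) * \<beta>)"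
  by (rule norm_le_if_spec_in[OF specX])

lemma speed_bound: "\<exists>M>0. \<forall>t\<ge>0. norm (vfield (X t)) \<le> M"
proof -
  have "norm (vfield (X t)) \<le> 4 * sqrt (CARD('n)) * B * sqrt (real CARD('n) * \<beta>) + 1" if "t \<ge> 0" for t
  proof -
    have "4 * sqrt (CARD('n)) * B * norm (X t) \<le> 4 * sqrt (CARD('n)) * B * sqrt (real CARD('n) * \<beta>)"
      by (intro mult_left_mono norm_X that mult_nonneg_nonneg B_nonneg) auto
    thus ?thesis using vfield_bound[of "X t"] by linarith
  qed
  moreover have "4 * sqrt (CARD('n)) * B * sqrt (real CARD('n) * \<beta>) + 1 > 0"
    using B_nonneg \<alpha> \<alpha>\<beta> by (intro add_nonneg_pos) auto
  ultimately show ?thesis by blast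
qed

text \<open>
  LaSalle's principle for the squared Frobenius norm. Its derivative \<open>G\<close> is
  \<open>-2\<close> times a sum of Bregman divergences weighted by overlaps. If it vanishes, any
  two eigenvectors of \<open>X\<^sup>* X\<close> and \<open>X X\<^sup>*\<close> that are not
  orthogonal have the same eigenvalue, so the two matrices coincide.
\<close>
lemma limit_normal:
  assumes s: "filterlim s at_top sequentially" and N: "(\<lambda>m. X (s m)) \<longlonglongrightarrow> N"
  shows "adj N ** N = N ** adj N"
proof -
  have cf: "continuous_on {\<alpha>..\<beta>} f1" "continuous_on {\<alpha>..\<beta>} f2"
    using df1 df2 by (meson DERIV_continuous continuous_on_eq_continuous_within)+
  obtain g1 where g1: "\<And>x. x \<in> {\<alpha>..\<beta>} \<Longrightarrow> (g1 has_real_derivative f1 x) (at x within {\<alpha>..\<beta>})"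
    using antiderivative_continuous[OF cf(1)] unfolding has_real_derivative_iff_has_vector_derivative by metis
  obtain g2 where g2: "\<And>x. x \<in> {\<alpha>..\<beta>} \<Longrightarrow> (g2 has_real_derivative f2 x) (at x within {\<alpha>..\<beta>})"
    using antiderivative_continuous[OF cf(2)] unfolding has_real_derivative_iff_has_vector_derivative by metis
  define G where "G Y = 2 * 1 * Re (trace (Phi Y ** (herm_fun (\<lambda>x. 1 * x) (Y ** adj Y) - herm_fun (\<lambda>x. 1 * x) (adj Y ** Y))))" for Y :: "complex^'n^'n"
  have Gx: "G Y = 2 * Re (trace (Phi Y ** (Y ** adj Y - adj Y ** Y)))" for Y
    by (simp add: G_def herm_fun_id)
  have form: "G Y \<le> 0 \<and> (G Y = 0 \<longrightarrow> adj Y ** Y = Y ** adj Y)"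
    if Y: "spec_in \<alpha> \<beta> (adj Y ** Y)" for Y :: "complex^'n^'n"
  proof -
    obtain U a where U: "eigdecomp U a (adj Y ** Y)" using hermitian_eigdecomp[of "adj Y ** Y"] by auto
    obtain W b where W: "eigdecomp W b (Y ** adj Y)" using hermitian_eigdecomp[of "Y ** adj Y"] by auto
    have a: "a i \<in> {\<alpha>..\<beta>}" and b: "b i \<in> {\<alpha>..\<beta>}" for i
      using spec_in_gram_eigenvalues[OF Y] U W by auto
    define F1 where "F1 = (\<lambda>i j. overlap U W i j * (g1 (b j) - g1 (a i) - f1 (a i) * (b j - a i)))"
    define F2 where "F2 = (\<lambda>i j. overlap W U i j * (g2 (a j) - g2 (b i) - f2 (b i) * (a j - b i)))"
    have G: "G Y = - 2 * (\<Sum>i\<in>UNIV. \<Sum>j\<in>UNIV. F1 i j) - 2 * (\<Sum>i\<in>UNIV. \<Sum>j\<in>UNIV. F2 i j)"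
      using trace_Phi_difference[OF U W, of "\<lambda>x. 1 * x" g1 g2] by (simp add: G_def F1_def F2_def)
    have F1: "F1 i j \<ge> 0" for i j unfolding F1_def
      by (intro mult_nonneg_nonneg overlap_nonneg klein_inequality[OF mono(1) g1] a b)
    have F2: "F2 i j \<ge> 0" for i j unfolding F2_def
      by (intro mult_nonneg_nonneg overlap_nonneg klein_inequality[OF mono(2) g2] a b)
    have S: "(\<Sum>i\<in>UNIV. \<Sum>j\<in>UNIV. F1 i j) \<ge> 0" "(\<Sum>i\<in>UNIV. \<Sum>j\<in>UNIV. F2 i j) \<ge> 0"
      by (intro sum_nonneg F1 F2)+
    have "adj Y ** Y = Y ** adj Y" if "G Y = 0"
    proof -
      have z: "F i j = 0" if "(\<Sum>i\<in>UNIV. \<Sum>j\<in>UNIV. F i j) = 0" "\<And>i j. F i j \<ge> 0" for F :: "'n \<Rightarrow> 'n \<Rightarrow> real" and i j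
      proof -
        have "(\<Sum>j\<in>UNIV. F i j) = 0"
          using that by (subst (asm) sum_nonneg_eq_0_iff) (auto intro: sum_nonneg)
        thus ?thesis using that(2) by (subst (asm) sum_nonneg_eq_0_iff) auto
      qed
      have F10: "F1 i j = 0" and F20: "F2 j i = 0" for i j
        using z[of F1] z[of F2] F1 F2 S G that by (smt (verit))+
      have ov0: "overlap U W i j * (a i - b j)\<^sup>2 = 0" for i j
      proof (rule ccontr)
        assume "\<not> ?thesis"
        hence ov: "overlap U W i j \<noteq> 0" and ne: "a i \<noteq> b j" by auto
        have e1: "g1 (b j) - g1 (a i) - f1 (a i) * (b j - a i) = 0"
          using F10[of i j] ov by (simp add: F1_def)
        have e2: "g2 (a i) - g2 (b j) - f2 (b j) * (a i - b j) = 0"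
          using F20[of j i] ov by (simp add: F2_def overlap_commute)
        define x where "x = min (a i) (b j)"
        define y where "y = max (a i) (b j)"
        have xy: "x < y" using ne by (auto simp: x_def y_def)
        \<comment> \<open>two interior points at which both \<open>f1\<close> and \<open>f2\<close>
          would agree\<close>
        define z1 where "z1 = (2 * x + y) / 3"
        define z2 where "z2 = (x + 2 * y) / 3"
        have zz: "x < z1" "z1 < z2" "z2 < y" using xy by (auto simp: z1_def z2_def)
        have btw: "a i < z \<and> z < b j \<or> b j < z \<and> z < a i" "b j < z \<and> z < a i \<or> a i < z \<and> z < b j"
          if "x < z" "z < y" for z using that by (auto simp: x_def y_def)
        have "f1 z = f1 (a i)" "f2 z = f2 (b j)" if "x < z" "z < y" for z
          using klein_equality[OF mono(1) g1 a b e1 btw(1)[OF that]]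
            klein_equality[OF mono(2) g2 b a e2 btw(2)[OF that]] by auto
        hence "f1 z1 + f2 z1 = f1 z2 + f2 z2" using zz by auto
        moreover have "z1 \<in> {\<alpha>..\<beta>}" "z2 \<in> {\<alpha>..\<beta>}" using zz a[of i] b[of j] by (auto simp: x_def y_def)
        ultimately show False using strict_mono_onD[OF strict, of z1 z2] zz by simp
      qed
      hence "(norm (herm_fun (\<lambda>x. x) (adj Y ** Y) - herm_fun (\<lambda>x. x) (Y ** adj Y)))\<^sup>2 = 0"
        unfolding norm_diff_herm_fun[OF U W] by (simp only: ov0 sum.neutral_const)
      thus ?thesis by (simp add: herm_fun_id)
    qed
    thus ?thesis using G S by simp
  qed
  obtain M where M: "M > 0" "\<And>t. t \<ge> 0 \<Longrightarrow> norm (vfield (X t)) \<le> M" using speed_bound by blast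
  have "G N = 0"
  proof (rule lasalle_zero_dissipation[where E = "\<lambda>t. Re (trace (herm_fun (\<lambda>x. x) (adj (X t) ** X t)))" and G = G, OF _ _ _ _ M(1) _ s N])
    fix t :: real assume t: "t \<ge> 0"
    show "((\<lambda>t. Re (trace (herm_fun (\<lambda>x. x) (adj (X t) ** X t)))) has_real_derivative G (X t)) (at t within {0..})"
      unfolding G_def by (rule derivative_trace_gram[where C = 0]) (use dX[OF t] in auto)
    show "G (X t) \<le> 0" using form[OF specX[OF t]] by simp
    show "0 \<le> Re (trace (herm_fun (\<lambda>x. x) (adj (X t) ** X t)))"
      unfolding herm_fun_id[OF herm_gram(1)] norm_sq_trace[symmetric] by simp
  next
    fix r t :: real assume "0 \<le> r" "r \<le> t"
    thus "norm (X t - X r) \<le> M * (t - r)" by (intro norm_diff_le_if_derivative_bounded[OF dX M(2)])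
  next
    show "isCont G N" unfolding Gx isCont_def
      by (intro tendsto_intros tendsto_Re tendsto_trace tendsto_mm tendsto_adj
          continuous_Phi[unfolded isCont_def])
  qed
  moreover have "spec_in \<alpha> \<beta> (adj N ** N)"
  proof -
    have "eventually (\<lambda>m. s m \<ge> 0) sequentially" using s by (simp add: filterlim_at_top)
    then obtain m0 where m0: "\<And>m. m \<ge> m0 \<Longrightarrow> s m \<ge> 0" by (auto simp: eventually_sequentially)
    show ?thesis
    proof (rule spec_in_limit)
      show "spec_in \<alpha> \<beta> (adj (X (s (m + m0))) ** X (s (m + m0)))" for m using specX m0 by simp
      have "(\<lambda>m. X (s (m + m0))) \<longlonglongrightarrow> N" using N by (rule LIMSEQ_ignore_initial_segment)
      thus "(\<lambda>m. adj (X (s (m + m0))) ** X (s (m + m0))) \<longlonglongrightarrow> adj N ** N"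
        by (intro tendsto_mm tendsto_adj)
    qed
  qed
  ultimately show ?thesis using form[of N] by simp
qed

text \<open>
  Off the diagonal this is strict monotonicity of \<open>f\<^sub>1 + f\<^sub>2\<close>, on the
  diagonal positivity of its derivative.
\<close>
lemma divdiff_sum_pos:
  assumes "x \<in> {\<alpha>..\<beta>}" "y \<in> {\<alpha>..\<beta>}" "\<not> (x = 0 \<and> y = 0)"
  shows "\<kappa>1 x y + \<kappa>2 x y > 0"
proof (cases "x = y")
  case True thus ?thesis using pos[of x] assms by (simp add: divdiff_def)
next
  case False
  hence "\<kappa>1 x y + \<kappa>2 x y = ((f1 x + f2 x) - (f1 y + f2 y)) / (x - y)"
    by (simp add: divdiff_def add_divide_distrib[symmetric])
  thus ?thesis
    using strict_mono_onD[OF strict, of x y] strict_mono_onD[OF strict, of y x] assms False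
    by (cases "x < y") (auto simp: divide_neg_neg)
qed

lemma divdiff_bounded: "\<exists>K\<ge>0. \<forall>x\<in>{\<alpha>..\<beta>}. \<forall>y\<in>{\<alpha>..\<beta>}. \<bar>\<kappa>1 x y\<bar> \<le> K \<and> \<bar>\<kappa>2 x y\<bar> \<le> K"
proof -
  have "bounded (f1' ` {\<alpha>..\<beta>})" "bounded (f2' ` {\<alpha>..\<beta>})"
    using cf1 cf2 by (auto intro!: compact_imp_bounded compact_continuous_image)
  then obtain K1 K2 where "\<forall>z\<in>f1' ` {\<alpha>..\<beta>}. \<bar>z\<bar> \<le> K1" "\<forall>z\<in>f2' ` {\<alpha>..\<beta>}. \<bar>z\<bar> \<le> K2"
    unfolding bounded_iff real_norm_def by blast
  hence K: "\<And>x. x \<in> {\<alpha>..\<beta>} \<Longrightarrow> \<bar>f1' x\<bar> \<le> K1" "\<And>x. x \<in> {\<alpha>..\<beta>} \<Longrightarrow> \<bar>f2' x\<bar> \<le> K2"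
    by blast+
  have "\<bar>\<kappa>1 x y\<bar> \<le> max K1 K2 \<and> \<bar>\<kappa>2 x y\<bar> \<le> max K1 K2" if xy: "x \<in> {\<alpha>..\<beta>}" "y \<in> {\<alpha>..\<beta>}" for x y
  proof -
    obtain c where "min x y \<le> c" "c \<le> max x y" "\<kappa>1 x y = f1' c" using divdiff_mean_value[of \<alpha> \<beta> f1 f1', OF df1 xy] by metis
    moreover obtain d where "min x y \<le> d" "d \<le> max x y" "\<kappa>2 x y = f2' d" using divdiff_mean_value[of \<alpha> \<beta> f2 f2', OF df2 xy] by metis
    ultimately show ?thesis using K(1)[of c] K(2)[of d] xy by (auto simp: min_def max_def split: if_splits)
  qed
  moreover have "max K1 K2 \<ge> 0" using K(1)[of \<alpha>] \<alpha>\<beta> by simp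
  ultimately show ?thesis by blast
qed

end

section \<open>Decay of the defect of spectral projections\<close>

text \<open>
  As \<open>R\<close> commutes with \<open>X\<close> and \<open>R\<^sup>*\<close> with
  \<open>X\<^sup>*\<close>, only the defect \<open>R - R\<^sup>*\<close> contributes to the
  commutator with \<open>X\<^sup>*\<close>; these commutators are therefore linear in the
  defect.
\<close>
lemma gram_commutators:
  fixes X R :: "complex^'n^'n"
  assumes "R ** X = X ** R"
  defines "D \<equiv> R - adj R" and "E \<equiv> adj X ** (R - adj R) - (R - adj R) ** adj X"
  shows "adj X ** X ** R - R ** (adj X ** X) = E ** X" "X ** adj X ** R - R ** (X ** adj X) = X ** E"
proof -
  have "adj X ** adj R = adj R ** adj X" using arg_cong[OF assms(1), of adj] by (simp add: adj_mult)
  hence E: "E = adj X ** R - R ** adj X" by (simp add: E_def mm_ring)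
  have 1: "A ** X ** R = A ** R ** X" "R ** X ** A = X ** R ** A" for A
    using assms(1) by (metis matrix_mul_assoc)+
  show "adj X ** X ** R - R ** (adj X ** X) = E ** X" "X ** adj X ** R - R ** (X ** adj X) = X ** E"
    by (simp_all add: E mm_ring 1)
qed

context smooth_flow
begin

text \<open>
  Each \<open>q(X)\<close> solves a linear equation, whose solution with initial value
  \<open>0\<close> is \<open>0\<close>.
\<close>
lemma polynomial_identity_preserved:
  assumes "pmat q (X 0) = 0" "t \<ge> 0"
  shows "pmat q (X t) = 0"
proof (rule gronwall_zero[where z = "\<lambda>t. pmat q (X t)", OF _ _ assms])
  fix s :: real assume s: "0 \<le> s"
  show "((\<lambda>t. pmat q (X t)) has_vector_derivative comm_mat (Phi (X s)) (pmat q (X s))) (at s within {0..})"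
    by (rule has_vector_derivative_pmat) (use dX[OF s] in \<open>simp add: vfield_def\<close>)
  have "2 * norm (Phi (X s)) * norm (pmat q (X s)) \<le> 2 * (2 * sqrt (CARD('n)) * B) * norm (pmat q (X s))"
    by (intro mult_right_mono mult_left_mono norm_Phi) auto
  thus "norm (comm_mat (Phi (X s)) (pmat q (X s))) \<le> (2 * (2 * sqrt (CARD('n)) * B)) * norm (pmat q (X s))"
    using norm_comm_mat[of "Phi (X s)" "pmat q (X s)"] by linarith
qed

text \<open>
  The form equals
  \<open>-2 \<Sum> (\<kappa>\<^sub>1 + \<kappa>\<^sub>2)(h\<^sub>i, h\<^sub>j) \<bar>c\<^sub>i\<^sub>j\<bar>\<^sup>2\<close>
  for \<open>C = [N, D]\<close>, so it can be nonnegative only if \<open>C = 0\<close>. The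
  weight at \<open>(0, 0)\<close> may be zero or negative, but there
  \<open>c\<^sub>i\<^sub>j\<close> vanishes: \<open>N\<close> and its adjoint have the same
  kernel.
\<close>
lemma limit_form_nonneg_imp_commute:
  fixes N D :: "complex^'n^'n"
  assumes N: "adj N ** N = N ** adj N" and spec: "spec_in \<alpha> \<beta> (adj N ** N)"
    and U: "eigdecomp U h (adj N ** N)" and W: "eigdecomp W k (adj N ** N)" and D: "adj D = - D"
  defines "E \<equiv> adj N ** D - D ** adj N"
  assumes nonneg: "0 \<le> - 4 * Re (trace (schur_mult \<kappa>1 U h (E ** N) ** D)) + 4 * Re (trace (schur_mult \<kappa>2 W k (N ** E) ** D))"
  shows "N ** D = D ** N"
proof -
  define C where "C = N ** D - D ** N"
  have u: "unitary_mat U" using U by (simp add: eigdecomp_def)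
  define c where "c = adj U ** C ** U"
  have hI: "h i \<in> {\<alpha>..\<beta>}" for i by (rule spec_in_gram_eigenvalues(1)[OF spec U])
  have 1: "2 * Re (trace (schur_mult \<kappa>1 U h (E ** N) ** D)) = Re (trace (schur_mult \<kappa>1 U h C ** adj C))"
    unfolding E_def C_def by (rule skew_commutator_form(1)[OF N U D divdiff_commute])
  have "2 * Re (trace (schur_mult \<kappa>2 W k (N ** E) ** D)) = - Re (trace (schur_mult \<kappa>2 W k C ** adj C))"
    unfolding E_def C_def by (rule skew_commutator_form(2)[OF N W D divdiff_commute])
  hence 2: "2 * Re (trace (schur_mult \<kappa>2 W k (N ** E) ** D)) = - Re (trace (schur_mult \<kappa>2 U h C ** adj C))"
    unfolding schur_mult_basis_independent[OF U W] .
  have "0 \<le> - (Re (trace (schur_mult \<kappa>1 U h C ** adj C)) + Re (trace (schur_mult \<kappa>2 U h C ** adj C)))"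
    using nonneg 1 2 by linarith
  also have "Re (trace (schur_mult \<kappa>1 U h C ** adj C)) + Re (trace (schur_mult \<kappa>2 U h C ** adj C))
      = (\<Sum>i\<in>UNIV. \<Sum>j\<in>UNIV. (\<kappa>1 (h i) (h j) + \<kappa>2 (h i) (h j)) * (cmod (c $ i $ j))\<^sup>2)"
    unfolding trace_schur_mult_adj[OF u] c_def[symmetric] by (simp only: Re_complex_of_real sum.distrib distrib_right)
  finally have le: "(\<Sum>i\<in>UNIV. \<Sum>j\<in>UNIV. (\<kappa>1 (h i) (h j) + \<kappa>2 (h i) (h j)) * (cmod (c $ i $ j))\<^sup>2) \<le> 0" by simp
  have kernel: "c $ i $ j = 0" if "h i = 0" "h j = 0" for i j
  proof -
    define n where "n = adj U ** N ** U"
    define d where "d = adj U ** D ** U"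
    have "c = n ** d - d ** n"
      by (simp add: c_def n_def d_def C_def mm_ring unitary_cancel[OF u])
    moreover have "n $ l $ j = 0" for l
      using gram_kernel[OF U that(2)] by (simp add: n_def matrix_mul_assoc[symmetric] mm_entry[of "adj U" "N ** U"])
    moreover have "n $ i $ l = 0" for l
    proof -
      have "(adj N ** U) $ m $ i = 0" for m
        by (rule gram_kernel[where h = h]) (use U that(1) N in \<open>simp_all\<close>)
      hence "adj n $ l $ i = 0"
        by (simp add: n_def adj_mult matrix_mul_assoc[symmetric] mm_entry[of "adj U" "adj N ** U"] del: adj_entry)
      thus ?thesis by simp
    qed
    ultimately show ?thesis by (simp add: mm_entry)
  qed
  have trm: "(\<kappa>1 (h i) (h j) + \<kappa>2 (h i) (h j)) * (cmod (c $ i $ j))\<^sup>2 \<ge> 0" for i j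
    using divdiff_sum_pos[OF hI hI, of i j] kernel[of i j] by (cases "h i = 0 \<and> h j = 0") auto
  have "c $ i $ j = 0" for i j
  proof -
    have "(\<Sum>i\<in>UNIV. \<Sum>j\<in>UNIV. (\<kappa>1 (h i) (h j) + \<kappa>2 (h i) (h j)) * (cmod (c $ i $ j))\<^sup>2) = 0"
      using le by (intro antisym sum_nonneg trm) auto
    hence "(\<Sum>j\<in>UNIV. (\<kappa>1 (h i) (h j) + \<kappa>2 (h i) (h j)) * (cmod (c $ i $ j))\<^sup>2) = 0"
      by (subst (asm) sum_nonneg_eq_0_iff) (auto intro!: sum_nonneg trm)
    hence "(\<kappa>1 (h i) (h j) + \<kappa>2 (h i) (h j)) * (cmod (c $ i $ j))\<^sup>2 = 0"
      by (subst (asm) sum_nonneg_eq_0_iff) (use trm in auto)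
    thus ?thesis using divdiff_sum_pos[OF hI hI, of i j] kernel[of i j] by (cases "h i = 0 \<and> h j = 0") auto
  qed
  hence "c = 0" by (simp add: vec_eq_iff)
  hence "U ** c ** adj U = 0" by simp
  hence "C = 0" by (simp add: c_def matrix_mul_assoc unitary_cancel[OF u])
  thus ?thesis by (simp add: C_def)
qed

context
  fixes p :: "complex poly"
  assumes idem: "\<And>t. t \<ge> 0 \<Longrightarrow> pmat p (X t) ** pmat p (X t) = pmat p (X t)"
begin

definition proj :: "real \<Rightarrow> complex^'n^'n" where
  "proj t = pmat p (X t)"

definition defect :: "real \<Rightarrow> complex^'n^'n" where
  "defect t = proj t - adj (proj t)"

definition defect_rate :: "real \<Rightarrow> real" where
  "defect_rate t = - 4 * Re (trace (comm_mat (Phi (X t)) (proj t) ** defect t))"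

lemma adj_defect: "adj (defect t) = - defect t"
  by (simp add: defect_def adj_diff)

lemma proj_commute: "proj t ** X t = X t ** proj t"
  using pmat_commute[of "X t" "X t" p] by (simp add: proj_def)

lemma proj_has_derivative: "t \<ge> 0 \<Longrightarrow> (proj has_vector_derivative comm_mat (Phi (X t)) (proj t)) (at t within {0..})"
  unfolding proj_def[abs_def] by (rule has_vector_derivative_pmat) (use dX[of t] in \<open>simp add: vfield_def\<close>)

lemma defect_norm_has_derivative:
  assumes t: "t \<ge> 0"
  shows "((\<lambda>t. (norm (defect t))\<^sup>2) has_real_derivative defect_rate t) (at t within {0..})"
proof -
  define Z where "Z = comm_mat (Phi (X t)) (proj t)"
  have dR: "(proj has_vector_derivative Z) (at t within {0..})"
    unfolding Z_def by (rule proj_has_derivative[OF t])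
  have dD: "(defect has_vector_derivative (Z - adj Z)) (at t within {0..})"
    unfolding defect_def[abs_def]
    by (intro has_vector_derivative_diff dR bounded_linear.has_vector_derivative[OF bounded_linear_adj])
  have "inner (defect t) (Z - adj Z) = - 2 * Re (trace (Z ** defect t))"
  proof -
    have "trace (defect t ** adj Z) = cnj (trace (Z ** adj (defect t)))"
      unfolding trace_adj[symmetric] by (simp add: adj_mult)
    moreover have "trace (defect t ** Z) = trace (Z ** defect t)" by (rule trace_mul_sym)
    ultimately show ?thesis
      unfolding inner_mat adj_defect by (simp add: mm_ring trace_sub trace_uminus adj_defect)
  qed
  moreover have "((\<lambda>t. (norm (defect t))\<^sup>2) has_real_derivative (inner (defect t) (Z - adj Z) + inner (Z - adj Z) (defect t))) (at t within {0..})"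
    unfolding power2_norm_eq_inner by (rule vector_derivative_inner[OF dD dD])
  ultimately show ?thesis by (simp add: defect_rate_def Z_def inner_commute)
qed

text \<open>
  Linear in the defect, with the singular values and singular vectors of \<open>X\<close> as
  coefficients.
\<close>
lemma comm_Phi_proj:
  assumes U: "eigdecomp U h (adj (X t) ** X t)" and W: "eigdecomp W k (X t ** adj (X t))"
  defines "E \<equiv> adj (X t) ** defect t - defect t ** adj (X t)"
  shows "comm_mat (Phi (X t)) (proj t) = schur_mult \<kappa>1 U h (E ** X t) - schur_mult \<kappa>2 W k (X t ** E)"
proof -
  note c = gram_commutators[OF proj_commute[of t], folded defect_def, folded E_def]
  have "comm_mat (Phi (X t)) (proj t) =
      (herm_fun f1 (adj (X t) ** X t) ** proj t - proj t ** herm_fun f1 (adj (X t) ** X t))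
    - (herm_fun f2 (X t ** adj (X t)) ** proj t - proj t ** herm_fun f2 (X t ** adj (X t)))"
    by (simp add: comm_mat_def Phi_def mm_ring)
  also have "\<dots> = schur_mult \<kappa>1 U h (E ** X t) - schur_mult \<kappa>2 W k (X t ** E)"
    by (simp only: herm_fun_commutator[OF U divdiff_mult[of f1 f1']] herm_fun_commutator[OF W divdiff_mult[of f2 f2']] c)
  finally show ?thesis .
qed

lemma proj_speed: "\<exists>C\<ge>0. \<forall>t\<ge>0. norm (comm_mat (Phi (X t)) (proj t)) \<le> C * norm (defect t)"
proof -
  obtain K where K: "K \<ge> 0" "\<And>x y. x \<in> {\<alpha>..\<beta>} \<Longrightarrow> y \<in> {\<alpha>..\<beta>} \<Longrightarrow> \<bar>\<kappa>1 x y\<bar> \<le> K \<and> \<bar>\<kappa>2 x y\<bar> \<le> K"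
    using divdiff_bounded by blast
  define r where "r = sqrt (real CARD('n) * \<beta>)"
  have r: "r \<ge> 0" using \<alpha> \<alpha>\<beta> by (simp add: r_def)
  have "norm (comm_mat (Phi (X t)) (proj t)) \<le> (4 * K * r * r) * norm (defect t)" if t: "t \<ge> 0" for t
  proof -
    obtain U h where U: "eigdecomp U h (adj (X t) ** X t)" using hermitian_eigdecomp[of "adj (X t) ** X t"] by auto
    obtain W k where W: "eigdecomp W k (X t ** adj (X t))" using hermitian_eigdecomp[of "X t ** adj (X t)"] by auto
    have u: "unitary_mat U" "unitary_mat W" using U W by (auto simp: eigdecomp_def)
    have hk: "h i \<in> {\<alpha>..\<beta>}" "k i \<in> {\<alpha>..\<beta>}" for i
      using spec_in_gram_eigenvalues[OF specX[OF t]] U W by auto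
    define E where "E = adj (X t) ** defect t - defect t ** adj (X t)"
    have xr: "norm (X t) \<le> r" using norm_X[OF t] by (simp add: r_def)
    have "norm E \<le> 2 * norm (adj (X t)) * norm (defect t)"
      using norm_comm_mat[of "adj (X t)" "defect t"] by (simp add: E_def comm_mat_def)
    also have "\<dots> \<le> 2 * r * norm (defect t)" using xr by (intro mult_right_mono) auto
    finally have E: "norm E \<le> 2 * r * norm (defect t)" .
    have EX: "norm (E ** X t) \<le> 2 * r * norm (defect t) * r" "norm (X t ** E) \<le> r * (2 * r * norm (defect t))"
      by (rule order_trans[OF norm_mm_le], rule mult_mono, use E xr r in auto)+
    have "norm (comm_mat (Phi (X t)) (proj t)) \<le> norm (schur_mult \<kappa>1 U h (E ** X t)) + norm (schur_mult \<kappa>2 W k (X t ** E))"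
      unfolding comm_Phi_proj[OF U W] E_def[symmetric] by (rule norm_triangle_ineq4)
    also have "\<dots> \<le> K * norm (E ** X t) + K * norm (X t ** E)"
      using K(2)[OF hk(1) hk(1)] K(2)[OF hk(2) hk(2)] by (intro add_mono norm_schur_mult_le u) auto
    also have "\<dots> \<le> K * (2 * r * norm (defect t) * r) + K * (r * (2 * r * norm (defect t)))"
      by (intro add_mono mult_left_mono EX K(1))
    finally show ?thesis by (simp add: algebra_simps)
  qed
  moreover have "4 * K * r * r \<ge> 0" using K r by simp
  ultimately show ?thesis by blast
qed

text \<open>
  The defect is off-diagonal with respect to the projection up to a term of second order.
\<close>
lemma defect_identity:
  assumes "t \<ge> 0"
  shows "proj t ** defect t + defect t ** proj t - defect t ** defect t = defect t"
proof -
  have i: "proj t ** proj t = proj t" using idem[OF assms] by (simp add: proj_def)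
  from arg_cong[OF this, of adj] have j: "adj (proj t) ** adj (proj t) = adj (proj t)" by (simp add: adj_mult)
  show ?thesis by (simp add: defect_def mm_ring i j)
qed

text \<open>
  Otherwise there are times tending to infinity at which the normalised rate is at least a
  negative number tending to \<open>0\<close>. Along a subsequence \<open>X\<close>, the
  normalised defect and the eigenbases of both Gram matrices converge, and the limit form is
  nonnegative on a skew matrix \<open>D\<close> of norm \<open>1\<close>. So \<open>D\<close>
  commutes with the normal limit \<open>N\<close>, hence with the orthogonal projection
  \<open>P = p(N)\<close>; but \<open>P D + D P = D\<close>, which forces
  \<open>D = 0\<close>.
\<close>
lemma defect_exponential_rate: "\<exists>c>0. \<exists>s\<ge>0. \<forall>t\<ge>s. defect_rate t \<le> - c * (norm (defect t))\<^sup>2"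
proof (rule ccontr)
  assume not: "\<not> ?thesis"
  have "\<forall>m::nat. \<exists>t\<ge>real m. defect_rate t > - (1 / real (Suc m)) * (norm (defect t))\<^sup>2"
  proof
    fix m :: nat
    have "1 / real (Suc m) > 0" by simp
    with not have "\<not> (\<exists>s\<ge>0. \<forall>t\<ge>s. defect_rate t \<le> - (1 / real (Suc m)) * (norm (defect t))\<^sup>2)" by blast
    hence "\<not> (\<forall>t\<ge>real m. defect_rate t \<le> - (1 / real (Suc m)) * (norm (defect t))\<^sup>2)" by simp
    thus "\<exists>t\<ge>real m. defect_rate t > - (1 / real (Suc m)) * (norm (defect t))\<^sup>2" by (auto simp: not_le)
  qed
  then obtain \<tau> where \<tau>: "\<And>m. \<tau> m \<ge> real m" "\<And>m. defect_rate (\<tau> m) > - (1 / real (Suc m)) * (norm (defect (\<tau> m)))\<^sup>2"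
    by metis
  have \<tau>0: "\<tau> m \<ge> 0" for m using \<tau>(1)[of m] by linarith
  have ne: "defect (\<tau> m) \<noteq> 0" for m using \<tau>(2)[of m] by (auto simp: defect_rate_def trace_def)
  \<comment> \<open>the normalised defect: the rate is quadratic in the defect, so only its
    direction matters\<close>
  define Dh where "Dh m = defect (\<tau> m) /\<^sub>R norm (defect (\<tau> m))" for m
  have Dh: "norm (Dh m) = 1" "adj (Dh m) = - Dh m" "defect (\<tau> m) = norm (defect (\<tau> m)) *\<^sub>R Dh m" for m
    using ne[of m] by (simp_all add: Dh_def adj_scaleR adj_defect)
  have "bounded (range (\<lambda>m. (X (\<tau> m), Dh m)))"
  proof (rule boundedI)
    fix z assume "z \<in> range (\<lambda>m. (X (\<tau> m), Dh m))"
    then obtain m where "z = (X (\<tau> m), Dh m)" by blast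
    thus "norm z \<le> sqrt (real CARD('n) * \<beta>) + 1"
      using norm_Pair_le[of "X (\<tau> m)" "Dh m"] norm_X[OF \<tau>0[of m]] Dh(1)[of m] by simp
  qed
  then obtain l r0 where r0: "strict_mono (r0 :: nat \<Rightarrow> nat)" and l: "(\<lambda>m. (X (\<tau> (r0 m)), Dh (r0 m))) \<longlonglongrightarrow> l"
    using bounded_imp_convergent_subsequence[of "\<lambda>m. (X (\<tau> m), Dh m)"] unfolding o_def by blast
  define N where "N = fst l"
  define D where "D = snd l"
  have XN0: "(\<lambda>m. X (\<tau> (r0 m))) \<longlonglongrightarrow> N" and DD0: "(\<lambda>m. Dh (r0 m)) \<longlonglongrightarrow> D"
    using tendsto_fst[OF l] tendsto_snd[OF l] by (simp_all add: N_def D_def)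
  have "\<exists>U h. eigdecomp U h (adj (X t) ** X t)" "\<exists>W k. eigdecomp W k (X t ** adj (X t))" for t
    using hermitian_eigdecomp[OF herm_gram(1)[of "X t"]] hermitian_eigdecomp[OF herm_gram(2)[of "X t"]] by metis+
  then obtain U h W k where U: "\<And>t. eigdecomp (U t) (h t) (adj (X t) ** X t)"
      and W: "\<And>t. eigdecomp (W t) (k t) (X t ** adj (X t))" by metis
  \<comment> \<open>the eigenbases of the two Gram matrices need not be related, hence two further
    subsequences\<close>
  obtain r1 V1 e1 where r1: "strict_mono (r1 :: nat \<Rightarrow> nat)" and V1: "(\<lambda>m. U (\<tau> (r0 (r1 m)))) \<longlonglongrightarrow> V1"
    and e1: "\<And>i. (\<lambda>m. h (\<tau> (r0 (r1 m))) i) \<longlonglongrightarrow> e1 i" and E1: "eigdecomp V1 e1 (adj N ** N)"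
    using eigdecomp_convergent_subsequence[of "\<lambda>m. U (\<tau> (r0 m))" "\<lambda>m. h (\<tau> (r0 m))" _ "adj N ** N", OF U
        tendsto_mm[OF tendsto_adj[OF XN0] XN0]] by metis
  have XN1: "(\<lambda>m. X (\<tau> (r0 (r1 m)))) \<longlonglongrightarrow> N" using LIMSEQ_subseq_LIMSEQ[OF XN0 r1] by (simp add: o_def)
  obtain r2 V2 e2 where r2: "strict_mono (r2 :: nat \<Rightarrow> nat)" and V2: "(\<lambda>m. W (\<tau> (r0 (r1 (r2 m))))) \<longlonglongrightarrow> V2"
    and e2: "\<And>i. (\<lambda>m. k (\<tau> (r0 (r1 (r2 m)))) i) \<longlonglongrightarrow> e2 i" and E2: "eigdecomp V2 e2 (N ** adj N)"
    using eigdecomp_convergent_subsequence[of "\<lambda>m. W (\<tau> (r0 (r1 m)))" "\<lambda>m. k (\<tau> (r0 (r1 m)))" _ "N ** adj N", OF W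
        tendsto_mm[OF XN1 tendsto_adj[OF XN1]]] by metis
  define r where "r m = r0 (r1 (r2 m))" for m
  have r: "strict_mono r" using r0 r1 r2 by (simp add: r_def strict_mono_def)
  define s where "s m = \<tau> (r m)" for m
  have s0: "s m \<ge> 0" for m by (simp add: s_def \<tau>0)
  have XN: "(\<lambda>m. X (s m)) \<longlonglongrightarrow> N" and V1': "(\<lambda>m. U (s m)) \<longlonglongrightarrow> V1" and e1': "\<And>i. (\<lambda>m. h (s m) i) \<longlonglongrightarrow> e1 i"
    using LIMSEQ_subseq_LIMSEQ[OF XN1 r2] LIMSEQ_subseq_LIMSEQ[OF V1 r2] LIMSEQ_subseq_LIMSEQ[OF e1 r2]
    by (simp_all add: o_def s_def r_def)
  have DD: "(\<lambda>m. Dh (r m)) \<longlonglongrightarrow> D"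
    using LIMSEQ_subseq_LIMSEQ[OF LIMSEQ_subseq_LIMSEQ[OF DD0 r1] r2] by (simp add: o_def r_def)
  have V2': "(\<lambda>m. W (s m)) \<longlonglongrightarrow> V2" and e2': "\<And>i. (\<lambda>m. k (s m) i) \<longlonglongrightarrow> e2 i"
    using V2 e2 by (simp_all add: s_def r_def)
  have s: "filterlim s at_top sequentially"
  proof (rule filterlim_at_top_mono[OF filterlim_real_sequentially], rule always_eventually, rule allI)
    show "real m \<le> s m" for m using \<tau>(1)[of "r m"] seq_suble[OF r, of m] by (simp add: s_def)
  qed
  have N: "adj N ** N = N ** adj N" by (rule limit_normal[OF s XN])
  have spec: "spec_in \<alpha> \<beta> (adj N ** N)"
    by (rule spec_in_limit[where A = "\<lambda>m. adj (X (s m)) ** X (s m)", OF specX[OF s0]]) (intro tendsto_mm tendsto_adj XN)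
  have nD: "norm D = 1" using LIMSEQ_unique[OF tendsto_norm[OF DD]] by (simp add: Dh)
  have aD: "adj D = - D"
    using LIMSEQ_unique[OF tendsto_adj[OF DD]] tendsto_minus[OF DD] by (simp add: Dh)
  define Eh where "Eh m = adj (X (s m)) ** Dh (r m) - Dh (r m) ** adj (X (s m))" for m
  define q where "q m = - 4 * Re (trace (schur_mult \<kappa>1 (U (s m)) (h (s m)) (Eh m ** X (s m)) ** Dh (r m)))
    + 4 * Re (trace (schur_mult \<kappa>2 (W (s m)) (k (s m)) (X (s m) ** Eh m) ** Dh (r m)))" for m
  define E where "E = adj N ** D - D ** adj N"
  have EE: "Eh \<longlonglongrightarrow> E" unfolding Eh_def[abs_def] E_def by (intro tendsto_diff tendsto_mm tendsto_adj XN DD)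
  have hk: "h (s m) i \<in> {\<alpha>..\<beta>}" "k (s m) i \<in> {\<alpha>..\<beta>}" for m i
    using spec_in_gram_eigenvalues[OF specX[OF s0]] U W by blast+
  have "q \<longlonglongrightarrow> - 4 * Re (trace (schur_mult \<kappa>1 V1 e1 (E ** N) ** D)) + 4 * Re (trace (schur_mult \<kappa>2 V2 e2 (N ** E) ** D))"
    unfolding q_def[abs_def]
    by (intro tendsto_add tendsto_mult_left tendsto_Re tendsto_trace tendsto_mm tendsto_schur_mult
        tendsto_divdiff[OF df1 cf1] tendsto_divdiff[OF df2 cf2] hk V1' V2' e1' e2' EE XN DD)
  moreover have "q m > - (1 / real (Suc m))" for m
  proof -
    define \<delta> where "\<delta> = norm (defect (s m))"
    have \<delta>: "\<delta> > 0" using ne[of "r m"] by (simp add: \<delta>_def s_def)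
    have d: "defect (s m) = \<delta> *\<^sub>R Dh (r m)" using Dh(3)[of "r m"] by (simp add: \<delta>_def s_def)
    have E: "adj (X (s m)) ** defect (s m) - defect (s m) ** adj (X (s m)) = \<delta> *\<^sub>R Eh m"
      by (simp add: d Eh_def mm_scaleR_left mm_scaleR_right scaleR_diff_right)
    define M1 where "M1 = schur_mult \<kappa>1 (U (s m)) (h (s m)) (Eh m ** X (s m))"
    define M2 where "M2 = schur_mult \<kappa>2 (W (s m)) (k (s m)) (X (s m) ** Eh m)"
    have "comm_mat (Phi (X (s m))) (proj (s m)) = \<delta> *\<^sub>R (M1 - M2)"
      unfolding comm_Phi_proj[OF U W] E M1_def M2_def
      by (simp only: mm_scaleR_left mm_scaleR_right schur_mult_scaleR scaleR_diff_right)
    hence "defect_rate (s m) = - 4 * (\<delta> * (\<delta> * Re (trace ((M1 - M2) ** Dh (r m)))))"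
      unfolding defect_rate_def d by (simp add: mm_scaleR_left mm_scaleR_right trace_scaleR)
    also have "\<dots> = \<delta>\<^sup>2 * q m"
      unfolding q_def M1_def[symmetric] M2_def[symmetric]
      by (simp add: mm_diff_left trace_sub power2_eq_square right_diff_distrib)
    finally have "defect_rate (s m) = \<delta>\<^sup>2 * q m" .
    moreover have "defect_rate (s m) > - (1 / real (Suc (r m))) * \<delta>\<^sup>2"
      using \<tau>(2)[of "r m"] by (simp add: s_def \<delta>_def)
    ultimately have "\<delta>\<^sup>2 * (- (1 / real (Suc (r m)))) < \<delta>\<^sup>2 * q m" by (simp add: mult.commute)
    hence "q m > - (1 / real (Suc (r m)))" using \<delta> by (simp only: mult_less_cancel_left_pos zero_less_power)
    moreover have "1 / real (Suc (r m)) \<le> 1 / real (Suc m)"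
      using seq_suble[OF r, of m] by (intro divide_left_mono) auto
    ultimately show ?thesis by linarith
  qed
  moreover have "(\<lambda>m. - (1 / real (Suc m))) \<longlonglongrightarrow> 0"
    using tendsto_minus[OF LIMSEQ_Suc[OF lim_1_over_n]] by simp
  ultimately have "0 \<le> - 4 * Re (trace (schur_mult \<kappa>1 V1 e1 (E ** N) ** D)) + 4 * Re (trace (schur_mult \<kappa>2 V2 e2 (N ** E) ** D))"
    by (intro LIMSEQ_le[of _ 0 q]) (auto intro: less_imp_le)
  hence ND: "N ** D = D ** N"
    unfolding E_def using E2 by (intro limit_form_nonneg_imp_commute[OF N spec E1 _ aD]) (simp_all add: N)
  define P where "P = pmat p N"
  have RP: "(\<lambda>m. proj (s m)) \<longlonglongrightarrow> P" unfolding proj_def P_def by (rule tendsto_pmat[OF XN])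
  have PP: "P ** P = P"
  proof (rule LIMSEQ_unique[OF _ RP])
    show "(\<lambda>m. proj (s m)) \<longlonglongrightarrow> P ** P"
      using tendsto_mm[OF RP RP] idem[OF s0] by (simp add: proj_def)
  qed
  have aP: "adj P = P"
    using PP normal_pmat[OF N, of p] by (intro normal_idempotent_hermitian) (auto simp: P_def)
  have defP: "(\<lambda>m. defect (s m)) \<longlonglongrightarrow> 0"
    using tendsto_diff[OF RP tendsto_adj[OF RP]] by (simp add: aP defect_def)
  have idh: "proj (s m) ** Dh (r m) + Dh (r m) ** proj (s m) - Dh (r m) ** defect (s m) = Dh (r m)" for m
  proof -
    define \<delta> where "\<delta> = norm (defect (s m))"
    have \<delta>: "\<delta> \<noteq> 0" using ne[of "r m"] by (simp add: \<delta>_def s_def)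
    have d: "defect (s m) = \<delta> *\<^sub>R Dh (r m)" using Dh(3)[of "r m"] by (simp add: \<delta>_def s_def)
    have "\<delta> *\<^sub>R (proj (s m) ** Dh (r m) + Dh (r m) ** proj (s m) - Dh (r m) ** defect (s m)) = \<delta> *\<^sub>R Dh (r m)"
      using defect_identity[OF s0[of m]] unfolding d by (simp add: mm_scaleR_left mm_scaleR_right scaleR_diff_right scaleR_add_right)
    thus ?thesis using \<delta> by simp
  qed
  have "P ** D + D ** P - D ** 0 = D"
    using LIMSEQ_unique[OF tendsto_diff[OF tendsto_add[OF tendsto_mm[OF RP DD] tendsto_mm[OF DD RP]] tendsto_mm[OF DD defP]]] DD
    by (simp add: idh)
  moreover have "D ** P = P ** D" unfolding P_def by (rule pmat_commute) (simp add: ND)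
  ultimately have PD: "P ** D + P ** D = D" by simp
  have "P ** (P ** D + P ** D) = P ** D" by (simp only: PD)
  hence "P ** D + P ** D = P ** D" by (simp only: matrix_add_ldistrib matrix_mul_assoc PP)
  hence "P ** D = 0" by (metis add_cancel_right_right)
  with PD nD show False by simp
qed

lemma proj_convergent: "\<exists>L. ((\<lambda>t. pmat p (X t)) \<longlongrightarrow> L) at_top"
  unfolding proj_def[symmetric]
proof -
  obtain c s where c: "c > 0" and s: "s \<ge> 0" and rate: "\<And>t. t \<ge> s \<Longrightarrow> defect_rate t \<le> - c * (norm (defect t))\<^sup>2"
    using defect_exponential_rate by blast
  obtain C where C: "C \<ge> 0" "\<And>t. t \<ge> 0 \<Longrightarrow> norm (comm_mat (Phi (X t)) (proj t)) \<le> C * norm (defect t)"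
    using proj_speed by blast
  define A where "A = norm (defect s) * exp (c * s / 2)"
  have defect_le: "norm (defect t) \<le> A * exp (- (c / 2) * t)" if t: "t \<ge> s" for t
  proof -
    have "(norm (defect t))\<^sup>2 \<le> (norm (defect s))\<^sup>2 * exp (- c * (t - s))"
      by (rule exponential_decay[OF defect_norm_has_derivative rate s t]) (use s in auto)
    also have "\<dots> = (A * exp (- (c / 2) * t))\<^sup>2"
      by (simp add: A_def power_mult_distrib exp_double[symmetric] mult.assoc exp_add[symmetric] algebra_simps)
    finally show ?thesis by (rule power2_le_imp_le) (simp add: A_def)
  qed
  show "\<exists>L. (proj \<longlongrightarrow> L) at_top"
  proof (rule convergent_if_derivative_decays[of s proj "\<lambda>t. comm_mat (Phi (X t)) (proj t)" "C * A" "c / 2"])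
    fix t assume t: "t \<ge> s"
    show "(proj has_vector_derivative comm_mat (Phi (X t)) (proj t)) (at t within {0..})"
      using t s by (intro proj_has_derivative) auto
    show "norm (comm_mat (Phi (X t)) (proj t)) \<le> C * A * exp (- (c / 2) * t)"
      using C(2)[of t] mult_left_mono[OF defect_le[OF t] C(1)] t s by (simp add: mult.assoc)
  qed (use s c C(1) in \<open>auto simp: A_def\<close>)
qed

end

end

section \<open>Riesz projections\<close>

lemma mat_of_real_mm: "mat (of_real r) ** A = r *\<^sub>R (A :: complex^'n^'n)"
  by (simp add: vec_eq_iff mat_mm_entry scaleR_conv_of_real[where 'a=complex])

text \<open>
  The powers of \<open>A\<close> up to the real dimension of the matrix space are linearly
  dependent, unless two of them coincide.
\<close>
lemma annihilating_polynomial_exists: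
  fixes A :: "complex^'n^'n"
  obtains q :: "complex poly" where "q \<noteq> 0" "pmat q A = 0"
proof -
  define B where "B k = pmat (monom 1 k) A" for k
  define I where "I = {..DIM(complex^'n^'n)}"
  show thesis
  proof (cases "inj_on B I")
    case True
    have "dependent (B ` I)"
      using card_image[OF True] by (intro dependent_biggerset) (simp add: I_def)
    then obtain u where u: "\<exists>v\<in>B ` I. u v \<noteq> 0" "(\<Sum>v\<in>B ` I. u v *\<^sub>R v) = 0"
      using dependent_finite[of "B ` I"] by (auto simp: I_def)
    define q :: "complex poly" where "q = (\<Sum>k\<in>I. smult (of_real (u (B k))) (monom 1 k))"
    have "pmat q A = (\<Sum>k\<in>I. u (B k) *\<^sub>R B k)"
      by (simp add: q_def pmat_sum pmat_smult mat_of_real_mm B_def)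
    also have "\<dots> = 0" using u(2) by (simp add: sum.reindex[OF True])
    finally have 0: "pmat q A = 0" .
    obtain k where k: "k \<in> I" "u (B k) \<noteq> 0" using u(1) by blast
    have "coeff q k = (\<Sum>j\<in>I. if j = k then of_real (u (B j)) else 0)"
      unfolding q_def coeff_sum by (intro sum.cong) auto
    also have "\<dots> = of_real (u (B k))" using k(1) by (simp add: I_def)
    finally have "coeff q k \<noteq> 0" using k(2) by simp
    hence "q \<noteq> 0" by auto
    with 0 show thesis using that by blast
  next
    case False
    then obtain i j where ij: "i \<noteq> j" "B i = B j" by (auto simp: inj_on_def)
    have "coeff (monom 1 i - monom (1::complex) j) i \<noteq> 0" using ij(1) by simp
    hence "monom 1 i - monom (1::complex) j \<noteq> 0" by (metis coeff_0)
    moreover have "pmat (monom 1 i - monom 1 j) A = 0" using ij(2) by (simp add: pmat_diff B_def)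
    ultimately show thesis using that by blast
  qed
qed

text \<open>
  For \<open>e = 1\<close> it is division of \<open>v\<close> by \<open>x - \<mu>\<close>
  with remainder \<open>v(\<mu>)\<close>; multiplying two such identities raises the exponent.
\<close>
lemma bezout_linear_power:
  fixes v :: "complex poly"
  assumes "poly v \<mu> \<noteq> 0"
  shows "\<exists>s t. s * [:- \<mu>, 1:] ^ e + t * v = 1"
proof (induction e)
  case 0
  show ?case by (rule exI[of _ 1], rule exI[of _ 0]) simp
next
  case (Suc e)
  then obtain s t where st: "s * [:- \<mu>, 1:] ^ e + t * v = 1" by blast
  define c where "c = inverse (poly v \<mu>)"
  define w where "w = synthetic_div v \<mu>"
  have "v = [:- \<mu>, 1:] * w + [:poly v \<mu>:]" unfolding w_def by (rule synthetic_div_correct'[symmetric])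
  hence "smult c v = smult c ([:- \<mu>, 1:] * w) + 1"
    using assms by (metis smult_add_right c_def left_inverse pCons_one smult_0_right smult_pCons)
  moreover have "smult c ([:- \<mu>, 1:] * w) = smult c w * [:- \<mu>, 1:]"
    by (metis mult.commute mult_smult_right)
  ultimately have "[:c:] * v = smult c w * [:- \<mu>, 1:] + 1" by simp
  moreover have "(- y) * z + (y * z + 1) = 1" for y z :: "complex poly" by simp
  ultimately have 1: "(- smult c w) * [:- \<mu>, 1:] + [:c:] * v = 1" by (simp only:)
  have "1 = (s * [:- \<mu>, 1:] ^ e + t * v) * ((- smult c w) * [:- \<mu>, 1:] + [:c:] * v)"
    by (simp only: st 1 mult_1)
  also have "\<dots> = (s * (- smult c w)) * [:- \<mu>, 1:] ^ Suc e
      + (s * [:- \<mu>, 1:] ^ e * [:c:] + t * ((- smult c w) * [:- \<mu>, 1:] + [:c:] * v)) * v"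
    by (simp only: distrib_left distrib_right power_Suc mult_ac add_ac)
  finally show ?case by metis
qed

text \<open>
  Modulo \<open>m\<close> this polynomial is the idempotent of the factor
  \<open>(x - \<mu>)\<^sup>e\<close>: if \<open>m = u v\<close> with
  \<open>u = (x - \<mu>)\<^sup>e\<close> and \<open>s u + t v = 1\<close>, it is
  \<open>t v\<close>.
\<close>
lemma riesz_polynomial_exists:
  fixes m :: "complex poly"
  assumes m: "m \<noteq> 0" "poly m \<mu> = 0"
  shows "\<exists>p. m dvd p * p - p \<and> poly p \<mu> = 1 \<and> (\<forall>z. poly m z = 0 \<and> z \<noteq> \<mu> \<longrightarrow> poly p z = 0)"
proof -
  define u where "u = [:- \<mu>, 1:] ^ order \<mu> m"
  obtain v where v: "m = u * v" "\<not> [:- \<mu>, 1:] dvd v"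
    using order_decomp[OF m(1), of \<mu>] by (auto simp: u_def)
  hence "poly v \<mu> \<noteq> 0" by (simp add: poly_eq_0_iff_dvd)
  then obtain s t where st: "s * u + t * v = 1" unfolding u_def using bezout_linear_power by blast
  have "order \<mu> m \<noteq> 0" using m by (simp add: order_root)
  hence u\<mu>: "poly u \<mu> = 0" by (simp add: u_def)
  have uz: "poly u z \<noteq> 0" if "z \<noteq> \<mu>" for z using that by (simp add: u_def)
  have "t * v = 1 - s * u" using st by (simp add: algebra_simps)
  hence "(t * v) * (t * v) - t * v = - (t * s) * m"
    by (subst (2) \<open>t * v = 1 - s * u\<close>) (simp add: v(1) algebra_simps)
  hence "m dvd (t * v) * (t * v) - t * v" by simp
  moreover have "poly (t * v) \<mu> = 1" using arg_cong[OF st, of "\<lambda>p. poly p \<mu>"] u\<mu> by simp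
  moreover have "poly (t * v) z = 0" if "poly m z = 0" "z \<noteq> \<mu>" for z
    using that uz[of z] by (simp add: v(1))
  ultimately show ?thesis by blast
qed

text \<open>
  For normal \<open>Z\<close>, \<open>Z Z B = 0\<close> gives
  \<open>Z\<^sup>* Z B = 0\<close> and so \<open>Z B = 0\<close>.
\<close>
lemma normal_nilpotent_zero:
  fixes N :: "complex^'n^'n"
  assumes n: "adj N ** N = N ** adj N" and k: "pmat (w ^ k) N = 0"
  shows "pmat w N = 0"
  using k
proof (induction k)
  case 0
  hence "mat 1 = (0 :: complex^'n^'n)" by simp
  thus ?case by (metis matrix_mul_rid mm_zero_right)
next
  case (Suc k)
  define Z where "Z = pmat w N"
  have nZ: "adj Z ** Z = Z ** adj Z" unfolding Z_def by (rule normal_pmat[OF n])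
  show ?case
  proof (cases k)
    case 0 thus ?thesis using Suc.prems by simp
  next
    case (Suc j)
    define B where "B = pmat (w ^ j) N"
    have "Z ** (Z ** B) = 0" using Suc.prems \<open>k = Suc j\<close> by (simp add: Z_def B_def pmat_mult)
    hence "adj Z ** (Z ** B) = 0" using norm_normal_mm[OF nZ, of "Z ** B"] by simp
    hence "adj (Z ** B) ** (Z ** B) = 0" by (simp add: adj_mult matrix_mul_assoc[symmetric])
    hence "(norm (Z ** B))\<^sup>2 = 0" unfolding norm_sq_trace by (simp add: trace_def)
    hence "pmat (w ^ k) N = 0" by (simp add: Z_def B_def pmat_mult \<open>k = Suc j\<close>)
    thus ?thesis by (rule Suc.IH)
  qed
qed

lemma normal_mat_iff: "normal_mat N \<longleftrightarrow> adj N ** N = N ** adj N"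
  by (simp add: normal_mat_def)

section \<open>Convergence of the trajectory\<close>

context smooth_flow
begin

text \<open>
  Let \<open>m(T) = 0\<close>, let \<open>p\<^sub>\<mu>\<close> be the Riesz polynomials of
  \<open>m\<close> and \<open>g = \<Sum> \<mu> p\<^sub>\<mu>\<close>. The projections
  \<open>p\<^sub>\<mu>(X)\<close> converge, so \<open>g(X)\<close> has a limit \<open>N\<close>.
  The polynomial \<open>w = x - g\<close> vanishes at all roots of \<open>m\<close>, so
  \<open>m\<close> divides a power of \<open>w\<close>, and \<open>w\<close> annihilates every
  normal limit point \<open>N'\<close> of \<open>X\<close>: \<open>N' = g(N') = N\<close>. A
  bounded trajectory with only one limit point converges.
\<close>
lemma converges_to_normal: "\<exists>N. normal_mat N \<and> (X \<longlongrightarrow> N) at_top"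
proof -
  obtain m :: "complex poly" where m: "m \<noteq> 0" "pmat m (X 0) = 0" by (rule annihilating_polynomial_exists)
  define S where "S = {z. poly m z = 0}"
  have fS: "finite S" unfolding S_def by (rule poly_roots_finite[OF m(1)])
  have "\<forall>\<mu>\<in>S. \<exists>p. m dvd p * p - p \<and> poly p \<mu> = 1 \<and> (\<forall>z. poly m z = 0 \<and> z \<noteq> \<mu> \<longrightarrow> poly p z = 0)"
    using riesz_polynomial_exists[OF m(1)] by (auto simp: S_def)
  from bchoice[OF this] obtain p where P: "\<forall>\<mu>\<in>S. m dvd p \<mu> * p \<mu> - p \<mu> \<and> poly (p \<mu>) \<mu> = 1 \<and>
      (\<forall>z. poly m z = 0 \<and> z \<noteq> \<mu> \<longrightarrow> poly (p \<mu>) z = 0)" by blast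
  have p: "m dvd p \<mu> * p \<mu> - p \<mu>" "poly (p \<mu>) \<mu> = 1" if "\<mu> \<in> S" for \<mu> using P that by blast+
  have p0: "poly (p \<mu>) z = 0" if "\<mu> \<in> S" "z \<in> S" "z \<noteq> \<mu>" for \<mu> z using P that unfolding S_def by blast
  have ann: "pmat q (X t) = 0" if "m dvd q" "t \<ge> 0" for q t
  proof -
    have "pmat m (X t) = 0" by (rule polynomial_identity_preserved[OF m(2) that(2)])
    thus ?thesis using that(1) by (auto simp: dvd_def pmat_mult)
  qed
  have idem: "pmat (p \<mu>) (X t) ** pmat (p \<mu>) (X t) = pmat (p \<mu>) (X t)" if "\<mu> \<in> S" "t \<ge> 0" for \<mu> t
    using ann[OF p(1)[OF that(1)] that(2)] by (simp add: pmat_diff pmat_mult)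
  have "\<forall>\<mu>\<in>S. \<exists>L. ((\<lambda>t. pmat (p \<mu>) (X t)) \<longlongrightarrow> L) at_top"
    using proj_convergent[OF idem] by blast
  then obtain L where L: "\<And>\<mu>. \<mu> \<in> S \<Longrightarrow> ((\<lambda>t. pmat (p \<mu>) (X t)) \<longlongrightarrow> L \<mu>) at_top" by metis
  define g where "g = (\<Sum>\<mu>\<in>S. smult \<mu> (p \<mu>))"
  define N where "N = (\<Sum>\<mu>\<in>S. mat \<mu> ** L \<mu>)"
  have gN: "((\<lambda>t. pmat g (X t)) \<longlongrightarrow> N) at_top"
    unfolding g_def N_def pmat_sum pmat_smult by (intro tendsto_sum tendsto_mm tendsto_const L)
  \<comment> \<open>the nilpotent part of \<open>X\<close>, as a polynomial in \<open>X\<close>\<close>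
  define w where "w = [:0, 1:] - g"
  have "poly w z = 0" if "poly m z = 0" for z
  proof -
    have z: "z \<in> S" using that by (simp add: S_def)
    have "poly g z = (\<Sum>\<mu>\<in>S. if \<mu> = z then z else 0)"
      unfolding g_def poly_sum using p(2) p0 z by (intro sum.cong) auto
    also have "\<dots> = z" using fS z by simp
    finally show ?thesis by (simp add: w_def)
  qed
  hence "m dvd w ^ degree m" using nullstellensatz_univariate[of m w] m(1) by auto
  hence wk: "pmat (w ^ degree m) (X t) = 0" if "t \<ge> 0" for t using ann that by blast
  have limit: "N' = N" if s: "filterlim s at_top sequentially" and N': "(\<lambda>k. X (s k)) \<longlonglongrightarrow> N'" for s N'
  proof -
    have n: "adj N' ** N' = N' ** adj N'" by (rule limit_normal[OF that])
    have "eventually (\<lambda>k. s k \<ge> 0) sequentially" using s by (simp add: filterlim_at_top)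
    hence "eventually (\<lambda>k. pmat (w ^ degree m) (X (s k)) = 0) sequentially"
      by eventually_elim (rule wk)
    hence "(\<lambda>k. pmat (w ^ degree m) (X (s k))) \<longlonglongrightarrow> 0" by (rule tendsto_eventually)
    hence "pmat (w ^ degree m) N' = 0" using LIMSEQ_unique[OF tendsto_pmat[OF N']] by blast
    hence "pmat w N' = 0" by (rule normal_nilpotent_zero[OF n])
    hence "N' = pmat g N'" by (simp add: w_def pmat_diff)
    also have "pmat g N' = N"
      by (rule LIMSEQ_unique[OF tendsto_pmat[OF N'] filterlim_compose[OF gN s]])
    finally show ?thesis .
  qed
  have sub: "\<exists>r. strict_mono r \<and> (\<lambda>k. X (s (r k))) \<longlonglongrightarrow> N"
    if s: "filterlim s at_top sequentially" "\<And>k. s k \<ge> 0" for s :: "nat \<Rightarrow> real"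
  proof -
    have "bounded (range (\<lambda>k. X (s k)))" using norm_X[OF s(2)] by (intro boundedI) auto
    then obtain N' r where r: "strict_mono (r :: nat \<Rightarrow> nat)" "(\<lambda>k. X (s (r k))) \<longlonglongrightarrow> N'"
      using bounded_imp_convergent_subsequence[of "\<lambda>k. X (s k)"] unfolding o_def by blast
    have "filterlim (\<lambda>k. s (r k)) at_top sequentially"
      by (rule filterlim_compose[OF s(1) filterlim_subseq[OF r(1)]])
    hence "N' = N" using r(2) by (rule limit)
    thus ?thesis using r by blast
  qed
  have "(X \<longlongrightarrow> N) at_top"
  proof (rule ccontr)
    assume "\<not> ?thesis"
    then obtain e where e: "e > 0" "\<not> eventually (\<lambda>t. dist (X t) N < e) at_top"
      unfolding tendsto_iff by blast
    hence "\<forall>k::nat. \<exists>t\<ge>real k. dist (X t) N \<ge> e"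
      by (auto simp: eventually_at_top_linorder not_less)
    then obtain s where s: "\<And>k. s k \<ge> real k" "\<And>k. dist (X (s k)) N \<ge> e" by metis
    have "filterlim s at_top sequentially"
      by (rule filterlim_at_top_mono[OF filterlim_real_sequentially]) (use s(1) in auto)
    moreover have "s k \<ge> 0" for k using s(1)[of k] by linarith
    ultimately obtain r where "(\<lambda>k. X (s (r k))) \<longlonglongrightarrow> N" using sub by blast
    from tendstoD[OF this e(1)] show False using s(2) by (auto simp: eventually_sequentially not_less[symmetric])
  qed
  moreover have "normal_mat N"
    unfolding normal_mat_iff
    by (rule limit_normal[OF filterlim_real_sequentially filterlim_compose[OF calculation filterlim_real_sequentially]])
  ultimately show ?thesis by blast
qed

end

section \<open>From singular values to their squares\<close>

lemma flow_eq:
  assumes X: "flow_solution a b \<phi>1 \<phi>2 T X" and t: "t \<ge> 0"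
    and uniq: "\<And>Y. flow_solution a b \<phi>1 \<phi>2 T Y \<Longrightarrow> Y t = X t"
  shows "flow a b \<phi>1 \<phi>2 t T = X t"
  unfolding flow_def
proof (rule the_equality)
  show "\<exists>Y. flow_solution a b \<phi>1 \<phi>2 T Y \<and> Y t = X t" using X by blast
qed (use uniq in blast)

lemma Ck_on_imp_continuous_on: "Ck_on k f S \<Longrightarrow> continuous_on S f"
  by (cases k) (auto simp: continuous_on_eq_continuous_within intro: DERIV_continuous)

text \<open>
  Away from \<open>0\<close> the derivative of \<open>\<phi> \<circ> sqrt\<close> is given by
  the chain rule; it carries the sign condition on
  \<open>\<phi>\<^sub>1' + \<phi>\<^sub>2'\<close> over to the squared variable.
\<close>
lemma compose_sqrt_has_derivative:
  assumes "0 \<le> a" "x \<in> {a\<^sup>2..b\<^sup>2}" "x > 0" "b \<ge> 0"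
    and "\<And>x. x \<in> {a..b} \<Longrightarrow> (\<phi> has_real_derivative \<phi>' x) (at x within {a..b})"
  shows "((\<lambda>x. \<phi> (sqrt x)) has_real_derivative \<phi>' (sqrt x) / (2 * sqrt x)) (at x within {a\<^sup>2..b\<^sup>2})"
proof -
  have im: "sqrt y \<in> {a..b}" if "y \<in> {a\<^sup>2..b\<^sup>2}" for y
    using that real_sqrt_le_iff[of "a\<^sup>2" y] real_sqrt_le_iff[of y "b\<^sup>2"] assms(1,4) by simp
  have "(\<phi> has_real_derivative \<phi>' (sqrt x)) (at (sqrt x) within sqrt ` {a\<^sup>2..b\<^sup>2})"
    by (rule has_field_derivative_subset[OF assms(5)[OF im[OF assms(2)]]]) (rule image_subsetI, rule im)
  moreover have "(sqrt has_real_derivative inverse (sqrt x) / 2) (at x within {a\<^sup>2..b\<^sup>2})"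
    using has_field_derivative_at_within[OF DERIV_real_sqrt[OF assms(3)]] by simp
  ultimately have "((\<phi> \<circ> sqrt) has_real_derivative \<phi>' (sqrt x) * (inverse (sqrt x) / 2)) (at x within {a\<^sup>2..b\<^sup>2})"
    by (rule DERIV_image_chain)
  moreover have "\<phi>' (sqrt x) * (inverse (sqrt x) / 2) = \<phi>' (sqrt x) / (2 * sqrt x)"
    by (simp add: field_simps)
  ultimately show ?thesis by (simp only: o_def)
qed

lemma lipschitz_compose_cut:
  assumes ab: "\<alpha> \<le> \<beta>"
    and d: "\<And>x. x \<in> {\<alpha>..\<beta>} \<Longrightarrow> (\<psi> has_real_derivative \<psi>' x) (at x within {\<alpha>..\<beta>})"
    and c: "continuous_on {\<alpha>..\<beta>} \<psi>'"
  shows "\<exists>K\<ge>0. \<forall>x y. \<bar>\<psi> (cut \<alpha> \<beta> x) - \<psi> (cut \<alpha> \<beta> y)\<bar> \<le> K * \<bar>x - y\<bar>"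
    and "\<exists>B\<ge>0. \<forall>x. \<bar>\<psi> (cut \<alpha> \<beta> x)\<bar> \<le> B"
proof -
  have "bounded (\<psi>' ` {\<alpha>..\<beta>})" using c by (intro compact_imp_bounded compact_continuous_image) auto
  then obtain K where K: "\<And>x. x \<in> {\<alpha>..\<beta>} \<Longrightarrow> \<bar>\<psi>' x\<bar> \<le> K"
    unfolding bounded_iff real_norm_def by blast
  have K0: "K \<ge> 0" using K[of \<alpha>] ab by simp
  have "\<bar>\<psi> (cut \<alpha> \<beta> x) - \<psi> (cut \<alpha> \<beta> y)\<bar> \<le> K * \<bar>x - y\<bar>" for x y
  proof -
    let ?x = "cut \<alpha> \<beta> x" and ?y = "cut \<alpha> \<beta> y"
    have xy: "?x \<in> {\<alpha>..\<beta>}" "?y \<in> {\<alpha>..\<beta>}" using cut_in[OF ab] by auto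
    obtain e where e: "min ?x ?y \<le> e" "e \<le> max ?x ?y" "divdiff \<psi> \<psi>' ?x ?y = \<psi>' e"
      using divdiff_mean_value[of \<alpha> \<beta> \<psi> \<psi>', OF d xy] by metis
    have "e \<in> {\<alpha>..\<beta>}" using e(1,2) xy by (auto simp: min_def max_def split: if_splits)
    hence "\<bar>\<psi>' e * (?x - ?y)\<bar> \<le> K * \<bar>x - y\<bar>"
      unfolding abs_mult using K cut_lipschitz K0 by (intro mult_mono) auto
    thus ?thesis using divdiff_mult[of \<psi> \<psi>' ?x ?y] e(3) by simp
  qed
  thus "\<exists>K\<ge>0. \<forall>x y. \<bar>\<psi> (cut \<alpha> \<beta> x) - \<psi> (cut \<alpha> \<beta> y)\<bar> \<le> K * \<bar>x - y\<bar>" using K0 by blast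
  have "continuous_on {\<alpha>..\<beta>} \<psi>"
    using d by (meson DERIV_continuous continuous_on_eq_continuous_within)
  hence "bounded (\<psi> ` {\<alpha>..\<beta>})" by (intro compact_imp_bounded compact_continuous_image) auto
  then obtain B where B: "\<And>x. x \<in> {\<alpha>..\<beta>} \<Longrightarrow> \<bar>\<psi> x\<bar> \<le> B"
    unfolding bounded_iff real_norm_def by blast
  have "B \<ge> 0" using B[of \<alpha>] ab by simp
  thus "\<exists>B\<ge>0. \<forall>x. \<bar>\<psi> (cut \<alpha> \<beta> x)\<bar> \<le> B" using B cut_in[OF ab] by blast
qed

text \<open>
  The functions \<open>\<psi>\<^sub>i = \<phi>\<^sub>i \<circ> sqrt\<close> of the squared
  singular values are extended by truncation; on matrices with singular values in
  \<open>[a, b]\<close> the truncated vector field is the given one, and uniqueness identifies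
  the solution with the flow.
\<close>
lemma flow_converges_smooth:
  fixes a b :: real and T :: "complex^'n^'n"
  assumes ab: "0 \<le> a" "a \<le> b"
    and mono: "mono_on {a..b} \<phi>1" "mono_on {a..b} \<phi>2"
    and strict: "strict_mono_on {a..b} (\<lambda>x. \<phi>1 x + \<phi>2 x)"
    and d1: "\<And>x. x \<in> {a\<^sup>2..b\<^sup>2} \<Longrightarrow> ((\<lambda>x. \<phi>1 (sqrt x)) has_real_derivative \<psi>1' x) (at x within {a\<^sup>2..b\<^sup>2})"
    and d2: "\<And>x. x \<in> {a\<^sup>2..b\<^sup>2} \<Longrightarrow> ((\<lambda>x. \<phi>2 (sqrt x)) has_real_derivative \<psi>2' x) (at x within {a\<^sup>2..b\<^sup>2})"
    and c: "continuous_on {a\<^sup>2..b\<^sup>2} \<psi>1'" "continuous_on {a\<^sup>2..b\<^sup>2} \<psi>2'"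
    and pos: "\<And>x. x \<in> {a\<^sup>2..b\<^sup>2} - {0} \<Longrightarrow> \<psi>1' x + \<psi>2' x > 0"
    and T: "T \<in> mats_between a b"
  shows "\<exists>N. normal_mat N \<and> ((\<lambda>t. flow a b \<phi>1 \<phi>2 t T) \<longlongrightarrow> N) at_top"
proof -
  define \<alpha> where "\<alpha> = a\<^sup>2"
  define \<beta> where "\<beta> = b\<^sup>2"
  have ab': "\<alpha> \<le> \<beta>" using ab by (simp add: \<alpha>_def \<beta>_def power_mono)
  note d1 = d1[folded \<alpha>_def \<beta>_def] and d2 = d2[folded \<alpha>_def \<beta>_def] and c = c[folded \<alpha>_def \<beta>_def]
    and pos = pos[folded \<alpha>_def \<beta>_def]
  define f1 where "f1 x = \<phi>1 (sqrt (cut \<alpha> \<beta> x))" for x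
  define f2 where "f2 x = \<phi>2 (sqrt (cut \<alpha> \<beta> x))" for x
  have sq: "sqrt x \<in> {a..b}" if "x \<in> {\<alpha>..\<beta>}" for x
    using that real_sqrt_le_iff[of "a\<^sup>2" x] real_sqrt_le_iff[of x "b\<^sup>2"] ab by (simp add: \<alpha>_def \<beta>_def)
  obtain K1 where K1: "K1 \<ge> 0" "\<And>x y. \<bar>f1 x - f1 y\<bar> \<le> K1 * \<bar>x - y\<bar>"
    using lipschitz_compose_cut(1)[OF ab' d1 c(1)] unfolding f1_def by blast
  obtain K2 where K2: "K2 \<ge> 0" "\<And>x y. \<bar>f2 x - f2 y\<bar> \<le> K2 * \<bar>x - y\<bar>"
    using lipschitz_compose_cut(1)[OF ab' d2 c(2)] unfolding f2_def by blast
  obtain B1 where B1: "\<And>x. \<bar>f1 x\<bar> \<le> B1"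
    using lipschitz_compose_cut(2)[OF ab' d1 c(1)] unfolding f1_def by blast
  obtain B2 where B2: "\<And>x. \<bar>f2 x\<bar> \<le> B2"
    using lipschitz_compose_cut(2)[OF ab' d2 c(2)] unfolding f2_def by blast
  have eq: "f1 x = \<phi>1 (sqrt x)" "f2 x = \<phi>2 (sqrt x)" if "x \<in> {\<alpha>..\<beta>}" for x
    using that by (simp_all add: f1_def f2_def cut_id)
  interpret clamped_pair \<alpha> \<beta> "max K1 K2" "max B1 B2" f1 f2
  proof
    show "0 \<le> \<alpha>" "\<alpha> \<le> \<beta>" using ab' by (auto simp: \<alpha>_def)
    show "mono f1" unfolding f1_def
      by (intro monoI mono_onD[OF mono(1)] sq cut_in ab') (simp add: cut_mono)
    show "mono f2" unfolding f2_def
      by (intro monoI mono_onD[OF mono(2)] sq cut_in ab') (simp add: cut_mono)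
    show "\<bar>f1 x - f1 y\<bar> \<le> max K1 K2 * \<bar>x - y\<bar>" for x y
      by (rule order_trans[OF K1(2)]) (simp add: mult_right_mono)
    show "\<bar>f2 x - f2 y\<bar> \<le> max K1 K2 * \<bar>x - y\<bar>" for x y
      by (rule order_trans[OF K2(2)]) (simp add: mult_right_mono)
    show "0 \<le> max K1 K2" using K1 by simp
    show "\<bar>f1 x\<bar> \<le> max B1 B2" "\<bar>f2 x\<bar> \<le> max B1 B2" for x using B1[of x] B2[of x] by auto
    show "f1 (cut \<alpha> \<beta> x) = f1 x" "f2 (cut \<alpha> \<beta> x) = f2 x" for x
      using cut_id[OF cut_in[OF ab', of x]] by (simp_all add: f1_def f2_def)
  qed
  have VV: "comm_mat (phi_mat \<phi>1 \<phi>2 Y) Y = vfield Y" if "spec_in \<alpha> \<beta> (adj Y ** Y)" for Y :: "complex^'n^'n"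
  proof -
    obtain U h where U: "eigdecomp U h (adj Y ** Y)" using hermitian_eigdecomp[of "adj Y ** Y"] by auto
    obtain W k where W: "eigdecomp W k (Y ** adj Y)" using hermitian_eigdecomp[of "Y ** adj Y"] by auto
    have "herm_fun (\<lambda>x. \<phi>1 (sqrt x)) (adj Y ** Y) = herm_fun f1 (adj Y ** Y)"
      by (rule herm_fun_cong[OF U]) (simp add: eq spec_in_gram_eigenvalues(1)[OF that U] del: atLeastAtMost_iff)
    moreover have "herm_fun (\<lambda>x. \<phi>2 (sqrt x)) (Y ** adj Y) = herm_fun f2 (Y ** adj Y)"
      by (rule herm_fun_cong[OF W]) (simp add: eq spec_in_gram_eigenvalues(2)[OF that W] del: atLeastAtMost_iff)
    ultimately show ?thesis by (simp add: phi_mat_eq vfield_def Phi_def)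
  qed
  have mb: "Y \<in> mats_between a b \<longleftrightarrow> spec_in \<alpha> \<beta> (adj Y ** Y)" for Y :: "complex^'n^'n"
    unfolding \<alpha>_def \<beta>_def by (rule mats_between_iff_spec_in[OF ab])
  have sol: "flow_solution a b \<phi>1 \<phi>2 T Y \<longleftrightarrow> Y 0 = T \<and> (\<forall>t\<ge>0. spec_in \<alpha> \<beta> (adj (Y t) ** Y t)) \<and>
      (\<forall>t\<ge>0. (Y has_vector_derivative vfield (Y t)) (at t within {0..}))" for Y
    unfolding flow_solution_def mb using VV by auto
  obtain X where X: "X 0 = T" "\<And>t. t \<ge> 0 \<Longrightarrow> (X has_vector_derivative vfield (X t)) (at t within {0..})"
    "\<And>t. t \<ge> 0 \<Longrightarrow> spec_in \<alpha> \<beta> (adj (X t) ** X t)"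
    using solution_exists[of T] T unfolding mb by metis
  have flow: "flow a b \<phi>1 \<phi>2 t T = X t" if t: "t \<ge> 0" for t
  proof (rule flow_eq[OF _ t])
    show "flow_solution a b \<phi>1 \<phi>2 T X" using X sol by blast
    fix Y assume "flow_solution a b \<phi>1 \<phi>2 T Y"
    hence Y: "Y 0 = T" "\<And>t. t \<ge> 0 \<Longrightarrow> (Y has_vector_derivative vfield (Y t)) (at t within {0..})"
      "\<And>t. t \<ge> 0 \<Longrightarrow> spec_in \<alpha> \<beta> (adj (Y t) ** Y t)" using sol by blast+
    show "Y t = X t" by (rule solution_unique[OF Y(2,3) X(2,3) _ t]) (simp_all add: Y(1) X(1))
  qed
  interpret smooth_flow \<alpha> \<beta> "max K1 K2" "max B1 B2" f1 f2 \<psi>1' \<psi>2' X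
  proof
    fix x assume x: "x \<in> {\<alpha>..\<beta>}"
    show "(f1 has_real_derivative \<psi>1' x) (at x within {\<alpha>..\<beta>})"
      by (rule has_field_derivative_transform_within[OF d1[OF x] zero_less_one x]) (simp add: eq)
    show "(f2 has_real_derivative \<psi>2' x) (at x within {\<alpha>..\<beta>})"
      by (rule has_field_derivative_transform_within[OF d2[OF x] zero_less_one x]) (simp add: eq)
  next
    show "strict_mono_on {\<alpha>..\<beta>} (\<lambda>x. f1 x + f2 x)"
    proof (rule strict_mono_onI)
      fix x y assume xy: "x \<in> {\<alpha>..\<beta>}" "y \<in> {\<alpha>..\<beta>}" "x < y"
      show "f1 x + f2 x < f1 y + f2 y"
        unfolding eq[OF xy(1)] eq[OF xy(2)]
        using strict_mono_onD[OF strict sq[OF xy(1)] sq[OF xy(2)]] xy(3) by simp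
    qed
  qed (use c pos X in auto)
  obtain N where N: "normal_mat N" "(X \<longlongrightarrow> N) at_top" using converges_to_normal by blast
  have "((\<lambda>t. flow a b \<phi>1 \<phi>2 t T) \<longlongrightarrow> N) at_top"
  proof (rule Lim_transform_eventually[OF N(2)])
    show "eventually (\<lambda>t. X t = flow a b \<phi>1 \<phi>2 t T) at_top"
      using eventually_ge_at_top[of 0] by eventually_elim (simp add: flow)
  qed
  with N(1) show ?thesis by blast
qed

text \<open>
  In dimension one all commutators vanish and the flow is constant. The case is separate because
  the smoothness hypothesis then gives no derivative of
  \<open>\<phi>\<^sub>i \<circ> sqrt\<close> at \<open>0\<close>.
\<close>
lemma flow_converges_scalar:
  fixes T :: "complex^'n^'n"
  assumes n: "CARD('n) = 1" and T: "T \<in> mats_between a b"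
  shows "\<exists>N. normal_mat N \<and> ((\<lambda>t. flow a b \<phi>1 \<phi>2 t T) \<longlongrightarrow> N) at_top"
proof -
  obtain i0 :: 'n where "UNIV = {i0}" using n by (auto simp: card_1_singleton_iff)
  hence i0: "i = i0" for i :: 'n by auto
  have comm: "A ** C = C ** A" for A C :: "complex^'n^'n"
    by (simp add: vec_eq_iff mm_entry \<open>UNIV = {i0}\<close> mult.commute) (metis i0)
  have zero: "comm_mat A C = 0" for A C :: "complex^'n^'n" by (simp add: comm_mat_def comm[of A C])
  have flow: "flow a b \<phi>1 \<phi>2 t T = T" if t: "t \<ge> 0" for t
  proof (rule flow_eq[where X = "\<lambda>t. T", OF _ t])
    show "flow_solution a b \<phi>1 \<phi>2 T (\<lambda>t. T)" by (simp add: flow_solution_def zero T)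
    fix Y assume Y: "flow_solution a b \<phi>1 \<phi>2 T Y"
    have "Y t - T = 0"
      by (rule gronwall_zero[where z = "\<lambda>t. Y t - T" and z' = "\<lambda>t. 0" and M = 0, OF _ _ _ t])
         (use Y in \<open>auto simp: flow_solution_def zero intro!: derivative_eq_intros\<close>)
    thus "Y t = T" by simp
  qed
  have "((\<lambda>t. flow a b \<phi>1 \<phi>2 t T) \<longlongrightarrow> T) at_top"
    by (rule tendsto_eventually) (use eventually_ge_at_top[of 0] in eventually_elim, simp add: flow)
  moreover have "normal_mat T" by (simp add: normal_mat_def comm[of T "adj T"])
  ultimately show ?thesis by blast
qed

theorem theorem3p10:
  fixes a b :: real
    and \<phi>1 \<phi>2 \<phi>1' \<phi>2' :: "real \<Rightarrow> real"
    and T :: "complex ^ 'n ^ 'n"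
  assumes "0 \<le> a" and "a \<le> b"
    and "\<And>x. x \<in> {a..b} \<Longrightarrow> (\<phi>1 has_real_derivative \<phi>1' x) (at x within {a..b})"
    and "\<And>x. x \<in> {a..b} \<Longrightarrow> (\<phi>2 has_real_derivative \<phi>2' x) (at x within {a..b})"
    and "continuous_on {a..b} \<phi>1'" and "continuous_on {a..b} \<phi>2'"
    and "mono_on {a..b} \<phi>1" and "mono_on {a..b} \<phi>2"
    and "strict_mono_on {a..b} (\<lambda>x. \<phi>1 x + \<phi>2 x)"
    and "\<And>x. x \<in> {a..b} - {0} \<Longrightarrow> \<phi>1' x + \<phi>2' x > 0"
    and "Ck_on (CARD('n) - 1) (\<lambda>x. \<phi>1 (sqrt x)) {a\<^sup>2..b\<^sup>2}"
    and "Ck_on (CARD('n) - 1) (\<lambda>x. \<phi>2 (sqrt x)) {a\<^sup>2..b\<^sup>2}"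
    and "T \<in> mats_between a b"
  shows "\<exists>N. normal_mat N \<and> ((\<lambda>t. flow a b \<phi>1 \<phi>2 t T) \<longlongrightarrow> N) at_top"
proof (cases "CARD('n) = 1")
  case True
  thus ?thesis using assms(13) by (rule flow_converges_scalar)
next
  case False
  have b: "b \<ge> 0" using assms(1,2) by simp
  have sq: "sqrt x \<in> {a..b}" if "x \<in> {a\<^sup>2..b\<^sup>2}" for x
    using that real_sqrt_le_iff[of "a\<^sup>2" x] real_sqrt_le_iff[of x "b\<^sup>2"] assms(1,2) by simp
  note der1 = compose_sqrt_has_derivative[of a _ b \<phi>1 \<phi>1', OF assms(1) _ _ b assms(3)]
  note der2 = compose_sqrt_has_derivative[of a _ b \<phi>2 \<phi>2', OF assms(1) _ _ b assms(4)]
  have quot_pos: "\<phi>1' (sqrt x) / (2 * sqrt x) + \<phi>2' (sqrt x) / (2 * sqrt x) > 0"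
    if x: "x \<in> {a\<^sup>2..b\<^sup>2}" "x > 0" for x
  proof -
    have "\<phi>1' (sqrt x) + \<phi>2' (sqrt x) > 0" using assms(10)[of "sqrt x"] sq[OF x(1)] x(2) by auto
    thus ?thesis using x(2) by (simp add: add_divide_distrib[symmetric])
  qed
  show ?thesis
  proof (cases "a = 0")
    case False
    hence x0: "x > 0" if "x \<in> {a\<^sup>2..b\<^sup>2}" for x
      using that assms(1) by (smt (verit) atLeastAtMost_iff zero_less_power2)
    \<comment> \<open>for \<open>a > 0\<close> the square root is smooth on the interval and the
      chain rule gives \<open>\<psi>\<^sub>i'\<close>\<close>
    have cont: "continuous_on {a\<^sup>2..b\<^sup>2} (\<lambda>x. \<phi>' (sqrt x) / (2 * sqrt x))" if "continuous_on {a..b} \<phi>'" for \<phi>'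
    proof (intro continuous_on_divide continuous_on_compose2[OF that] continuous_intros)
      show "sqrt ` {a\<^sup>2..b\<^sup>2} \<subseteq> {a..b}" by (rule image_subsetI) (rule sq)
      show "\<forall>x\<in>{a\<^sup>2..b\<^sup>2}. 2 * sqrt x \<noteq> 0" using x0 by fastforce
    qed
    show ?thesis
      by (rule flow_converges_smooth[OF assms(1,2,7,8,9) der1 der2 cont[OF assms(5)] cont[OF assms(6)] _ assms(13)])
         (use x0 quot_pos in blast)+
  next
    case True
    \<comment> \<open>for \<open>a = 0\<close> the derivative at \<open>0\<close> comes from the
      smoothness of \<open>\<psi>\<^sub>i\<close>, and there are at least two
      dimensions\<close>
    define k where "k = CARD('n) - 2"
    have k: "CARD('n) - 1 = Suc k" using \<open>CARD('n) \<noteq> 1\<close> by (simp add: k_def) (metis One_nat_def Suc_diff_Suc Suc_lessI numeral_2_eq_2 zero_less_card_finite)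
    obtain \<psi>1' where p1: "\<And>x. x \<in> {a\<^sup>2..b\<^sup>2} \<Longrightarrow> ((\<lambda>x. \<phi>1 (sqrt x)) has_real_derivative \<psi>1' x) (at x within {a\<^sup>2..b\<^sup>2})"
        and c1: "continuous_on {a\<^sup>2..b\<^sup>2} \<psi>1'"
      using assms(11) unfolding k Ck_on.simps using Ck_on_imp_continuous_on by blast
    obtain \<psi>2' where p2: "\<And>x. x \<in> {a\<^sup>2..b\<^sup>2} \<Longrightarrow> ((\<lambda>x. \<phi>2 (sqrt x)) has_real_derivative \<psi>2' x) (at x within {a\<^sup>2..b\<^sup>2})"
        and c2: "continuous_on {a\<^sup>2..b\<^sup>2} \<psi>2'"
      using assms(12) unfolding k Ck_on.simps using Ck_on_imp_continuous_on by blast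
    have "\<psi>1' x + \<psi>2' x > 0" if x: "x \<in> {a\<^sup>2..b\<^sup>2} - {0}" for x
    proof -
      have xI: "x \<in> {a\<^sup>2..b\<^sup>2}" and x0: "x > 0" using x True by auto
      hence lt: "a\<^sup>2 < b\<^sup>2" using True by auto
      \<comment> \<open>derivatives within a nondegenerate interval are unique, so the sign can be
        read off from the chain rule\<close>
      have "d = e" if "(g has_real_derivative d) (at x within {a\<^sup>2..b\<^sup>2})" "(g has_real_derivative e) (at x within {a\<^sup>2..b\<^sup>2})" for g d e
        using vector_derivative_unique_within_closed_interval[OF lt, of x g d e] that xI
        by (simp add: has_real_derivative_iff_has_vector_derivative)
      hence "\<psi>1' x = \<phi>1' (sqrt x) / (2 * sqrt x)" "\<psi>2' x = \<phi>2' (sqrt x) / (2 * sqrt x)"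
        using p1[OF xI] der1[OF xI x0] p2[OF xI] der2[OF xI x0] by blast+
      thus ?thesis using quot_pos[OF xI x0] by simp
    qed
    thus ?thesis by (intro flow_converges_smooth[OF assms(1,2,7,8,9) p1 p2 c1 c2 _ assms(13)]) auto
  qed
qed

end
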